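(* Let $r\geq 4$ be an integer, let $k$ be an integer with $0<k<r-2$, and let $M_0, M_k, M_{r-2}, M_r>0$ be real numbers. There exists a function $x\in L^r_{\infty,\infty}(\mathbb R)$ such that $$\|x\|=M_0,\quad \|x^{(k)}\|=M_k,\quad \|x^{(r-2)}\|=M_{r-2},\quad \|x^{(r)}\|=M_r$$ if and only if the following two conditions hold: $$\text{a)}\quad M_{r-2}\leq \frac{\|\varphi_{2}\|}{\|\varphi_{r-k}\|^{\frac{2}{r-k}}}\,M_{k}^{\frac{2}{r-k}}\,M_r^{\frac{r-k-2}{r-k}},$$ $$\text{b)}\quad M_0\geq \|\Psi_r(M_{k},M_{r-2},M_r;\cdot)\|,$$ where $\Psi_r(M_k,M_{r-2},M_r;\cdot)$ is the comparison spline defined in the context (its definition presupposes a)).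
   Context: Throughout, $\|\cdot\|$ is the norm of $L_\infty(\mathbb R)$ (essential supremum of the absolute value over $\mathbb R$). For $r\in\mathbb N$, $L^r_\infty(\mathbb R)$ is the space of functions $x:\mathbb R\to\mathbb R$ such that $x^{(r-1)}$ (with $x^{(0)}=x$) exists and is locally absolutely continuous and $x^{(r)}\in L_\infty(\mathbb R)$; $L^r_{\infty,\infty}(\mathbb R):=L^r_\infty(\mathbb R)\cap L_\infty(\mathbb R)$. Euler perfect splines: $\varphi_0(t)=\operatorname{sgn}\sin t$, and $\varphi_r$ is the $r$-th $2\pi$-periodic integral of $\varphi_0$ with zero mean value over the period (i.e. $\varphi_r'=\varphi_{r-1}$ and each $\varphi_j$, $j\ge 1$, is $2\pi$-periodic with zero mean). Comparison splines: for $a\geq 0$ define $\psi_1(a;t)$ on $[0,a+2]$ by $\psi_1(a;t)=t-1$ for $t\in[0,1]$, $\psi_1(a;t)=0$ for $t\in[1,a+1]$, $\psi_1(a;t)=t-a-1$ for $t\in[a+1,a+2]$; extend it evenly to $[-(a+2),0]$ and then periodically with period $4+2a$ to $\mathbb R$. For $r\in\mathbb N$, $\psi_r(a;\cdot)$ is the $(r-1)$-th $(4+2a)$-periodic integral of $\psi_1(a;\cdot)$ with zero mean value over the period (so $\psi_r'(a;t)=\psi_{r-1}(a;t)$ for $r\ge2$ and each $\psi_r(a;\cdot)$ is $(4+2a)$-periodic with zero mean). For $a\ge 0$, $b,\lambda>0$ put $\Psi_{a,b,\lambda}(t):=b\,\psi_r(a;\lambda t)$. If positive numbers $M_k,M_{r-2},M_r$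 satisfy inequality a), then there exist $a\ge 0$, $b>0$, $\lambda>0$ with $\|\Psi^{(s)}_{a,b,\lambda}\|=M_s$ for $s\in\{k,r-2,r\}$; $\Psi_r(M_k,M_{r-2},M_r;t)$ denotes the function $\Psi_{a,b,\lambda}(t)$ with $a,b,\lambda$ chosen in this way. *)

theory Defs
  imports "HOL-Probability.Essential_Supremum"
begin

text \<open>The \<open>j\<close>-th derivative of \<open>x\<close> is \<open>(deriv ^^ j) x\<close>. Where the derivative does not exist,
  \<^const>\<open>deriv\<close> takes one fixed unspecified value; for a locally absolutely continuous function
  this happens only on a null set and is invisible to the norm below.\<close>

definition Linf_norm :: "(real \<Rightarrow> real) \<Rightarrow> ereal" where
  "Linf_norm f = esssup lebesgue (\<lambda>t. ereal \<bar>f t\<bar>)"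

definition Linf :: "(real \<Rightarrow> real) set" where
  "Linf = {f. f \<in> borel_measurable lebesgue \<and> Linf_norm f < \<infinity>}"

definition abs_continuous_on_interval :: "(real \<Rightarrow> real) \<Rightarrow> real \<Rightarrow> real \<Rightarrow> bool" where
  "abs_continuous_on_interval f a b \<longleftrightarrow>
     (\<forall>\<epsilon>>0. \<exists>\<delta>>0. \<forall>(n::nat) (u::nat \<Rightarrow> real) v.
        (\<forall>i<n. a \<le> u i \<and> u i \<le> v i \<and> v i \<le> b) \<longrightarrow>
        disjoint_family_on (\<lambda>i. {u i<..<v i}) {..<n} \<longrightarrow>
        (\<Sum>i<n. v i - u i) < \<delta> \<longrightarrow>
        (\<Sum>i<n. \<bar>f (v i) - f (u i)\<bar>) < \<epsilon>)"

definition locally_abs_continuous :: "(real \<Rightarrow> real) \<Rightarrow> bool" where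
  "locally_abs_continuous f \<longleftrightarrow> (\<forall>a b. abs_continuous_on_interval f a b)"

text \<open>Both spaces are meant for \<open>r \<ge> 1\<close>.\<close>

definition Sobolev_inf :: "nat \<Rightarrow> (real \<Rightarrow> real) set" where
  "Sobolev_inf r = {x.
     (\<forall>j < r - 1. \<forall>t. (deriv ^^ j) x field_differentiable at t) \<and>
     locally_abs_continuous ((deriv ^^ (r - 1)) x) \<and>
     (deriv ^^ r) x \<in> Linf}"

definition Sobolev_inf_inf :: "nat \<Rightarrow> (real \<Rightarrow> real) set" where
  "Sobolev_inf_inf r = Sobolev_inf r \<inter> Linf"

text \<open>For a \<open>T\<close>-periodic \<open>f\<close> with zero mean this is the unique primitive of \<open>f\<close> that is again
  \<open>T\<close>-periodic with zero mean. Interval integrals are oriented, so \<open>t < 0\<close> is covered.\<close>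

definition periodic_primitive :: "real \<Rightarrow> (real \<Rightarrow> real) \<Rightarrow> real \<Rightarrow> real" where
  "periodic_primitive T f t =
     (LBINT s=0..t. f s) - (LBINT u=0..T. (LBINT s=0..u. f s)) / T"

definition euler_spline :: "nat \<Rightarrow> real \<Rightarrow> real" where
  "euler_spline r = (periodic_primitive (2 * pi) ^^ r) (\<lambda>t. sgn (sin t))"

definition psi1_base :: "real \<Rightarrow> real \<Rightarrow> real" where
  "psi1_base a t = (if t \<le> 1 then t - 1 else if t \<le> a + 1 then 0 else t - a - 1)"

text \<open>Subtracting the nearest multiple of the period \<open>4 + 2 * a\<close> moves \<open>t\<close> into
  \<open>[-(a + 2), a + 2]\<close>; the absolute value then gives the even extension from \<open>[0, a + 2]\<close>.\<close>

definition psi1 :: "real \<Rightarrow> real \<Rightarrow> real" where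
  "psi1 a t = psi1_base a \<bar>t - (4 + 2 * a) * of_int (round (t / (4 + 2 * a)))\<bar>"

definition psi :: "nat \<Rightarrow> real \<Rightarrow> real \<Rightarrow> real" where
  "psi r a = (periodic_primitive (4 + 2 * a) ^^ (r - 1)) (psi1 a)"

definition Psi :: "nat \<Rightarrow> real \<Rightarrow> real \<Rightarrow> real \<Rightarrow> real \<Rightarrow> real" where
  "Psi r a b l t = b * psi r a (l * t)"

text \<open>Under the inequality relating \<open>Mk\<close>, \<open>Mr2\<close>, \<open>Mr\<close> (norms of the derivatives of orders
  \<open>k\<close>, \<open>r - 2\<close>, \<open>r\<close>) suitable parameters exist. They are unique: the norm of \<open>psi 2 a\<close> is
  \<open>1/2\<close> for all \<open>a\<close>, which fixes \<open>l\<close> and \<open>b\<close>, and the norm of \<open>psi (r - k) a\<close> is strictly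
  increasing in \<open>a\<close>. Hence the choice below is no real choice.\<close>

definition comparison_spline :: "nat \<Rightarrow> nat \<Rightarrow> real \<Rightarrow> real \<Rightarrow> real \<Rightarrow> real \<Rightarrow> real" where
  "comparison_spline r k Mk Mr2 Mr =
     (SOME F. \<exists>a b l. a \<ge> 0 \<and> b > 0 \<and> l > 0 \<and> F = Psi r a b l \<and>
        Linf_norm ((deriv ^^ k) F) = ereal Mk \<and>
        Linf_norm ((deriv ^^ (r - 2)) F) = ereal Mr2 \<and>
        Linf_norm ((deriv ^^ r) F) = ereal Mr)"

end

theory Submission
  imports Defs
begin

text \<open>The necessity of both conditions rests on a comparison: let \<open>x\<close> be no larger in norm than
  \<open>psi r a\<close>, with \<open>x\<^bsup>(r)\<^esup>\<close> bounded by \<open>1\<close> and \<open>x\<^bsup>(r-2)\<^esup>\<close> bounded by \<open>1/2\<close> (the latter being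
  superfluous for \<open>a = 0\<close>). Then each \<open>x\<^bsup>(j)\<^esup>\<close> is no larger than \<open>psi (r - j) a\<close>. It suffices to
  treat \<open>j = 1\<close> and, replacing \<open>x\<close> by \<open>x (l sin (t / l))\<close> with \<open>l\<close> large, periodic \<open>x\<close>. If \<open>x'\<close> were
  too large somewhere, a translate of \<open>x\<close> would meet the spline there with larger slope, and the
  difference would have two more sign changes per period than the spline. By Rolle's theorem so
  would its derivatives up to order \<open>r - 2\<close>, where the bounds permit only as many as the spline has.

  Strictness comes from decreasing \<open>a\<close> a little or, for \<open>a = 0\<close>, from rescaling the argument. That
  the norm of \<open>x\<^bsup>(r)\<^esup>\<close> is a Lipschitz constant of \<open>x\<^bsup>(r-1)\<^esup>\<close> needs the almost everywhere
  differentiability of absolutely continuous functions, obtained from Vitali's covering theorem.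
  Conversely the comparison spline plus a constant has the prescribed norms, since \<open>k > 0\<close>.\<close>

section \<open>Absolutely continuous functions are differentiable almost everywhere\<close>

text \<open>The norm of \<open>psi 2 a\<close> is 1/2 for every \<open>a\<close>. After
  normalization the bound on the derivative of order \<open>r - 2\<close> is therefore the same for
  all parameters, so one function may be compared with splines of different parameters; without
  this, lowering \<open>a\<close> would be impossible. Sign changes are counted cyclically because
  on an interval Rolle's theorem loses one with each differentiation. This calls for a periodization
  that spoils no bound on any derivative. Composition with \<open>l * sin (t / l)\<close> does this:
  it keeps value and slope at 0, the leading term of its \<open>j\<close>-th derivative is
  \<open>X j\<close> times a power of a cosine, and every other term carries a factor
  \<open>1 / l\<close>. To make those terms small, the intermediate derivatives must be known to be
  bounded. The remaining error is absorbed by first shrinking the function by a factor below 1,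
  which also supplies the strict inequality at the extrema of the spline.\<close>

abbreviation increments :: "(real \<Rightarrow> real) \<Rightarrow> (real \<times> real) set \<Rightarrow> real" where
  "increments h D \<equiv> \<Sum>(p, q)\<in>D. h q - h p"

abbreviation total_length :: "(real \<times> real) set \<Rightarrow> real" where
  "total_length D \<equiv> \<Sum>(p, q)\<in>D. q - p"

abbreviation interval_union :: "(real \<times> real) set \<Rightarrow> real set" where
  "interval_union D \<equiv> \<Union>(p, q)\<in>D. {p..q}"

abbreviation disjoint_intervals :: "(real \<times> real) set \<Rightarrow> bool" where
  "disjoint_intervals D \<equiv> disjoint_family_on (\<lambda>(p, q). {p..q}) D"

text \<open>Finite sets of pairs instead of indexed families allow intervals to be collected and
  removed without renumbering. Disjointness concerns the open intervals, so neighbours may share an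
  endpoint.\<close>

lemma abs_continuous_finite_set:
  assumes ac: "abs_continuous_on_interval f a b" and "\<epsilon> > 0"
  obtains \<delta> where "\<delta> > 0"
    "\<And>D. \<lbrakk>finite D; \<And>p q. (p, q) \<in> D \<Longrightarrow> a \<le> p \<and> p \<le> q \<and> q \<le> b;
        disjoint_family_on (\<lambda>(p, q). {p<..<q}) D; total_length D < \<delta>\<rbrakk>
      \<Longrightarrow> (\<Sum>(p, q)\<in>D. \<bar>f q - f p\<bar>) < \<epsilon>"
proof -
  obtain \<delta> where "\<delta> > 0" and \<delta>: "\<And>(n::nat) u v. \<lbrakk>\<forall>i<n. a \<le> u i \<and> u i \<le> v i \<and> v i \<le> b;
        disjoint_family_on (\<lambda>i. {u i<..<v i}) {..<n}; (\<Sum>i<n. v i - u i) < \<delta>\<rbrakk>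
      \<Longrightarrow> (\<Sum>i<n. \<bar>f (v i) - f (u i)\<bar>) < \<epsilon>"
    using ac \<open>\<epsilon> > 0\<close> unfolding abs_continuous_on_interval_def by meson
  show ?thesis
  proof (rule that[OF \<open>\<delta> > 0\<close>])
    fix D :: "(real \<times> real) set"
    assume D: "finite D" "\<And>p q. (p, q) \<in> D \<Longrightarrow> a \<le> p \<and> p \<le> q \<and> q \<le> b"
      "disjoint_family_on (\<lambda>(p, q). {p<..<q}) D" "total_length D < \<delta>"
    obtain h where h: "bij_betw h {..<card D} D"
      using ex_bij_betw_nat_finite[OF D(1)] by (auto simp: atLeast0LessThan)
    have hD: "h i \<in> D" if "i < card D" for i
      using h that by (auto simp: bij_betw_def)
    have inj: "h i \<noteq> h j" if "i < card D" "j < card D" "i \<noteq> j" for i j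
      using h that by (auto simp: bij_betw_def inj_on_def)
    have s: "(\<Sum>i<card D. g (h i)) = sum g D" for g :: "real \<times> real \<Rightarrow> real"
      by (rule sum.reindex_bij_betw[OF h])
    have "(\<Sum>i<card D. \<bar>f (snd (h i)) - f (fst (h i))\<bar>) < \<epsilon>"
    proof (rule \<delta>)
      show "\<forall>i<card D. a \<le> fst (h i) \<and> fst (h i) \<le> snd (h i) \<and> snd (h i) \<le> b"
        using D(2) hD by (metis prod.collapse)
      show "disjoint_family_on (\<lambda>i. {fst (h i)<..<snd (h i)}) {..<card D}"
        using D(3) hD inj unfolding disjoint_family_on_def case_prod_beta by (metis lessThan_iff)
      show "(\<Sum>i<card D. snd (h i) - fst (h i)) < \<delta>"
        using D(4) s[of "\<lambda>x. snd x - fst x"] by (simp add: case_prod_beta)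
    qed
    then show "(\<Sum>(p, q)\<in>D. \<bar>f q - f p\<bar>) < \<epsilon>"
      using s[of "\<lambda>x. \<bar>f (snd x) - f (fst x)\<bar>"] by (simp add: case_prod_beta)
  qed
qed

text \<open>Peeling off the rightmost interval leaves the gap between it and \<open>q\<close>. One
  family \<open>G\<close> serves every \<open>h\<close>: the identity yields the total length of the
  gaps, \<open>f\<close> the increment over them.\<close>

lemma complementary_intervals:
  fixes D :: "(real \<times> real) set"
  assumes "finite D" "p \<le> q" "\<And>u v. (u, v) \<in> D \<Longrightarrow> p \<le> u \<and> u < v \<and> v \<le> q"
    and "disjoint_intervals D"
  shows "\<exists>G. finite G \<and> (\<forall>(u, v)\<in>G. p \<le> u \<and> u \<le> v \<and> v \<le> q) \<and>
     disjoint_family_on (\<lambda>(u, v). {u<..<v}) G \<and>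
     (\<forall>h::real\<Rightarrow>real. h q - h p = increments h D + increments h G)"
  using assms
proof (induction "card D" arbitrary: D q)
  case 0
  then have "D = {}" by simp
  then show ?case
    using 0 by (intro exI[of _ "{(p, q)}"]) (auto simp: disjoint_family_on_def)
next
  case (Suc n)
  define u where "u = Max (fst ` D)"
  have "D \<noteq> {}" using Suc(2) by auto
  then have "u \<in> fst ` D" unfolding u_def using Suc(3) by (intro Max_in) auto
  then obtain v where uv: "(u, v) \<in> D" by auto
  have umax: "x \<le> u" if "(x, y) \<in> D" for x y
    unfolding u_def using that Suc(3) by (intro Max_ge) (auto intro: rev_image_eqI)
  let ?D = "D - {(u, v)}"
  have below: "y < u" if xy: "(x, y) \<in> ?D" for x y
  proof -
    have "{x..y} \<inter> {u..v} = {}"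
      using Suc.prems(4) xy uv unfolding disjoint_family_on_def by (metis (mono_tags, lifting) Diff_iff insertCI old.prod.case)
    moreover have "x \<le> u" "x < y" "u < v"
      using umax[of x y] xy Suc.prems(3) uv by auto
    ultimately show ?thesis by (metis Int_iff atLeastAtMost_iff empty_iff less_imp_le not_le order_refl)
  qed
  have "\<exists>G. finite G \<and> (\<forall>(x, y)\<in>G. p \<le> x \<and> x \<le> y \<and> y \<le> u) \<and>
     disjoint_family_on (\<lambda>(u, v). {u<..<v}) G \<and>
     (\<forall>h::real\<Rightarrow>real. h u - h p = increments h ?D + increments h G)"
  proof (rule Suc.hyps(1))
    show "n = card ?D" using Suc.hyps(2) uv Suc.prems(1) by simp
    show "p \<le> u" using Suc.prems(3)[OF uv] by simp
    show "p \<le> x \<and> x < y \<and> y \<le> u" if "(x, y) \<in> ?D" for x y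
      using Suc.prems(3)[of x y] below[OF that] that by auto
    show "disjoint_intervals ?D"
      using Suc.prems(4) by (rule disjoint_family_on_mono[rotated]) auto
  qed (use Suc.prems(1) in auto)
  then obtain G where G0: "finite G" "\<forall>(x, y)\<in>G. p \<le> x \<and> x \<le> y \<and> y \<le> u"
     "disjoint_family_on (\<lambda>(u, v). {u<..<v}) G"
     "\<forall>h::real\<Rightarrow>real. h u - h p = increments h ?D + increments h G"
    by (elim exE conjE) (rule that)
  have G: "finite G" "\<And>x y. (x, y)\<in>G \<Longrightarrow> p \<le> x \<and> x \<le> y \<and> y \<le> u"
     "disjoint_family_on (\<lambda>(u, v). {u<..<v}) G"
     "\<And>h::real\<Rightarrow>real. h u - h p = increments h ?D + increments h G"
    using G0(1,3) bspec[OF G0(2)] spec[OF G0(4)] by auto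
  have uvb: "p \<le> u" "u < v" "v \<le> q" using Suc.prems(3)[OF uv] by auto
  have nin: "(v, q) \<notin> G" using G(2)[of v q] uvb by auto
  show ?case
  proof (intro exI[of _ "insert (v, q) G"] conjI allI)
    show "\<forall>(x, y)\<in>insert (v, q) G. p \<le> x \<and> x \<le> y \<and> y \<le> q"
      using G(2) uvb by fastforce
    show "disjoint_family_on (\<lambda>(u, v). {u<..<v}) (insert (v, q) G)"
      using G(3) nin G(2) uvb by (subst disjoint_family_on_insert) (fastforce simp: Int_def)+
    fix h :: "real \<Rightarrow> real"
    have "increments h D = (h v - h u) + increments h ?D"
      using uv Suc.prems(1) by (subst sum.remove[of D "(u, v)"]) auto
    then show "h q - h p = increments h D + (\<Sum>(u, v)\<in>insert (v, q) G. h v - h u)"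
      using G(4)[of h] nin G(1) by simp
  qed (use G in simp)
qed

section \<open>Vitali covers by intervals and measurable hulls\<close>

lemma measure_disjoint_intervals:
  fixes C :: "(real \<times> real) set"
  assumes "finite C" "disjoint_intervals C" "\<And>p q. (p, q) \<in> C \<Longrightarrow> p < q"
  shows "measure lebesgue (interval_union C) = total_length C"
    and "interval_union C \<in> lmeasurable"
proof -
  have "measure lebesgue (interval_union C) = (\<Sum>i\<in>C. measure lebesgue (case i of (p, q) \<Rightarrow> {p..q}))"
    using assms by (intro measure_finite_Union) (auto simp: emeasure_lborel_Icc_eq)
  also have "\<dots> = total_length C"
    using assms(3) by (intro sum.cong) (auto simp: measure_lborel_Icc less_imp_le)
  finally show "measure lebesgue (interval_union C) = total_length C" .
  show "interval_union C \<in> lmeasurable"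
    using assms(1) by (intro fmeasurable.finite_UN) (auto simp: case_prod_beta)
qed

text \<open>The intervals satisfying \<open>P\<close> form a Vitali cover at \<open>x\<close>. Since
  \<open>x\<close> may be an endpoint, the negation of \<open>fine_at\<close> controls all
  difference quotients taken at \<open>x\<close> itself, on both sides.\<close>

definition fine_at :: "(real \<Rightarrow> real \<Rightarrow> bool) \<Rightarrow> real \<Rightarrow> bool" where
  "fine_at P x \<longleftrightarrow> (\<forall>e>0. \<exists>p q. p < q \<and> p \<le> x \<and> x \<le> q \<and> q - p < e \<and> P p q)"

lemma vitali_intervals:
  fixes S :: "real set"
  assumes "open U" "S \<subseteq> U"
    and P: "\<And>x. x \<in> S \<Longrightarrow> fine_at P x"
  obtains C where "countable C" "\<And>p q. (p, q) \<in> C \<Longrightarrow> p < q \<and> {p..q} \<subseteq> U \<and> P p q"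
    "disjoint_intervals C" "negligible (S - interval_union C)"
proof -
  let ?K = "{(p, q). p < q \<and> {p..q} \<subseteq> U \<and> P p q}"
  let ?a = "\<lambda>(p, q). (p + q) / 2 :: real" and ?r = "\<lambda>(p, q). (q - p) / 2 :: real"
  have cb: "cball (?a i) (?r i) = (case i of (p, q) \<Rightarrow> {p..q})" for i
    by (cases i) (auto simp: cball_eq_atLeastAtMost field_simps)
  have "\<exists>i. i \<in> ?K \<and> x \<in> cball (?a i) (?r i) \<and> ?r i < d" if "x \<in> S" "d > 0" for x d
  proof -
    obtain e where "e > 0" and e: "cball x e \<subseteq> U"
      using \<open>open U\<close> \<open>S \<subseteq> U\<close> \<open>x \<in> S\<close> by (meson open_contains_cball subsetD)
    obtain p q where pq: "p < q" "p \<le> x" "x \<le> q" "q - p < min d e" "P p q"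
      using P[OF \<open>x \<in> S\<close>] \<open>d > 0\<close> \<open>e > 0\<close> unfolding fine_at_def by (meson min_less_iff_conj)
    have "{p..q} \<subseteq> cball x e"
      using pq by (auto simp: cball_eq_atLeastAtMost)
    then show ?thesis
      using pq e by (intro exI[of _ "(p, q)"]) (simp add: cb[of "(p, q)", simplified] order_trans[OF _ e])
  qed
  note cover = this
  obtain C where C: "countable C" "C \<subseteq> ?K"
     "pairwise (\<lambda>i j. disjnt (cball (?a i) (?r i)) (cball (?a j) (?r j))) C"
     "negligible (S - (\<Union>i \<in> C. cball (?a i) (?r i)))"
  proof (rule Vitali_covering_theorem_cballs[of ?K ?r S ?a])
    show "0 < ?r i" if "i \<in> ?K" for i using that by auto
  qed (erule (1) cover, erule (3) that)
  show thesis
  proof (rule that[OF C(1)])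
    show "disjoint_intervals C"
      using C(3)[unfolded cb] unfolding pairwise_def disjnt_def disjoint_family_on_def .
    show "negligible (S - interval_union C)"
      using C(4) unfolding cb .
  qed (use C(2) in auto)
qed

text \<open>\<open>S\<close> need not be measurable. The hypothesis on \<open>H\<close> says that
  \<open>H\<close> is a measurable hull of \<open>S\<close>: the countable Vitali family fills
  \<open>H\<close> up to a null set, and continuity of the measure from above permits truncation to
  finitely many intervals.\<close>

lemma vitali_intervals_finite:
  fixes S :: "real set"
  assumes "open U" "S \<subseteq> U"
    and P: "\<And>x. x \<in> S \<Longrightarrow> fine_at P x"
    and H: "H \<in> lmeasurable" "\<And>B. \<lbrakk>B \<in> sets lebesgue; negligible (S - B)\<rbrakk> \<Longrightarrow> negligible (H - B)"
    and "\<epsilon> > 0"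
  obtains C where "finite C" "\<And>p q. (p, q) \<in> C \<Longrightarrow> p < q \<and> {p..q} \<subseteq> U \<and> P p q"
    "disjoint_intervals C" "measure lebesgue (H - interval_union C) < \<epsilon>"
    "interval_union C \<in> lmeasurable" "measure lebesgue (interval_union C) = total_length C"
    "measure lebesgue H < total_length C + \<epsilon>"
proof -
  obtain C where C: "countable C" "\<And>p q. (p, q) \<in> C \<Longrightarrow> p < q \<and> {p..q} \<subseteq> U \<and> P p q"
    "disjoint_intervals C" "negligible (S - interval_union C)"
    by (rule vitali_intervals[OF assms(1,2), of P])
      (rule P, assumption, rule that, assumption+)
  define A where "A n = H - (\<Union>(p, q)\<in>C \<inter> from_nat_into C ` {..<n}. {p..q})" for n
  have Am: "A n \<in> lmeasurable" for n
    unfolding A_def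
    by (intro fmeasurable_Diff H(1) sets.finite_UN) auto
  have "(\<Inter>n. A n) \<subseteq> H - interval_union C"
  proof
    fix x assume x: "x \<in> (\<Inter>n. A n)"
    have False if pq: "(p, q) \<in> C" "x \<in> {p..q}" for p q
    proof -
      obtain n where "from_nat_into C n = (p, q)"
        using from_nat_into_surj[OF C(1) pq(1)] by blast
      then have "(p, q) \<in> C \<inter> from_nat_into C ` {..<Suc n}"
        using pq(1) by (metis IntI imageI lessI lessThan_iff)
      then have "x \<notin> A (Suc n)" using pq(2) unfolding A_def by blast
      then show False using x by blast
    qed
    then show "x \<in> H - interval_union C"
      using x unfolding A_def by fast
  qed
  moreover have "negligible (H - interval_union C)"
    using C(1,4) by (intro H(2) sets.countable_UN') (auto simp: split_def)
  ultimately have "negligible (\<Inter>n. A n)" by (rule negligible_subset[rotated])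
  then have "measure lebesgue (\<Inter>n. A n) = 0" by (rule negligible_imp_measure0)
  moreover have "(\<lambda>n. measure lebesgue (A n)) \<longlonglongrightarrow> measure lebesgue (\<Inter>n. A n)"
    using Am by (intro Lim_measure_decseq)
      (fastforce simp: decseq_def A_def fmeasurable_def less_top[symmetric])+
  ultimately have "\<forall>\<^sub>F n in sequentially. measure lebesgue (A n) < \<epsilon>"
    using \<open>\<epsilon> > 0\<close> by (simp add: order_tendsto_iff)
  then obtain n where n: "measure lebesgue (A n) < \<epsilon>"
    by (auto simp: eventually_sequentially)
  let ?C = "C \<inter> from_nat_into C ` {..<n}" and ?I = "\<Union>(p, q)\<in>C \<inter> from_nat_into C ` {..<n}. {p..q}"
  have small: "measure lebesgue (H - ?I) < \<epsilon>" using n by (simp add: A_def)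
  have C': "finite ?C" "\<And>p q. (p, q) \<in> ?C \<Longrightarrow> p < q \<and> {p..q} \<subseteq> U \<and> P p q"
    using C(2) by auto
  have dis: "disjoint_intervals ?C"
    using C(3) by (rule disjoint_family_on_mono[rotated]) auto
  have I: "measure lebesgue ?I = total_length ?C" "?I \<in> lmeasurable"
    using measure_disjoint_intervals[OF C'(1) dis] C'(2) by blast+
  have "measure lebesgue H \<le> measure lebesgue (?I \<union> (H - ?I))"
    using H(1) I(2) by (intro measure_mono_fmeasurable) auto
  also have "\<dots> \<le> measure lebesgue ?I + measure lebesgue (H - ?I)"
    using H(1) I(2) by (intro measure_Un_le) auto
  finally have fin: "measure lebesgue H < total_length ?C + \<epsilon>" using small I(1) by linarith
  show ?thesis
  proof (rule that[of ?C])
    show "p < q \<and> {p..q} \<subseteq> U \<and> P p q" if "(p, q) \<in> ?C" for p q by (rule C'(2)[OF that])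
  qed (fact C'(1), fact dis, fact small, fact I(2), fact I(1), fact fin)
qed

text \<open>Take a measurable superset whose measure is the outer measure of \<open>S\<close>. If
  \<open>H - B\<close> had positive measure, \<open>H \<inter> B\<close> together with the null set
  \<open>S - B\<close> would be a smaller measurable superset. The bounding interval makes the
  measure finite, so that measures can be subtracted.\<close>

lemma measure_hull:
  fixes S :: "real set"
  assumes "S \<subseteq> {a<..<b}"
  obtains H where "H \<in> lmeasurable" "S \<subseteq> H" "H \<subseteq> {a<..<b}"
    "\<And>B. \<lbrakk>B \<in> sets lebesgue; negligible (S - B)\<rbrakk> \<Longrightarrow> negligible (H - B)"
proof -
  obtain E where E: "E \<in> sets lebesgue" "S \<subseteq> E" "outer_measure_of lebesgue S = emeasure lebesgue E"
    using outer_measure_of_attain[of S lebesgue] by auto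
  let ?H = "E \<inter> {a<..<b}"
  have Hs: "?H \<in> sets lebesgue" using E by auto
  have Hm: "?H \<in> lmeasurable"
    using Hs by (intro bounded_set_imp_lmeasurable) (auto intro: bounded_subset[of "{a<..<b}"])
  have out: "emeasure lebesgue ?H \<le> emeasure lebesgue B" if "S \<subseteq> B" "B \<in> sets lebesgue" for B
  proof -
    have "emeasure lebesgue ?H \<le> emeasure lebesgue E" by (intro emeasure_mono) (use E in auto)
    also have "\<dots> = outer_measure_of lebesgue S" using E by simp
    also have "\<dots> \<le> emeasure lebesgue B"
      unfolding outer_measure_of_def using that by (intro INF_lower) auto
    finally show ?thesis .
  qed
  show ?thesis
  proof (rule that[OF Hm])
    fix B :: "real set" assume B: "B \<in> sets lebesgue" "negligible (S - B)"
    let ?B = "(?H \<inter> B) \<union> (S - B)"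
    have SB: "S - B \<in> sets lebesgue" "emeasure lebesgue (S - B) = 0"
      using B(2) by (auto simp: negligible_iff_null_sets)
    have "emeasure lebesgue ?H \<le> emeasure lebesgue ?B"
      using E B assms SB Hs by (intro out) auto
    also have "\<dots> \<le> emeasure lebesgue (?H \<inter> B) + emeasure lebesgue (S - B)"
      using Hs B(1) SB(1) by (intro emeasure_subadditive) auto
    finally have le: "emeasure lebesgue ?H \<le> emeasure lebesgue (?H \<inter> B)" using SB by simp
    have fin2: "emeasure lebesgue ?H \<noteq> \<infinity>"
      using fmeasurableD2[OF Hm] by simp
    have "emeasure lebesgue (?H \<inter> B) \<le> emeasure lebesgue ?H"
      by (rule emeasure_mono[OF _ Hs]) auto
    then have fin: "emeasure lebesgue (?H \<inter> B) \<noteq> \<infinity>"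
      using fin2 by (metis infinity_ennreal_def neq_top_trans)
    have "emeasure lebesgue (?H - ?H \<inter> B) = emeasure lebesgue ?H - emeasure lebesgue (?H \<inter> B)"
      using Hs B(1) fin by (intro emeasure_Diff) auto
    also have "\<dots> = 0" using le fin2 by (simp add: diff_eq_0_iff_ennreal less_top[symmetric])
    finally show "negligible (?H - B)"
      using Hs B(1) by (auto simp: negligible_iff_null_sets null_sets_def Diff_Int)
  qed (use E assms in auto)
qed

section \<open>Absolute continuity tested on Vitali families\<close>

definition nested_intervals :: "real \<Rightarrow> real \<Rightarrow> (real \<times> real) set \<Rightarrow> (real \<times> real) set \<Rightarrow> bool" where
  "nested_intervals a b I J \<longleftrightarrow> finite I \<and> finite J \<and> (\<forall>(p, q)\<in>I. a \<le> p \<and> p < q \<and> q \<le> b) \<and>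
     disjoint_intervals I \<and> disjoint_intervals J \<and> (\<forall>(u, v)\<in>J. u < v \<and> (\<exists>(p, q)\<in>I. p \<le> u \<and> v \<le> q))"

text \<open>What \<open>J\<close> leaves of \<open>I\<close> consists of finitely many gaps, whose
  total length is the difference of the two total lengths; absolute continuity then bounds the
  increments of \<open>f\<close> over the gaps.\<close>

lemma abs_continuous_small_gaps:
  assumes "abs_continuous_on_interval f a b" and "\<epsilon> > 0"
  obtains \<delta> where "\<delta> > 0"
    "\<And>I J. \<lbrakk>nested_intervals a b I J; total_length I - total_length J < \<delta>\<rbrakk>
      \<Longrightarrow> \<bar>increments f I - increments f J\<bar> < \<epsilon>"
proof -
  obtain \<delta> where "\<delta> > 0" and \<delta>:
    "\<And>D. \<lbrakk>finite D; \<And>p q. (p, q) \<in> D \<Longrightarrow> a \<le> p \<and> p \<le> q \<and> q \<le> b;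
        disjoint_family_on (\<lambda>(p, q). {p<..<q}) D; total_length D < \<delta>\<rbrakk>
      \<Longrightarrow> (\<Sum>(p, q)\<in>D. \<bar>f q - f p\<bar>) < \<epsilon>"
    using abs_continuous_finite_set[OF assms] by metis
  show ?thesis
  proof (rule that[OF \<open>\<delta> > 0\<close>])
    fix I J :: "(real \<times> real) set"
    assume nested: "nested_intervals a b I J" and small: "total_length I - total_length J < \<delta>"
    have fin: "finite I" "finite J" and I: "\<And>p q. (p, q) \<in> I \<Longrightarrow> a \<le> p \<and> p < q \<and> q \<le> b"
      and dis: "disjoint_intervals I" "disjoint_intervals J"
      and J: "\<And>u v. (u, v) \<in> J \<Longrightarrow> u < v \<and> (\<exists>(p, q)\<in>I. p \<le> u \<and> v \<le> q)"
      using nested unfolding nested_intervals_def by blast+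
    define K where "K i = {j\<in>J. fst i \<le> fst j \<and> snd j \<le> snd i}" for i
    have Iuniq: "i = i'" if "i \<in> I" "i' \<in> I" "x \<in> {fst i..snd i}" "x \<in> {fst i'..snd i'}" for i i' x
      using dis(1) that unfolding disjoint_family_on_def case_prod_beta by blast
    define Q where "Q i G \<longleftrightarrow> finite G \<and> (\<forall>(u, v)\<in>G. fst i \<le> u \<and> u \<le> v \<and> v \<le> snd i) \<and>
       disjoint_family_on (\<lambda>(u, v). {u<..<v}) G \<and>
       (\<forall>h::real\<Rightarrow>real. h (snd i) - h (fst i) = increments h (K i) + increments h G)"
      for i G
    have "\<exists>G. Q i G" if "i \<in> I" for i
      unfolding Q_def
    proof (rule complementary_intervals)
      show "finite (K i)" using fin by (simp add: K_def)
      show "fst i \<le> snd i" using I[of "fst i" "snd i"] that by simp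
      show "fst i \<le> u \<and> u < v \<and> v \<le> snd i" if "(u, v) \<in> K i" for u v
        using that J[of u v] by (simp add: K_def)
      show "disjoint_intervals (K i)"
        using dis(2) by (rule disjoint_family_on_mono[rotated]) (auto simp: K_def)
    qed
    then obtain G where GQ: "\<And>i. i \<in> I \<Longrightarrow> Q i (G i)"
      by metis
    have G: "finite (G i)" "\<And>u v. (u, v)\<in>G i \<Longrightarrow> fst i \<le> u \<and> u \<le> v \<and> v \<le> snd i"
       "disjoint_family_on (\<lambda>(u, v). {u<..<v}) (G i)"
       "\<And>h::real\<Rightarrow>real. h (snd i) - h (fst i) = increments h (K i) + increments h (G i)"
      if "i \<in> I" for i
      using GQ[OF that] unfolding Q_def by blast+
    define G' where "G' i = {g\<in>G i. fst g < snd g}" for i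
    have G': "finite (G' i)" "\<And>u v. (u, v) \<in> G' i \<Longrightarrow> fst i \<le> u \<and> u < v \<and> v \<le> snd i"
       "disjoint_family_on (\<lambda>(u, v). {u<..<v}) (G' i)" if "i \<in> I" for i
      using G(1-3)[OF that] by (fastforce simp: G'_def disjoint_family_on_def)+
    have eq: "h (snd i) - h (fst i) = increments h (K i) + increments h (G' i)"
      if "i \<in> I" for h :: "real \<Rightarrow> real" and i
    proof -
      have "increments h (G' i) = increments h (G i)"
        using G(1,2)[OF that] by (intro sum.mono_neutral_left) (fastforce simp: G'_def)+
      then show ?thesis using G(4)[OF that, of h] by simp
    qed
    have Kdis: "K i \<inter> K i' = {}" if "i \<in> I" "i' \<in> I" "i \<noteq> i'" for i i'
    proof -
      have "i = i'" if "j \<in> K i" "j \<in> K i'" for j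
        using that J[of "fst j" "snd j"] Iuniq[OF \<open>i \<in> I\<close> \<open>i' \<in> I\<close>, of "fst j"] by (simp add: K_def)
      then show ?thesis using that by blast
    qed
    have Gdis: "G' i \<inter> G' i' = {}" if "i \<in> I" "i' \<in> I" "i \<noteq> i'" for i i'
    proof -
      have "i = i'" if "j \<in> G' i" "j \<in> G' i'" for j
        using that G'(2)[OF \<open>i \<in> I\<close>, of "fst j" "snd j"] G'(2)[OF \<open>i' \<in> I\<close>, of "fst j" "snd j"]
          Iuniq[OF \<open>i \<in> I\<close> \<open>i' \<in> I\<close>, of "fst j"] by simp
      then show ?thesis using that by blast
    qed
    have KJ: "(\<Union>i\<in>I. K i) = J" using J by (fastforce simp: K_def)
    let ?D = "\<Union>i\<in>I. G' i"
    \<comment> \<open>Used twice: with the identity it measures the gaps, with \<open>f\<close> it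
      turns their increments into the difference to be estimated.\<close>
    have total: "increments h I = increments h J + increments h ?D"
      for h :: "real \<Rightarrow> real"
    proof -
      have "increments h I = (\<Sum>i\<in>I. h (snd i) - h (fst i))"
        by (simp add: case_prod_beta)
      also have "\<dots> = (\<Sum>i\<in>I. \<Sum>(u, v)\<in>K i. h v - h u) + (\<Sum>i\<in>I. \<Sum>(u, v)\<in>G' i. h v - h u)"
        by (simp add: eq sum.distrib)
      also have "(\<Sum>i\<in>I. \<Sum>(u, v)\<in>K i. h v - h u) = (\<Sum>(u, v)\<in>(\<Union>i\<in>I. K i). h v - h u)"
        using fin Kdis by (intro sum.UNION_disjoint[symmetric]) (auto simp: K_def)
      also have "(\<Sum>i\<in>I. \<Sum>(u, v)\<in>G' i. h v - h u) = increments h ?D"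
        using fin Gdis G'(1) by (intro sum.UNION_disjoint[symmetric]) auto
      finally show ?thesis by (simp add: KJ)
    qed
    have "(\<Sum>(p, q)\<in>?D. \<bar>f q - f p\<bar>) < \<epsilon>"
    proof (rule \<delta>)
      show "finite ?D" using fin G'(1) by auto
      show "a \<le> p \<and> p \<le> q \<and> q \<le> b" if "(p, q) \<in> ?D" for p q
      proof -
        obtain i where i: "i \<in> I" "(p, q) \<in> G' i" using \<open>(p, q) \<in> ?D\<close> by blast
        then show ?thesis using G'(2)[OF i] I[of "fst i" "snd i"] by simp
      qed
      show "disjoint_family_on (\<lambda>(p, q). {p<..<q}) ?D"
        unfolding disjoint_family_on_def
      proof (intro ballI impI)
        fix g g' assume g: "g \<in> ?D" "g' \<in> ?D" "g \<noteq> g'"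
        obtain i i' where i: "i \<in> I" "g \<in> G' i" "i' \<in> I" "g' \<in> G' i'" using g by blast
        show "(case g of (p, q) \<Rightarrow> {p<..<q}) \<inter> (case g' of (p, q) \<Rightarrow> {p<..<q}) = {}"
        proof (cases "i = i'")
          case True
          then show ?thesis using G'(3)[OF i(1)] i g(3) by (simp add: disjoint_family_on_def)
        next
          case False
          have "x \<notin> {fst g<..<snd g} \<inter> {fst g'<..<snd g'}" for x
            using G'(2)[OF i(1), of "fst g" "snd g"] G'(2)[OF i(3), of "fst g'" "snd g'"]
              Iuniq[OF i(1) i(3), of x] i(2,4) False by auto
          then have "{fst g<..<snd g} \<inter> {fst g'<..<snd g'} = {}" by blast
          then show ?thesis by (simp only: case_prod_beta)
        qed
      qed
      show "total_length ?D < \<delta>" using total[of "\<lambda>x. x"] small by linarith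
    qed
    moreover have "\<bar>\<Sum>(p, q)\<in>?D. f q - f p\<bar> \<le> (\<Sum>(p, q)\<in>?D. \<bar>f q - f p\<bar>)"
      unfolding case_prod_beta by (rule sum_abs)
    ultimately show "\<bar>increments f I - increments f J\<bar> < \<epsilon>"
      using total[of f] by linarith
  qed
qed

text \<open>Cover \<open>S\<close> by steep intervals in a tight open neighbourhood, then fill those
  with flat intervals. Both families have nearly the same total length, hence nearly the same
  increment of \<open>f\<close>; but one increment is at least \<open>w\<close> times that length
  and the other at most about \<open>u\<close> times it.\<close>

lemma abs_continuous_oscillation_negligible:
  assumes ac: "abs_continuous_on_interval f a b" and "u < w" and S: "S \<subseteq> {a<..<b}"
    and up: "\<And>x. x \<in> S \<Longrightarrow> fine_at (\<lambda>p q. f q - f p \<ge> w * (q - p)) x"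
    and down: "\<And>x. x \<in> S \<Longrightarrow> fine_at (\<lambda>p q. f q - f p \<le> u * (q - p)) x"
  shows "negligible S"
proof -
  obtain H where H: "H \<in> lmeasurable" "S \<subseteq> H" "H \<subseteq> {a<..<b}"
    "\<And>B. \<lbrakk>B \<in> sets lebesgue; negligible (S - B)\<rbrakk> \<Longrightarrow> negligible (H - B)"
    using measure_hull[OF S] by metis
  let ?m = "measure lebesgue H"
  have "?m = 0"
  proof (rule ccontr)
    assume "?m \<noteq> 0"
    then have m: "?m > 0" by (simp add: zero_less_measure_iff)
    \<comment> \<open>The increments should differ by \<open>(w - u) * ?m / 2\<close>, that is
      \<open>2 * \<eta>\<close>; at most \<open>\<eta>\<close> of this is lost to the difference of
      the total lengths.\<close>
    define \<eta> where "\<eta> = (w - u) * ?m / 4"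
    have "\<eta> > 0" using m \<open>u < w\<close> by (simp add: \<eta>_def)
    obtain \<delta> where "\<delta> > 0" and \<delta>: "\<And>I J. \<lbrakk>nested_intervals a b I J; total_length I - total_length J < \<delta>\<rbrakk>
      \<Longrightarrow> \<bar>increments f I - increments f J\<bar> < \<eta>"
      using abs_continuous_small_gaps[OF ac \<open>\<eta> > 0\<close>] by metis
    \<comment> \<open>The three bounds ensure, in order, that the gaps are shorter than
      \<open>\<delta>\<close>, that \<open>I\<close> is longer than \<open>?m / 2\<close>, and that
      the gaps multiplied by \<open>\<bar>u\<bar>\<close> contribute at most
      \<open>\<eta>\<close>.\<close>
    define \<epsilon> where "\<epsilon> = min (\<delta> / 2) (min (?m / 2) (\<eta> / (2 * (\<bar>u\<bar> + 1))))"
    have "\<epsilon> > 0" and \<epsilon>: "2 * \<epsilon> \<le> \<delta>" "\<epsilon> \<le> ?m / 2" "\<epsilon> \<le> \<eta> / (2 * (\<bar>u\<bar> + 1))"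
      using m \<open>\<delta> > 0\<close> \<open>\<eta> > 0\<close> unfolding \<epsilon>_def by (simp, linarith, linarith, simp)
    obtain U0 where U0: "open U0" "H \<subseteq> U0" "U0 - H \<in> lmeasurable" "emeasure lebesgue (U0 - H) < ennreal \<epsilon>"
      using sets_lebesgue_outer_open[OF fmeasurableD[OF H(1)] \<open>\<epsilon> > 0\<close>] by metis
    define U where "U = U0 \<inter> {a<..<b}"
    have U: "open U" "H \<subseteq> U" "U \<subseteq> {a<..<b}" using U0 H(3) by (auto simp: U_def)
    have UH: "U - H \<in> lmeasurable" "measure lebesgue (U - H) < \<epsilon>"
    proof -
      have "U - H = (U0 - H) \<inter> {a<..<b}" by (auto simp: U_def)
      then show *: "U - H \<in> lmeasurable" using U0(3) by (simp add: fmeasurable_Int_fmeasurable)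
      have "measure lebesgue (U - H) \<le> measure lebesgue (U0 - H)"
        using * U0(3) by (intro measure_mono_fmeasurable) (auto simp: U_def)
      also have "\<dots> < \<epsilon>" using U0(3,4) \<open>\<epsilon> > 0\<close> by (simp add: emeasure_eq_measure2 ennreal_less_iff)
      finally show "measure lebesgue (U - H) < \<epsilon>" .
    qed
    have SU: "S \<subseteq> U" using H(2) U(2) by blast
    obtain I where I: "finite I" "\<And>p q. (p, q) \<in> I \<Longrightarrow> p < q \<and> {p..q} \<subseteq> U \<and> f q - f p \<ge> w * (q - p)"
      "disjoint_intervals I" "measure lebesgue (H - interval_union I) < \<epsilon>"
      "interval_union I \<in> lmeasurable" "measure lebesgue (interval_union I) = total_length I"
      "?m < total_length I + \<epsilon>"
      by (rule vitali_intervals_finite[where P = "\<lambda>p q. f q - f p \<ge> w * (q - p)", OF U(1) SU _ H(1) _ \<open>\<epsilon> > 0\<close>])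
        (rule up, assumption, rule H(4), assumption, assumption, rule that, assumption+)
    let ?I = "\<Union>(p, q)\<in>I. {p..q}" and ?V = "\<Union>(p, q)\<in>I. {p<..<q}"
    have Iab: "a \<le> p \<and> p < q \<and> q \<le> b" if "(p, q) \<in> I" for p q
    proof -
      have "p < q" "{p..q} \<subseteq> {a<..<b}" using I(2)[OF that] U(3) by auto
      moreover from this have "p \<in> {a<..<b}" "q \<in> {a<..<b}" by (meson atLeastAtMost_iff less_imp_le order_refl subsetD)+
      ultimately show ?thesis by simp
    qed
    have Ilt: "p < q" if "(p, q) \<in> I" for p q using I(2)[OF that] by simp
    note Im = I(6,5)
    have V: "open ?V" by (intro open_UN ballI) (simp add: case_prod_beta)
    have VC: "- ?V \<in> sets lebesgue"
      using V by (metis borel_closed closed_Compl sets_completionI_sets sets_lborel)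
    have IV: "negligible (?I - ?V)"
    proof (rule negligible_subset)
      show "negligible (\<Union>(p, q)\<in>I. {p, q})" using I(1) by (intro negligible_Union) (auto simp: case_prod_beta)
      show "?I - ?V \<subseteq> (\<Union>(p, q)\<in>I. {p, q})" by fastforce
    qed
    have HV: "H \<inter> ?V \<in> lmeasurable" using H(1) V by (intro fmeasurable_Int_fmeasurable) auto
    \<comment> \<open>Adding the complement of \<open>?V\<close> to the test set transfers the hull
      property from \<open>H\<close> to its part inside \<open>?V\<close>, so Vitali's theorem can
      be applied a second time.\<close>
    have hull: "negligible (H \<inter> ?V - B)" if "B \<in> sets lebesgue" "negligible (S \<inter> ?V - B)" for B
    proof -
      have "S - (B \<union> - ?V) = S \<inter> ?V - B" by blast
      then have "negligible (H - (B \<union> - ?V))"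
        using that(2) by (intro H(4) sets.Un that(1) VC) (simp only:)
      moreover have "H - (B \<union> - ?V) = H \<inter> ?V - B" by blast
      ultimately show ?thesis by simp
    qed
    have SV: "S \<inter> ?V \<subseteq> ?V" by blast
    obtain J0 where J0: "finite J0" "\<And>p q. (p, q) \<in> J0 \<Longrightarrow> p < q \<and> {p..q} \<subseteq> ?V \<and> f q - f p \<le> u * (q - p)"
      "disjoint_intervals J0" "measure lebesgue (H \<inter> ?V - interval_union J0) < \<epsilon>"
      "interval_union J0 \<in> lmeasurable" "measure lebesgue (interval_union J0) = total_length J0"
      by (rule vitali_intervals_finite[where P = "\<lambda>p q. f q - f p \<le> u * (q - p)", OF V SV _ HV _ \<open>\<epsilon> > 0\<close>])
        (rule down, erule IntD1, rule hull, assumption, assumption, rule that, assumption+)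
    have Jlt: "p < q" if "(p, q) \<in> J0" for p q using J0(2)[OF that] by simp
    let ?J = "\<Union>(p, q)\<in>J0. {p..q}"
    note Jm = J0(6,5)
    have nest: "\<exists>(p, q)\<in>I. p \<le> u \<and> v \<le> q" if uv: "(u, v) \<in> J0" for u v
    proof -
      have sub: "{u..v} \<subseteq> ?V" "u < v" using J0(2)[OF uv] by auto
      then have "u \<in> ?V" by (meson atLeastAtMost_iff less_imp_le order_refl subsetD)
      then obtain p q where pq: "(p, q) \<in> I" "p < u" "u < q" by auto
      have "v < q"
      proof (rule ccontr)
        assume "\<not> v < q"
        then have "q \<in> {u..v}" using pq by auto
        then have "q \<in> ?V" using sub by blast
        then obtain p' q' where pq': "(p', q') \<in> I" "p' < q" "q < q'" by auto
        then have "(p, q) \<noteq> (p', q')" "q \<in> {p..q} \<inter> {p'..q'}" using pq by auto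
        then show False using I(3) pq(1) pq'(1) unfolding disjoint_family_on_def by fastforce
      qed
      then show ?thesis using pq by (intro bexI[of _ "(p, q)"]) auto
    qed
    have gap: "0 \<le> total_length I - total_length J0" "total_length I - total_length J0 < 2 * \<epsilon>"
    proof -
      have JI: "?J \<subseteq> ?I" using nest by fastforce
      have eq: "total_length I - total_length J0 = measure lebesgue (?I - ?J)"
        unfolding Im(1)[symmetric] Jm(1)[symmetric] using Im(2) Jm(2) JI by (simp add: measurable_measure_Diff fmeasurableD)
      then show "0 \<le> total_length I - total_length J0" by simp
      note eq
      \<comment> \<open>A point of \<open>?I\<close> missed by \<open>?J\<close> lies outside
        \<open>H\<close>, or in the uncovered part of \<open>H\<close> inside \<open>?V\<close>, or
        is an endpoint.\<close>
      also have "measure lebesgue (?I - ?J) \<le> measure lebesgue ((U - H) \<union> (H \<inter> ?V - ?J) \<union> (?I - ?V))"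
      proof (rule measure_mono_fmeasurable)
        show "?I - ?J \<subseteq> (U - H) \<union> (H \<inter> ?V - ?J) \<union> (?I - ?V)"
        proof -
          have "?I \<subseteq> U" using I(2) by blast
          then show ?thesis by blast
        qed
        show "?I - ?J \<in> sets lebesgue" using Im Jm by auto
        show "(U - H) \<union> (H \<inter> ?V - ?J) \<union> (?I - ?V) \<in> lmeasurable"
          by (intro fmeasurable.Un fmeasurable_Diff negligible_imp_measurable[OF IV] UH(1) HV fmeasurableD[OF Jm(2)])
      qed
      also have "\<dots> \<le> measure lebesgue ((U - H) \<union> (H \<inter> ?V - ?J)) + measure lebesgue (?I - ?V)"
        using UH HV Jm IV by (intro measure_Un_le) (auto simp: negligible_imp_sets)
      also have "\<dots> \<le> (measure lebesgue (U - H) + measure lebesgue (H \<inter> ?V - ?J)) + 0"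
        using UH HV Jm negligible_imp_measure0[OF IV] by (intro add_mono measure_Un_le) auto
      also have "\<dots> < 2 * \<epsilon>" using UH(2) J0(4) by simp
      finally show "total_length I - total_length J0 < 2 * \<epsilon>" .
    qed
    have lt: "\<bar>increments f I - increments f J0\<bar> < \<eta>"
      using nest Jlt Iab I(1,3) J0(1,3) gap(2) \<epsilon>(1) by (intro \<delta>) (auto simp: nested_intervals_def)
    have "increments f J0 \<le> (\<Sum>(p, q)\<in>J0. u * (q - p))" by (intro sum_mono) (auto dest: J0(2))
    moreover have "increments f I \<ge> (\<Sum>(p, q)\<in>I. w * (q - p))"
      by (intro sum_mono) (auto dest: I(2))
    moreover have "(\<Sum>(p, q)\<in>D. c * (q - p)) = c * total_length D" for c and D :: "(real \<times> real) set"
      by (simp add: sum_distrib_left case_prod_beta)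
    moreover have "w * total_length I - u * total_length J0
       = (w - u) * total_length I + u * (total_length I - total_length J0)" by (simp add: algebra_simps)
    moreover have "(w - u) * (?m / 2) \<le> (w - u) * total_length I"
      using \<open>u < w\<close> I(7) \<epsilon>(2) by (intro mult_left_mono) linarith+
    moreover have "- \<eta> \<le> u * (total_length I - total_length J0)"
    proof -
      have "\<bar>u\<bar> * (total_length I - total_length J0) \<le> (\<bar>u\<bar> + 1) * (2 * (\<eta> / (2 * (\<bar>u\<bar> + 1))))"
        using gap \<epsilon>(3) by (intro mult_mono) auto
      also have "\<dots> = \<eta>" using abs_ge_zero[of u] by (simp add: divide_eq_eq algebra_simps)
      finally have "\<bar>u * (total_length I - total_length J0)\<bar> \<le> \<eta>" using gap(1) by (simp add: abs_mult)
      then show ?thesis by linarith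
    qed
    moreover have "(w - u) * (?m / 2) = 2 * \<eta>" by (simp add: \<eta>_def)
    ultimately show False using lt by (simp only:)
  qed
  then have "negligible H" using H(1) by (simp add: negligible_iff_measure)
  then show ?thesis using H(2) by (rule negligible_subset)
qed

text \<open>Slope \<open>2 / ?m\<close> on intervals of total length above \<open>?m / 2\<close>
  produces an increment above 1, whereas absolute continuity keeps it below 1 within a window
  shorter than \<open>\<delta>\<close>. Negligibility is local, so windows suffice.\<close>

lemma abs_continuous_infinite_slope_negligible:
  assumes ac: "abs_continuous_on_interval f a b" and S: "S \<subseteq> {a<..<b}"
    and up: "\<And>x v. x \<in> S \<Longrightarrow> fine_at (\<lambda>p q. f q - f p \<ge> v * (q - p)) x"
  shows "negligible S"
proof -
  obtain \<delta> where "\<delta> > 0" and \<delta>: "\<And>I J. \<lbrakk>nested_intervals a b I J; total_length I - total_length J < \<delta>\<rbrakk>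
      \<Longrightarrow> \<bar>increments f I - increments f J\<bar> < 1"
    using abs_continuous_small_gaps[OF ac zero_less_one] by metis
  have local: "negligible (S \<inter> {c - \<delta> / 4<..<c + \<delta> / 4})" for c
  proof -
    define l u where "l = max a (c - \<delta> / 4)" and "u = min b (c + \<delta> / 4)"
    let ?S = "S \<inter> {c - \<delta> / 4<..<c + \<delta> / 4}"
    have S': "?S \<subseteq> {l<..<u}" using S by (auto simp: l_def u_def)
    obtain H where H: "H \<in> lmeasurable" "?S \<subseteq> H" "H \<subseteq> {l<..<u}"
      "\<And>B. \<lbrakk>B \<in> sets lebesgue; negligible (?S - B)\<rbrakk> \<Longrightarrow> negligible (H - B)"
      using measure_hull[OF S'] by metis
    let ?m = "measure lebesgue H"
    have "?m = 0"
    proof (rule ccontr)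
      assume "?m \<noteq> 0"
      then have m: "?m / 2 > 0" by (simp add: zero_less_measure_iff)
      obtain I where I: "finite I" "\<And>p q. (p, q) \<in> I \<Longrightarrow> p < q \<and> {p..q} \<subseteq> {l<..<u} \<and> f q - f p \<ge> 2 / ?m * (q - p)"
        "disjoint_intervals I" "measure lebesgue (H - interval_union I) < ?m / 2"
        "interval_union I \<in> lmeasurable" "measure lebesgue (interval_union I) = total_length I"
        "?m < total_length I + ?m / 2"
        by (rule vitali_intervals_finite[where P = "\<lambda>p q. f q - f p \<ge> 2 / ?m * (q - p)", OF _ S' _ H(1) _ m])
          (simp, rule up, erule IntD1, rule H(4), assumption, assumption, rule that, assumption+)
      let ?I = "\<Union>(p, q)\<in>I. {p..q}"
      have Ilt: "p < q" if "(p, q) \<in> I" for p q using I(2)[OF that] by simp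
      note Im = I(6,5)
      have Ilu: "l < p \<and> q < u" if "(p, q) \<in> I" for p q
      proof -
        have "p \<in> {p..q}" "q \<in> {p..q}" using Ilt[OF that] by auto
        then show ?thesis using I(2)[OF that] by (metis greaterThanLessThan_iff subsetD)
      qed
      have m2: "total_length I > ?m / 2" using I(7) by linarith
      have "total_length I < \<delta>"
      proof -
        have "I \<noteq> {}" using m2 m by auto
        then have "l < u" using Ilu Ilt by (metis equals0I order_less_trans surj_pair)
        have "measure lebesgue ?I \<le> measure lebesgue {l..u}"
          using Im(2) by (intro measure_mono_fmeasurable) (auto dest!: Ilu)
        also have "\<dots> < \<delta>" using \<open>l < u\<close> \<open>\<delta> > 0\<close> by (simp add: l_def u_def)
        finally show ?thesis using Im(1) by simp
      qed
      moreover have "nested_intervals a b I {}"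
        using I(1,3) Ilu Ilt by (force simp: nested_intervals_def disjoint_family_on_def[of _ "{}"] l_def u_def)
      ultimately have "increments f I < 1" using \<delta>[of I "{}"] by simp
      moreover have "increments f I \<ge> (\<Sum>(p, q)\<in>I. 2 / ?m * (q - p))"
        by (intro sum_mono) (auto dest!: I(2))
      moreover have "(\<Sum>(p, q)\<in>I. 2 / ?m * (q - p)) = 2 / ?m * total_length I"
        by (simp add: sum_distrib_left case_prod_beta)
      moreover have "2 / ?m * total_length I > 1" using m m2 by (simp add: field_simps)
      ultimately show False by linarith
    qed
    then have "negligible H" using H(1) by (simp add: negligible_iff_measure)
    then show ?thesis using H(2) by (rule negligible_subset)
  qed
  show ?thesis
  proof (rule locally_negligible_alt[THEN iffD2], rule ballI)
    fix x assume "x \<in> S"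
    let ?U = "{x - \<delta> / 4<..<x + \<delta> / 4}"
    have "openin (top_of_set S) (S \<inter> ?U)" by (rule openin_open_Int) simp
    moreover have "x \<in> S \<inter> ?U" using \<open>x \<in> S\<close> \<open>\<delta> > 0\<close> by simp
    ultimately show "\<exists>U. openin (top_of_set S) U \<and> x \<in> U \<and> negligible U"
      using local[of x] by blast
  qed
qed

text \<open>Almost every point lies in arbitrarily short intervals of slope at most
  \<open>v\<close>: at any other point outside the exceptional null sets \<open>f\<close> would be
  differentiable with a derivative of at least \<open>v\<close>, which exceeds \<open>M\<close>.
  Vitali's theorem fills \<open>(a, b)\<close> with such intervals up to gaps over which
  \<open>f\<close> hardly changes.\<close>

lemma abs_continuous_increment_le:
  assumes ac: "abs_continuous_on_interval f a b" and "a < b" and Z: "negligible Z"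
    and D: "\<And>x D. \<lbrakk>x \<notin> Z; (f has_real_derivative D) (at x)\<rbrakk> \<Longrightarrow> D \<le> M"
    and "M < v"
  shows "f b - f a \<le> v * (b - a)"
proof -
  define lo up where "lo u = fine_at (\<lambda>p q. f q - f p \<le> u * (q - p))"
    and "up u = fine_at (\<lambda>p q. f q - f p \<ge> u * (q - p))" for u
  define G where "G = {x\<in>{a<..<b}. lo v x}"
  have Einf: "negligible {x\<in>{a<..<b}. \<forall>w. up w x}"
    by (rule abs_continuous_infinite_slope_negligible[OF ac]) (auto simp: up_def)
  have Euw: "negligible {x\<in>{a<..<b}. lo u x \<and> up w x}" if "u < w" for u w
    by (rule abs_continuous_oscillation_negligible[OF ac that]) (auto simp: lo_def up_def)
  let ?Q = "\<Union>(u, w)\<in>{(u, w). u \<in> \<rat> \<and> w \<in> \<rat> \<and> u < w}. {x\<in>{a<..<b}. lo u x \<and> up w x}"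
  have "negligible ?Q"
  proof -
    have "countable (\<rat> \<times> \<rat> :: (real \<times> real) set)" by (simp add: countable_rat)
    then have "countable {(u::real, w). u \<in> \<rat> \<and> w \<in> \<rat> \<and> u < w}"
      by (rule countable_subset[rotated]) auto
    then show ?thesis using Euw by (intro negligible_countable_Union) auto
  qed
  have "{a<..<b} - G \<subseteq> {x\<in>{a<..<b}. \<forall>w. up w x} \<union> ?Q \<union> Z"
  proof
    fix x assume x: "x \<in> {a<..<b} - G"
    show "x \<in> {x\<in>{a<..<b}. \<forall>w. up w x} \<union> ?Q \<union> Z"
    proof (rule ccontr)
      assume c: "x \<notin> {x\<in>{a<..<b}. \<forall>w. up w x} \<union> ?Q \<union> Z"
      have nlo: "\<not> lo v x" using x by (simp add: G_def)
      obtain w0 where w0: "\<not> up w0 x" using c x by blast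
      have nuw: "\<not> lo u x \<or> \<not> up w x" if "u \<in> \<rat>" "w \<in> \<rat>" "u < w" for u w using c x that by blast
      let ?W = "{w. \<not> up w x}"
      have lb: "v \<le> w" if w: "w \<in> ?W" for w
      proof -
        obtain e where e: "e > 0" "\<And>p q. \<lbrakk>p < q; p \<le> x; x \<le> q; q - p < e\<rbrakk> \<Longrightarrow> f q - f p > v * (q - p)"
          using nlo unfolding lo_def fine_at_def by (meson not_le)
        obtain e' where e': "e' > 0" "\<And>p q. \<lbrakk>p < q; p \<le> x; x \<le> q; q - p < e'\<rbrakk> \<Longrightarrow> f q - f p < w * (q - p)"
          using w unfolding up_def fine_at_def mem_Collect_eq by (meson not_le)
        define d where "d = min e e' / 2"
        have d: "0 < d" "d < e" "d < e'" using e(1) e'(1) by (auto simp: d_def)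
        have "v * d < f (x + d) - f x" "f (x + d) - f x < w * d"
          using e(2)[of x "x + d"] e'(2)[of x "x + d"] d by simp_all
        then have "v * d < w * d" by (rule less_trans)
        then show ?thesis using d by simp
      qed
      have bdd: "bdd_below ?W" using lb by (rule bdd_belowI)
      \<comment> \<open>The upper derivate at \<open>x\<close>. Slopes beyond a value above
        \<open>l\<close> stop recurring; below \<open>l\<close> they do recur, and off
        \<open>?Q\<close> this keeps all smaller slopes from recurring, so the lower derivate is
        \<open>l\<close> as well.\<close>
      define l where "l = Inf ?W"
      have "v \<le> l" unfolding l_def using w0 lb by (intro cInf_greatest) auto
      have "(f has_real_derivative l) (at x)"
        unfolding has_field_derivative_iff
      proof (rule LIM_I)
        fix r :: real assume "r > 0"
        have "\<exists>w\<in>?W. w < l + r" using w0 \<open>r > 0\<close> unfolding l_def by (intro cInf_lessD) auto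
        then obtain w where w: "\<not> up w x" "w < l + r" by auto
        obtain e where e: "e > 0" "\<And>p q. \<lbrakk>p < q; p \<le> x; x \<le> q; q - p < e\<rbrakk> \<Longrightarrow> f q - f p < w * (q - p)"
          using w(1) unfolding up_def fine_at_def by (meson not_le)
        obtain u1 where u1: "u1 \<in> \<rat>" "l - r < u1" "u1 < l" using Rats_dense_in_real[of "l - r" l] \<open>r > 0\<close> by auto
        obtain u2 where u2: "u2 \<in> \<rat>" "u1 < u2" "u2 < l" using Rats_dense_in_real[of u1 l] u1 by auto
        have "up u2 x" using u2(3) cInf_lower[OF _ bdd, of u2] unfolding l_def by auto
        then have "\<not> lo u1 x" using nuw[OF u1(1) u2(1,2)] by simp
        then obtain e' where e': "e' > 0" "\<And>p q. \<lbrakk>p < q; p \<le> x; x \<le> q; q - p < e'\<rbrakk> \<Longrightarrow> f q - f p > u1 * (q - p)"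
          unfolding lo_def fine_at_def by (meson not_le)
        have "norm ((f y - f x) / (y - x) - l) < r" if y: "y \<noteq> x" "norm (y - x) < min e e'" for y
        proof -
          have "u1 < (f y - f x) / (y - x) \<and> (f y - f x) / (y - x) < w"
          proof (cases "x < y")
            case True
            then show ?thesis using e(2)[of x y] e'(2)[of x y] y by (simp add: less_divide_eq divide_less_eq)
          next
            case False
            then have "y < x" using y by simp
            moreover have "(f y - f x) / (y - x) = (f x - f y) / (x - y)"
              by (metis minus_diff_eq minus_divide_divide)
            ultimately show ?thesis using e(2)[of y x] e'(2)[of y x] y by (simp add: less_divide_eq divide_less_eq)
          qed
          then show ?thesis using w(2) u1(2) by (simp add: abs_less_iff)
        qed
        then show "\<exists>s>0. \<forall>y. y \<noteq> x \<and> norm (y - x) < s \<longrightarrow> norm ((f y - f x) / (y - x) - l) < r"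
          using e(1) e'(1) by (intro exI[of _ "min e e'"]) auto
      qed
      then have "l \<le> M" using D c by blast
      then show False using \<open>v \<le> l\<close> \<open>M < v\<close> by simp
    qed
  qed
  then have neg: "negligible ({a<..<b} - G)"
    by (rule negligible_subset[OF negligible_Un[OF negligible_Un[OF Einf \<open>negligible ?Q\<close>] Z]])
  have "f b - f a \<le> v * (b - a) + \<epsilon>" if "\<epsilon> > 0" for \<epsilon>
  proof -
    obtain \<delta> where "\<delta> > 0" and \<delta>: "\<And>I J. \<lbrakk>nested_intervals a b I J; total_length I - total_length J < \<delta>\<rbrakk>
      \<Longrightarrow> \<bar>increments f I - increments f J\<bar> < \<epsilon> / 2"
      by (fact abs_continuous_small_gaps[OF ac half_gt_zero[OF \<open>\<epsilon> > 0\<close>]])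
    \<comment> \<open>The second bound makes the missing length times \<open>\<bar>v\<bar>\<close>
      at most \<open>\<epsilon> / 2\<close>.\<close>
    define d where "d = min \<delta> (\<epsilon> / (2 * (\<bar>v\<bar> + 1)))"
    have "d > 0" using \<open>\<delta> > 0\<close> \<open>\<epsilon> > 0\<close> by (simp add: d_def)
    have G: "fine_at (\<lambda>p q. f q - f p \<le> v * (q - p)) x" if "x \<in> G" for x
      using that by (simp add: G_def lo_def)
    have hull: "negligible ({a<..<b} - B)" if "negligible (G - B)" for B
      by (rule negligible_subset[OF negligible_Un[OF neg that]]) blast
    have GU: "G \<subseteq> {a<..<b}" by (auto simp: G_def)
    obtain J where J: "finite J" "\<And>p q. (p, q) \<in> J \<Longrightarrow> p < q \<and> {p..q} \<subseteq> {a<..<b} \<and> f q - f p \<le> v * (q - p)"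
      "disjoint_intervals J" "measure lebesgue ({a<..<b} - interval_union J) < d"
      "interval_union J \<in> lmeasurable" "measure lebesgue (interval_union J) = total_length J"
      by (rule vitali_intervals_finite[where P = "\<lambda>p q. f q - f p \<le> v * (q - p)" and H = "{a<..<b}", OF _ GU _ _ _ \<open>d > 0\<close>])
        (simp, rule G, assumption, simp, rule hull, assumption, rule that, assumption+)
    let ?J = "\<Union>(p, q)\<in>J. {p..q}"
    have Jlt: "p < q" if "(p, q) \<in> J" for p q using J(2)[OF that] by simp
    note Jm = J(6,5)
    have Jab: "a < p \<and> q < b" if "(p, q) \<in> J" for p q
    proof -
      have "p \<in> {p..q}" "q \<in> {p..q}" using Jlt[OF that] by auto
      then show ?thesis using J(2)[OF that] by (metis greaterThanLessThan_iff subsetD)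
    qed
    have Jsub: "?J \<subseteq> {a<..<b}" using J(2) by blast
    have "measure lebesgue ({a<..<b} - ?J) = (b - a) - measure lebesgue ?J"
      using Jm(2) Jsub \<open>a < b\<close> by (subst measurable_measure_Diff) (auto simp: fmeasurableD)
    then have gap: "(b - a) - total_length J < d" "(b - a) - total_length J \<ge> 0"
      using J(4) Jm(1) measure_nonneg[of lebesgue "{a<..<b} - ?J"] by linarith+
    have "\<bar>increments f {(a, b)} - increments f J\<bar> < \<epsilon> / 2"
    proof (rule \<delta>)
      show "nested_intervals a b {(a, b)} J"
        using J(1,3) \<open>a < b\<close> Jlt Jab by (fastforce simp: nested_intervals_def disjoint_family_on_def)
      show "total_length {(a, b)} - total_length J < \<delta>"
        using gap(1) by (simp add: d_def)
    qed
    then have "\<bar>(f b - f a) - increments f J\<bar> < \<epsilon> / 2" by simp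
    moreover have "increments f J \<le> (\<Sum>(p, q)\<in>J. v * (q - p))"
      by (intro sum_mono) (auto dest!: J(2))
    moreover have "(\<Sum>(p, q)\<in>J. v * (q - p)) = v * total_length J"
      by (simp add: sum_distrib_left case_prod_beta)
    moreover have "v * total_length J \<le> v * (b - a) + \<epsilon> / 2"
    proof -
      let ?s = "(b - a) - total_length J"
      have "- v * ?s \<le> \<bar>v\<bar> * ?s" using gap(2) by (intro mult_right_mono) auto
      also have "\<dots> \<le> \<bar>v\<bar> * (\<epsilon> / (2 * (\<bar>v\<bar> + 1)))"
        using gap(1) by (intro mult_left_mono) (auto simp: d_def)
      also have "\<dots> \<le> \<epsilon> / 2" using \<open>\<epsilon> > 0\<close> by (simp add: field_simps)
      finally show ?thesis by (simp add: algebra_simps)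
    qed
    ultimately show ?thesis by linarith
  qed
  then show ?thesis by (rule field_le_epsilon)
qed

text \<open>Only points with a genuine derivative enter \<open>abs_continuous_increment_le\<close>,
  so the unspecified value of \<open>deriv\<close> elsewhere is harmless. The estimate holds for
  every slope above \<open>M\<close>, for \<open>f\<close> and its negative, and hence for
  \<open>M\<close>.\<close>

lemma locally_abs_continuous_lipschitz:
  assumes "locally_abs_continuous f" and "AE x in lebesgue. \<bar>deriv f x\<bar> \<le> M"
  shows "\<bar>f s - f t\<bar> \<le> M * \<bar>s - t\<bar>"
proof -
  obtain Z where Z: "Z \<in> null_sets lebesgue" "{x. \<not> \<bar>deriv f x\<bar> \<le> M} \<subseteq> Z"
    using assms(2) by (auto simp: eventually_ae_filter)
  then have "negligible Z" by (simp add: negligible_iff_null_sets)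
  have dM: "\<bar>D\<bar> \<le> M" if "x \<notin> Z" "(f has_real_derivative D) (at x)" for x D
    using that Z(2) DERIV_imp_deriv by blast
  have ac: "abs_continuous_on_interval f a b" for a b
    using assms(1) by (simp add: locally_abs_continuous_def)
  have acm: "abs_continuous_on_interval (\<lambda>x. - f x) a b" for a b
    using ac[of a b] unfolding abs_continuous_on_interval_def by (simp add: abs_minus_commute)
  have le: "\<bar>f b - f a\<bar> \<le> M * (b - a)" if "a < b" for a b
  proof -
    have 1: "f b - f a \<le> v * (b - a)" if "M < v" for v
      by (rule abs_continuous_increment_le[OF ac \<open>a < b\<close> \<open>negligible Z\<close> _ that]) (use dM in force)
    have 2: "f a - f b \<le> v * (b - a)" if "M < v" for v
    proof -
      have "- f b - (- f a) \<le> v * (b - a)"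
      proof (rule abs_continuous_increment_le[OF acm \<open>a < b\<close> \<open>negligible Z\<close> _ that])
        fix x D assume "x \<notin> Z" "((\<lambda>x. - f x) has_real_derivative D) (at x)"
        then show "D \<le> M" using dM[of x "- D"] DERIV_minus[of "\<lambda>x. - f x" D] by force
      qed
      then show ?thesis by simp
    qed
    have "\<bar>f b - f a\<bar> / (b - a) \<le> v" if "M < v" for v
      using 1[OF that] 2[OF that] \<open>a < b\<close> by (simp add: divide_le_eq abs_le_iff)
    then have "\<bar>f b - f a\<bar> / (b - a) \<le> M" by (rule dense_ge)
    then show ?thesis using \<open>a < b\<close> by (simp add: divide_le_eq)
  qed
  show ?thesis using le[of s t] le[of t s] by (cases s t rule: linorder_cases) (auto simp: abs_minus_commute)
qed

section \<open>The comparison splines\<close>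

lemma interval_integral_has_real_derivative:
  fixes f :: "real \<Rightarrow> real"
  assumes "continuous_on UNIV f"
  shows "((\<lambda>t. LBINT s=0..t. f s) has_real_derivative f t) (at t)"
proof -
  let ?a = "min 0 t - 1" and ?b = "max 0 t + 1"
  have "((\<lambda>u. LBINT y=ereal 0..u. f y) has_vector_derivative f t) (at t within {?a..?b})"
    using assms by (intro interval_integral_FTC2) (auto intro: continuous_on_subset)
  then show ?thesis
    by (simp add: has_real_derivative_iff_has_vector_derivative at_within_Icc_at zero_ereal_def)
qed

lemma has_real_derivative_zero_imp_eq:
  fixes f :: "real \<Rightarrow> real"
  assumes "\<And>t. (f has_real_derivative 0) (at t)"
  shows "f s = f t"
  using assms DERIV_isconst_all by metis

text \<open>The difference is constant and changes sign under the shift, hence is zero.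
  Antiperiodicity thus replaces the zero mean as the condition fixing the constant of
  integration.\<close>

lemma antiperiodic_eqI:
  fixes f g :: "real \<Rightarrow> real"
  assumes f: "\<And>t. (f has_real_derivative h t) (at t)" "\<And>t. f (t + H) = - f t"
    and g: "\<And>t. (g has_real_derivative h t) (at t)" "\<And>t. g (t + H) = - g t"
  shows "f = g"
proof
  fix t
  have "((\<lambda>t. f t - g t) has_real_derivative 0) (at t)" for t
    using DERIV_diff[OF f(1) g(1), of t] by simp
  then have "f (t + H) - g (t + H) = f t - g t"
    by (rule has_real_derivative_zero_imp_eq[of "\<lambda>t. f t - g t"])
  then show "f t = g t" using f(2)[of t] g(2)[of t] by simp
qed

lemma integral_of_shift_sum_const:
  fixes F :: "real \<Rightarrow> real"
  assumes cont: "continuous_on UNIV F" and K: "\<And>t. F (t + H) + F t = K"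
  shows "(LBINT u=0..2 * H. F u) = K * H"
proof -
  define G where "G t = (LBINT s=0..t. F s)" for t :: real
  have G: "(G has_real_derivative F t) (at t)" for t
    unfolding G_def by (rule interval_integral_has_real_derivative[OF cont])
  have sh: "((\<lambda>t. G (t + H)) has_real_derivative F (t + H)) (at t)" for t
    using G[of "t + H"] by (simp add: DERIV_shift)
  have "((\<lambda>t. G (t + H) + G t - K * t) has_real_derivative 0) (at t)" for t
    using DERIV_diff[OF DERIV_add[OF sh[of t] G[of t]] DERIV_cmult[OF DERIV_ident, of K]] K[of t] by simp
  from has_real_derivative_zero_imp_eq[OF this, of H 0] have "G (2 * H) = K * H"
    by (simp add: G_def zero_ereal_def)
  then show ?thesis by (simp add: G_def)
qed

text \<open>\<open>F (t + H) + F t\<close> is the constant \<open>F H\<close>, so the mean of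
  \<open>F\<close> over the period is \<open>F H / 2\<close>, and subtracting it makes the primitive
  antiperiodic again. The property therefore passes to all iterated primitives.\<close>

lemma periodic_primitive_antiperiodic:
  fixes f :: "real \<Rightarrow> real"
  assumes cont: "continuous_on UNIV f" and anti: "\<And>t. f (t + H) = - f t" and "H > 0"
  shows "(periodic_primitive (2 * H) f has_real_derivative f t) (at t)"
    and "periodic_primitive (2 * H) f (t + H) = - periodic_primitive (2 * H) f t"
proof -
  define F where "F t = (LBINT s=0..t. f s)" for t :: real
  have F: "(F has_real_derivative f t) (at t)" for t
    unfolding F_def by (rule interval_integral_has_real_derivative[OF cont])
  then have contF: "continuous_on UNIV F" by (meson DERIV_continuous_on has_field_derivative_at_within)
  have sh: "((\<lambda>t. F (t + H)) has_real_derivative f (t + H)) (at t)" for t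
    using F[of "t + H"] by (simp add: DERIV_shift)
  have FH: "F (t + H) + F t = F H" for t
  proof -
    have "((\<lambda>t. F (t + H) + F t) has_real_derivative 0) (at t)" for t
      using DERIV_add[OF sh[of t] F[of t]] anti[of t] by simp
    from has_real_derivative_zero_imp_eq[OF this, of t 0] show ?thesis
      by (simp add: F_def zero_ereal_def)
  qed
  have P: "periodic_primitive (2 * H) f t = F t - F H / 2" for t
    using integral_of_shift_sum_const[OF contF FH] \<open>H > 0\<close> by (simp add: periodic_primitive_def F_def)
  show "(periodic_primitive (2 * H) f has_real_derivative f t) (at t)"
    unfolding P using DERIV_diff[OF F DERIV_const] by simp
  show "periodic_primitive (2 * H) f (t + H) = - periodic_primitive (2 * H) f t"
    unfolding P using FH[of t] by simp
qed

section \<open>Symmetries and continuity of the initial spline\<close>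

definition lattice_dist :: "real \<Rightarrow> real \<Rightarrow> real" where
  "lattice_dist T t = \<bar>t - T * of_int (round (t / T))\<bar>"

lemma lattice_dist_factor:
  fixes t T :: real
  assumes "T > 0"
  shows "\<bar>t - T * of_int m\<bar> = T * \<bar>t / T - of_int m\<bar>"
proof -
  have "T * (t / T - of_int m) = t - T * of_int m" using assms by (simp add: right_diff_distrib)
  then show ?thesis using assms abs_mult[of T "t / T - of_int m"] by simp
qed

lemma lattice_dist_le: "T > 0 \<Longrightarrow> lattice_dist T t \<le> \<bar>t - T * of_int k\<bar>"
  unfolding lattice_dist_def lattice_dist_factor
  using round_diff_minimal[of "t / T" k] by (intro mult_left_mono) auto

lemma lattice_dist_nonneg: "lattice_dist T t \<ge> 0"
  by (simp add: lattice_dist_def)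

lemma lattice_dist_le_half: "T > 0 \<Longrightarrow> lattice_dist T t \<le> T / 2"
  unfolding lattice_dist_def lattice_dist_factor
  using of_int_round_abs_le[of "t / T"] mult_left_mono[of "\<bar>t / T - of_int (round (t / T))\<bar>" "1/2" T]
  by (simp add: abs_minus_commute)

lemma lattice_dist_lipschitz:
  assumes "T > 0" shows "\<bar>lattice_dist T s - lattice_dist T t\<bar> \<le> \<bar>s - t\<bar>"
proof -
  have "lattice_dist T s \<le> lattice_dist T t + \<bar>s - t\<bar>" for s t
    using lattice_dist_le[OF assms, of s "round (t / T)"] unfolding lattice_dist_def[of T t] by linarith
  from this[of s t] this[of t s] show ?thesis by (simp add: abs_le_iff abs_minus_commute)
qed

lemma lattice_dist_even:
  assumes "T > 0" shows "lattice_dist T (- t) = lattice_dist T t"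
proof -
  have "lattice_dist T (- t) \<le> lattice_dist T t" for t
    using lattice_dist_le[OF assms, of "- t" "- round (t / T)"] unfolding lattice_dist_def[of T t] by simp
  from this[of t] this[of "- t"] show ?thesis by simp
qed

lemma lattice_dist_shift:
  assumes T: "T > 0" shows "lattice_dist T (t + T / 2) = T / 2 - lattice_dist T t"
proof (rule antisym)
  let ?k = "round (t / T)" and ?l = "round ((t + T / 2) / T)"
  define e where "e = t - T * of_int ?k"
  have e: "lattice_dist T t = \<bar>e\<bar>" "\<bar>e\<bar> \<le> T / 2"
    using lattice_dist_le_half[OF T, of t] by (simp_all add: lattice_dist_def e_def)
  have "lattice_dist T (t + T / 2) \<le> \<bar>e - T / 2\<bar>"
    using lattice_dist_le[OF T, of "t + T / 2" "?k + 1"] by (simp add: e_def algebra_simps)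
  moreover have "lattice_dist T (t + T / 2) \<le> \<bar>e + T / 2\<bar>"
    using lattice_dist_le[OF T, of "t + T / 2" ?k] by (simp add: e_def algebra_simps)
  ultimately show "lattice_dist T (t + T / 2) \<le> T / 2 - lattice_dist T t"
    using e by linarith
  have "T / 2 \<le> \<bar>T * of_int (?l - ?k) - T / 2\<bar>"
  proof (cases "?l - ?k \<le> 0")
    case True
    then have "T * of_int (?l - ?k) \<le> 0" using T by (intro mult_nonneg_nonpos) linarith+
    then show ?thesis using T by linarith
  next
    case False
    then have "of_int (?l - ?k) \<ge> (1::real)" by linarith
    then have "T * of_int (?l - ?k) \<ge> T" using T by simp
    then show ?thesis using T by linarith
  qed
  also have "\<dots> = \<bar>(t - T * of_int ?k) - (t + T / 2 - T * of_int ?l)\<bar>"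
    by (simp add: algebra_simps)
  also have "\<dots> \<le> lattice_dist T t + lattice_dist T (t + T / 2)"
    unfolding lattice_dist_def by (rule abs_triangle_ineq4)
  finally show "T / 2 - lattice_dist T t \<le> lattice_dist T (t + T / 2)" by simp
qed

lemma lattice_dist_eq:
  assumes T: "T > 0" and t: "\<bar>t\<bar> \<le> T / 2" shows "lattice_dist T t = \<bar>t\<bar>"
proof -
  have "\<bar>t\<bar> \<le> \<bar>t - T * of_int k\<bar>" for k :: int
  proof -
    consider "k = 0" | "of_int k \<ge> (1::real)" | "of_int k \<le> (-1::real)" by linarith
    then show ?thesis
    proof cases
      case 2
      then have "T \<le> T * of_int k" using T by simp
      then show ?thesis using t by linarith
    next
      case 3
      then have "T * of_int k \<le> T * - 1" using T by (intro mult_left_mono) linarith+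
      then show ?thesis using t by linarith
    qed simp
  qed
  then show ?thesis using lattice_dist_le[OF T, of t 0] unfolding lattice_dist_def by (intro antisym) auto
qed

lemma psi1_lattice: "psi1 a t = psi1_base a (lattice_dist (4 + 2 * a) t)"
  by (simp add: psi1_def lattice_dist_def)

context
  fixes a :: real
  assumes a: "a \<ge> 0"
begin

lemma psi1_base_lipschitz: "\<bar>psi1_base a s - psi1_base a t\<bar> \<le> \<bar>s - t\<bar>"
  using a by (auto simp: psi1_base_def)

lemma psi1_lipschitz: "\<bar>psi1 a s - psi1 a t\<bar> \<le> \<bar>s - t\<bar>"
  unfolding psi1_lattice
  using psi1_base_lipschitz lattice_dist_lipschitz by (rule order_trans) (use a in simp)

lemma psi1_even: "psi1 a (- t) = psi1 a t"
  using a by (simp add: psi1_lattice lattice_dist_even)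

lemma psi1_antiperiodic: "psi1 a (t + (a + 2)) = - psi1 a t"
proof -
  have "psi1_base a (a + 2 - s) = - psi1_base a s" if "0 \<le> s" "s \<le> a + 2" for s
    using that a by (auto simp: psi1_base_def)
  moreover have "lattice_dist (4 + 2 * a) t \<le> a + 2"
    using lattice_dist_le_half[of "4 + 2 * a" t] a by simp
  moreover have "lattice_dist (4 + 2 * a) (t + (a + 2)) = a + 2 - lattice_dist (4 + 2 * a) t"
    using lattice_dist_shift[of "4 + 2 * a" t] a by (simp add: add_divide_distrib add.commute)
  ultimately show ?thesis using lattice_dist_nonneg by (simp add: psi1_lattice)
qed

lemma psi1_eq: "\<bar>t\<bar> \<le> a + 2 \<Longrightarrow> psi1 a t = psi1_base a \<bar>t\<bar>"
  using a by (simp add: psi1_lattice lattice_dist_eq)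

end

lemma lipschitz_continuous_on:
  fixes f :: "real \<Rightarrow> real"
  assumes "\<And>s t. \<bar>f s - f t\<bar> \<le> M * \<bar>s - t\<bar>"
  shows "continuous_on A f"
proof -
  have "0 \<le> M" using assms[of 0 1] abs_ge_zero[of "f 0 - f 1"] by simp
  then have "M-lipschitz_on A f" using assms by (intro lipschitz_onI) (auto simp: dist_real_def)
  then show ?thesis by (rule lipschitz_on_continuous_on)
qed

lemma psi_Suc_0 [simp]: "psi (Suc 0) a = psi1 a"
  by (simp add: psi_def)

lemma psi_Suc: "s \<ge> 1 \<Longrightarrow> psi (Suc s) a = periodic_primitive (2 * (a + 2)) (psi s a)"
proof -
  assume "s \<ge> 1"
  then obtain m where m: "s = Suc m" by (cases s) auto
  have "2 * (a + 2) = 4 + 2 * a" by simp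
  then show ?thesis unfolding psi_def m by (simp only: diff_Suc_1 funpow.simps o_apply)
qed

lemma psi_continuous_antiperiodic:
  assumes a: "a \<ge> 0"
  shows "continuous_on UNIV (psi (Suc m) a) \<and> (\<forall>t. psi (Suc m) a (t + (a + 2)) = - psi (Suc m) a t)"
proof (induction m)
  case 0
  then show ?case
    using psi1_antiperiodic[OF a] lipschitz_continuous_on[of "psi1 a" 1] psi1_lipschitz[OF a] by simp
next
  case (Suc m)
  have "psi (Suc (Suc m)) a = periodic_primitive (2 * (a + 2)) (psi (Suc m) a)" by (simp add: psi_Suc)
  then show ?case
    using periodic_primitive_antiperiodic[of "psi (Suc m) a" "a + 2"] Suc a
    by (metis DERIV_continuous_on add_nonneg_pos has_field_derivative_at_within zero_less_numeral)
qed

lemma psi_antiperiodic: "\<lbrakk>a \<ge> 0; s \<ge> 1\<rbrakk> \<Longrightarrow> psi s a (t + (a + 2)) = - psi s a t"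
  using psi_continuous_antiperiodic[of a "s - 1"] by simp

lemma psi_continuous: "\<lbrakk>a \<ge> 0; s \<ge> 1\<rbrakk> \<Longrightarrow> continuous_on A (psi s a)"
  using psi_continuous_antiperiodic[of a "s - 1"] by (auto intro: continuous_on_subset)

lemma psi_deriv: "\<lbrakk>a \<ge> 0; s \<ge> 1\<rbrakk> \<Longrightarrow> (psi (Suc s) a has_real_derivative psi s a t) (at t)"
  using periodic_primitive_antiperiodic(1)[of "psi s a" "a + 2"] psi_continuous[of a s UNIV]
    psi_antiperiodic[of a s] by (simp add: psi_Suc)

text \<open>The reflected spline with the appropriate sign is an antiperiodic primitive of the same
  function, and such a primitive is unique.\<close>

lemma psi_parity:
  assumes a: "a \<ge> 0"
  shows "psi (Suc m) a (- t) = (- 1) ^ m * psi (Suc m) a t"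
proof (induction m arbitrary: t)
  case 0
  then show ?case using psi1_even[OF a] by simp
next
  case (Suc m)
  have "(\<lambda>t. - ((- 1) ^ m) * psi (Suc (Suc m)) a (- t)) = psi (Suc (Suc m)) a"
  proof (rule antiperiodic_eqI)
    fix t
    have "((\<lambda>t. psi (Suc (Suc m)) a (- t)) has_real_derivative psi (Suc m) a (- t) * - 1) (at t)"
      by (rule DERIV_chain2[OF psi_deriv[OF a]]) (auto intro!: derivative_eq_intros)
    from DERIV_cmult[OF this, of "- ((- 1) ^ m)"]
    show "((\<lambda>t. - ((- 1) ^ m) * psi (Suc (Suc m)) a (- t)) has_real_derivative psi (Suc m) a t) (at t)"
      by (simp add: Suc flip: power_add mult_2)
    show "- ((- 1) ^ m) * psi (Suc (Suc m)) a (- (t + (a + 2))) = - (- ((- 1) ^ m) * psi (Suc (Suc m)) a (- t))"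
    proof -
      have "- (t + (a + 2)) + (a + 2) = - t" by simp
      then show ?thesis
        using psi_antiperiodic[OF a, of "Suc (Suc m)" "- (t + (a + 2))"] by simp
    qed
  qed (use a psi_antiperiodic[OF a, of "Suc (Suc m)"] psi_deriv[OF a] in auto)
  from fun_cong[OF this, of "t"]
  have "psi (Suc (Suc m)) a t = - ((- 1) ^ m) * psi (Suc (Suc m)) a (- t)" by simp
  then show ?case by simp
qed

section \<open>The splines on a quarter period\<close>

lemma psi_zero:
  assumes a: "a \<ge> 0"
  shows "odd m \<Longrightarrow> psi (Suc m) a 0 = 0" and "even m \<Longrightarrow> psi (Suc m) a (1 + a / 2) = 0"
proof -
  show "odd m \<Longrightarrow> psi (Suc m) a 0 = 0" using psi_parity[OF a, of m 0] by simp
  show "even m \<Longrightarrow> psi (Suc m) a (1 + a / 2) = 0"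
  proof -
    assume "even m"
    moreover have "- (1 + a / 2) + (a + 2) = 1 + a / 2" by simp
    ultimately show ?thesis
      using psi_parity[OF a, of m "1 + a / 2"] psi_antiperiodic[OF a, of "Suc m" "- (1 + a / 2)"]
      by (simp only: neg_one_even_power mult_1 le_add1 plus_1_eq_Suc[symmetric] neg_equal_zero) simp
  qed
qed

text \<open>This is the modulus of \<open>psi (Suc m) a\<close> on the quarter period
  \<open>[0, c]\<close> with \<open>c = 1 + a / 2\<close>. Each further primitive vanishes at one
  end, alternately at 0 and at \<open>c\<close>; integrating away from that end keeps everything
  nonnegative, so norms and their dependence on \<open>a\<close> can be studied without
  signs.\<close>

primrec quarter :: "real \<Rightarrow> nat \<Rightarrow> real \<Rightarrow> real" where
  "quarter c 0 = (\<lambda>t. max 0 (1 - t))"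
| "quarter c (Suc m) = (\<lambda>t. if even m then integral {0..t} (quarter c m) else integral {t..c} (quarter c m))"

lemma quarter_continuous: "continuous_on {0..c} (quarter c m)"
proof (induction m)
  case 0
  then show ?case by (auto intro!: continuous_intros)
next
  case (Suc m)
  then show ?case
    using indefinite_integral_continuous_1[OF integrable_continuous_real]
      indefinite_integral_continuous_1'[OF integrable_continuous_real] by (cases "even m") auto
qed

lemma quarter_integrable: "\<lbrakk>0 \<le> s; t \<le> c\<rbrakk> \<Longrightarrow> quarter c m integrable_on {s..t}"
  by (rule integrable_continuous_real) (rule continuous_on_subset[OF quarter_continuous], auto)

lemma quarter_nonneg: "\<lbrakk>0 \<le> t; t \<le> c\<rbrakk> \<Longrightarrow> 0 \<le> quarter c m t"
proof (induction m arbitrary: t)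
  case (Suc m)
  have "0 \<le> integral {p..q} (quarter c m)" if "0 \<le> p" "q \<le> c" for p q
    using that Suc.IH by (intro integral_nonneg quarter_integrable) auto
  then show ?case using Suc.prems by simp
qed simp

text \<open>The next primitive vanishes at 0 for even \<open>m\<close> and at
  \<open>1 + a / 2\<close> for odd \<open>m\<close>; in the second case the integral runs backwards
  to the zero, which flips the sign \<open>e\<close>.\<close>

lemma psi_quarter:
  assumes a: "a \<ge> 0"
  shows "\<exists>e\<in>{1, -1}. \<forall>t\<in>{0..1 + a / 2}. psi (Suc m) a t = e * quarter (1 + a / 2) m t"
proof (induction m)
  case 0
  have "psi (Suc 0) a t = - 1 * quarter (1 + a / 2) 0 t" if "t \<in> {0..1 + a / 2}" for t
    using that a by (auto simp: psi1_eq psi1_base_def)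
  then show ?case by blast
next
  case (Suc m)
  let ?c = "1 + a / 2"
  obtain e where e: "e \<in> {1, -1}" "\<And>t. t\<in>{0..?c} \<Longrightarrow> psi (Suc m) a t = e * quarter ?c m t"
    using Suc by blast
  have int: "((\<lambda>t. e * quarter ?c m t) has_integral (psi (Suc (Suc m)) a t - psi (Suc (Suc m)) a s)) {s..t}"
    if "0 \<le> s" "s \<le> t" "t \<le> ?c" for s t
  proof -
    have "(psi (Suc m) a has_integral (psi (Suc (Suc m)) a t - psi (Suc (Suc m)) a s)) {s..t}"
      using that psi_deriv[OF a, of "Suc m"]
      by (intro fundamental_theorem_of_calculus)
        (auto simp: has_real_derivative_iff_has_vector_derivative[symmetric] intro: has_field_derivative_at_within)
    then show ?thesis by (rule has_integral_eq[rotated]) (use that e(2) in auto)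
  qed
  have eq: "e * integral {s..t} (quarter ?c m) = psi (Suc (Suc m)) a t - psi (Suc (Suc m)) a s"
    if "0 \<le> s" "s \<le> t" "t \<le> ?c" for s t
    using integral_unique[OF int[OF that]] by simp
  show ?case
  proof (cases "even m")
    case True
    then have "psi (Suc (Suc m)) a t = e * quarter ?c (Suc m) t" if "t \<in> {0..?c}" for t
      using eq[of 0 t] that psi_zero(1)[OF a, of "Suc m"] by simp
    then show ?thesis using e(1) by blast
  next
    case False
    then have "psi (Suc (Suc m)) a t = - e * quarter ?c (Suc m) t" if "t \<in> {0..?c}" for t
      using eq[of t ?c] that psi_zero(2)[OF a, of "Suc m"] by simp
    moreover have "- e \<in> {1, -1}" using e(1) by auto
    ultimately show ?thesis by blast
  qed
qed

lemma psi_abs_quarter: "\<lbrakk>a \<ge> 0; 0 \<le> t; t \<le> 1 + a / 2\<rbrakk> \<Longrightarrow> \<bar>psi (Suc m) a t\<bar> = quarter (1 + a / 2) m t"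
  using psi_quarter[of a m] quarter_nonneg[of t "1 + a / 2" m] by auto

lemma integral_mono_subset:
  fixes f :: "real \<Rightarrow> real"
  assumes "continuous_on {p..q} f" "\<And>x. x \<in> {p..q} \<Longrightarrow> 0 \<le> f x" "p \<le> s" "t \<le> q"
  shows "integral {s..t} f \<le> integral {p..q} f"
  using assms
  by (intro integral_subset_le integrable_continuous_real) (auto intro: continuous_on_subset)

lemma quarter_mono:
  assumes "0 \<le> s" "s \<le> t" "t \<le> c"
  shows "even m \<Longrightarrow> quarter c m t \<le> quarter c m s" and "odd m \<Longrightarrow> quarter c m s \<le> quarter c m t"
proof -
  have "(if even m then quarter c m t \<le> quarter c m s else quarter c m s \<le> quarter c m t)"
  proof (cases m)
    case 0
    then show ?thesis using assms by simp
  next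
    case (Suc n)
    have "continuous_on {s..c} (quarter c n)" "continuous_on {0..t} (quarter c n)"
      using assms by (auto intro: continuous_on_subset[OF quarter_continuous])
    then show ?thesis
      using assms quarter_nonneg[of _ c n] Suc by (auto intro!: integral_mono_subset)
  qed
  then show "even m \<Longrightarrow> quarter c m t \<le> quarter c m s" "odd m \<Longrightarrow> quarter c m s \<le> quarter c m t"
    by (simp_all split: if_splits)
qed

text \<open>The maximal modulus, as \<open>psi_abs_le\<close> shows: splines of odd order are even
  functions peaking at 0, those of even order are odd functions peaking at the quarter
  period.\<close>

definition psi_norm :: "nat \<Rightarrow> real \<Rightarrow> real" where
  "psi_norm s a = \<bar>psi s a (if odd s then 0 else 1 + a / 2)\<bar>"

lemma psi_norm_quarter:
  "a \<ge> 0 \<Longrightarrow> psi_norm (Suc m) a = quarter (1 + a / 2) m (if even m then 0 else 1 + a / 2)"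
  by (simp add: psi_norm_def psi_abs_quarter)

lemma antiperiodic_shift_int:
  fixes f :: "real \<Rightarrow> real"
  assumes "\<And>t. f (t + H) = - f t"
  shows "f (t + of_int j * H) = (- 1) powi j * f t"
proof (induction j rule: int_induct[where k = 0])
  case (step1 i)
  then show ?case using assms[of "t + of_int i * H"] by (simp add: power_int_add algebra_simps)
next
  case (step2 i)
  then show ?case using assms[of "t + of_int (i - 1) * H"] by (simp add: power_int_diff algebra_simps)
qed simp

text \<open>A shift by a multiple of \<open>a + 2\<close> and a reflection move the argument into
  the quarter period, where the modulus is monotone.\<close>

lemma psi_abs_le:
  assumes a: "a \<ge> 0" and "s \<ge> 1"
  shows "\<bar>psi s a t\<bar> \<le> psi_norm s a"
proof -
  obtain m where m: "s = Suc m" using \<open>s \<ge> 1\<close> by (cases s) auto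
  let ?H = "a + 2" and ?c = "1 + a / 2"
  have H: "?H > 0" "?H = 2 * ?c" using a by auto
  have *: "\<bar>psi (Suc m) a t\<bar> \<le> psi_norm (Suc m) a" if "0 \<le> t" "t \<le> ?c" for t
    using that a quarter_mono[of 0 t ?c m] quarter_mono[of t ?c ?c m]
    by (cases "even m") (auto simp: psi_abs_quarter psi_norm_quarter)
  have **: "\<bar>psi (Suc m) a t\<bar> \<le> psi_norm (Suc m) a" if "\<bar>t\<bar> \<le> ?c" for t
    using *[of t] *[of "- t"] psi_parity[OF a, of m t] that by (cases "t \<ge> 0") (auto simp: abs_mult)
  define j where "j = round (t / ?H)"
  have "\<bar>t / ?H - of_int j\<bar> \<le> 1 / 2"
    using of_int_round_abs_le[of "t / ?H"] by (simp add: j_def abs_minus_commute)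
  then have "\<bar>t / ?H - of_int j\<bar> * ?H \<le> 1 / 2 * ?H"
    using H(1) by (intro mult_right_mono) auto
  moreover have "\<bar>t / ?H - of_int j\<bar> * ?H = \<bar>(t / ?H - of_int j) * ?H\<bar>"
    using H(1) by (simp add: abs_mult)
  moreover have "(t / ?H - of_int j) * ?H = t - of_int j * ?H" using H(1) by (simp add: left_diff_distrib)
  moreover have "1 / 2 * ?H = ?c" by simp
  ultimately have "\<bar>t - of_int j * ?H\<bar> \<le> ?c" by metis
  then have "\<bar>psi (Suc m) a (t - of_int j * ?H)\<bar> \<le> psi_norm (Suc m) a"
    by (rule **)
  moreover have "psi (Suc m) a (t - of_int j * ?H + of_int j * ?H) = (- 1) powi j * psi (Suc m) a (t - of_int j * ?H)"
    by (rule antiperiodic_shift_int[where f = "psi (Suc m) a"]) (simp add: psi_antiperiodic[OF a])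
  then have "\<bar>psi (Suc m) a t\<bar> = \<bar>psi (Suc m) a (t - of_int j * ?H)\<bar>"
    by (simp add: abs_mult power_int_abs)
  ultimately show ?thesis by (simp add: m)
qed

lemma psi_norm_attained:
  assumes a: "a \<ge> 0" and "s \<ge> 1"
  obtains t where "psi s a t = psi_norm s a" "psi s a (t + (a + 2)) = - psi_norm s a"
proof -
  obtain u where u: "psi_norm s a = \<bar>psi s a u\<bar>" unfolding psi_norm_def by blast
  have "psi s a (u + (a + 2)) = - psi s a u" "psi s a (u + (a + 2) + (a + 2)) = - psi s a (u + (a + 2))"
    using psi_antiperiodic[OF assms] by blast+
  then show ?thesis
    using that[of u] that[of "u + (a + 2)"] u by (cases "psi s a u \<ge> 0") auto
qed

lemma psi_2_eq:
  assumes a: "a \<ge> 0"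
  shows "0 \<le> t \<Longrightarrow> t \<le> 1 \<Longrightarrow> psi 2 a t = t\<^sup>2 / 2 - t" and "1 \<le> t \<Longrightarrow> t \<le> a + 1 \<Longrightarrow> psi 2 a t = - 1 / 2"
proof -
  have two: "psi 2 a = psi (Suc (Suc 0)) a" by (simp add: numeral_2_eq_2)
  have d: "(psi 2 a has_vector_derivative psi1 a t) (at t within A)" for t A
    using psi_deriv[OF a, of "Suc 0" t] unfolding two
    by (auto simp: has_real_derivative_iff_has_vector_derivative[symmetric] intro: has_field_derivative_at_within)
  have 0: "psi 2 a 0 = 0" using psi_zero(1)[OF a, of 1] by (simp add: two)
  have 1: "psi 2 a t = t\<^sup>2 / 2 - t" if "0 \<le> t" "t \<le> 1" for t
  proof -
    have "(psi1 a has_integral (psi 2 a t - psi 2 a 0)) {0..t}"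
      using that d by (intro fundamental_theorem_of_calculus) auto
    moreover have "(psi1 a has_integral ((t\<^sup>2 / 2 - t) - (0\<^sup>2 / 2 - 0))) {0..t}"
    proof (rule has_integral_eq[of _ "\<lambda>x. x - 1"])
      show "((\<lambda>x. x - 1) has_integral ((t\<^sup>2 / 2 - t) - (0\<^sup>2 / 2 - 0))) {0..t}"
        using that by (intro fundamental_theorem_of_calculus)
          (auto simp: has_real_derivative_iff_has_vector_derivative[symmetric] intro!: derivative_eq_intros)
      show "x - 1 = psi1 a x" if "x \<in> {0..t}" for x
        using that \<open>t \<le> 1\<close> a by (simp add: psi1_eq psi1_base_def)
    qed
    ultimately have "psi 2 a t - psi 2 a 0 = (t\<^sup>2 / 2 - t) - (0\<^sup>2 / 2 - 0)" by (rule has_integral_unique)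
    then show ?thesis using 0 by simp
  qed
  show "0 \<le> t \<Longrightarrow> t \<le> 1 \<Longrightarrow> psi 2 a t = t\<^sup>2 / 2 - t" by (rule 1)
  assume t: "1 \<le> t" "t \<le> a + 1"
  have "(psi1 a has_integral (psi 2 a t - psi 2 a 1)) {1..t}"
    using t d by (intro fundamental_theorem_of_calculus) auto
  moreover have "(psi1 a has_integral 0) {1..t}"
    by (rule has_integral_eq[OF _ has_integral_0]) (use t a in \<open>auto simp: psi1_eq psi1_base_def\<close>)
  ultimately have "psi 2 a t - psi 2 a 1 = 0" by (rule has_integral_unique)
  then show "psi 2 a t = - 1 / 2" using 1[of 1] by simp
qed

text \<open>The quarter point lies on the plateau \<open>[1, a + 1]\<close>, whose height does not
  depend on \<open>a\<close>.\<close>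

lemma psi_norm_2: "a \<ge> 0 \<Longrightarrow> psi_norm 2 a = 1 / 2"
  by (simp add: psi_norm_def psi_2_eq)

section \<open>Dependence of the norms on the parameter\<close>

lemma integral_pos:
  fixes f :: "real \<Rightarrow> real"
  assumes "continuous_on {p..q} f" "p < q" "\<And>x. x \<in> {p..q} \<Longrightarrow> 0 \<le> f x" "z \<in> {p..q}" "0 < f z"
  shows "0 < integral {p..q} f"
proof -
  have "integral {p..q} f \<noteq> 0"
    using integral_eq_0_iff[OF assms(1-3)] assms(4,5) by force
  moreover have "integral {p..q} f \<ge> 0"
    using assms(1,3) by (intro integral_nonneg integrable_continuous_real)
  ultimately show ?thesis by simp
qed

lemma quarter_continuous_sub: "\<lbrakk>0 \<le> s; t \<le> c\<rbrakk> \<Longrightarrow> continuous_on {s..t} (quarter c m)"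
  by (rule continuous_on_subset[OF quarter_continuous]) auto

lemma quarter_pos:
  assumes "0 < c"
  shows "if even m then 0 < quarter c m 0 else (\<forall>t\<in>{0<..c}. 0 < quarter c m t)"
proof (induction m)
  case (Suc m)
  show ?case
  proof (cases "even m")
    case True
    have "0 < integral {0..t} (quarter c m)" if "t \<in> {0<..c}" for t
      using that Suc True by (intro integral_pos[where z = 0] quarter_continuous_sub quarter_nonneg) auto
    then show ?thesis using True by simp
  next
    case False
    have "0 < integral {0..c} (quarter c m)"
      using Suc False assms by (intro integral_pos[where z = c] quarter_continuous_sub quarter_nonneg) auto
    then show ?thesis using False by simp
  qed
qed simp

lemma quarter_mono_param:
  assumes "0 < c" "c \<le> c'"
  shows "\<lbrakk>0 \<le> t; t \<le> c\<rbrakk> \<Longrightarrow> quarter c m t \<le> quarter c' m t"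
proof (induction m arbitrary: t)
  case (Suc m)
  show ?case
  proof (cases "even m")
    case True
    have "integral {0..t} (quarter c m) \<le> integral {0..t} (quarter c' m)"
      using Suc assms by (intro integral_le quarter_integrable) auto
    then show ?thesis using True by simp
  next
    case False
    have "integral {t..c} (quarter c m) \<le> integral {t..c} (quarter c' m)"
      using Suc assms by (intro integral_le quarter_integrable) auto
    also have "\<dots> \<le> integral {t..c'} (quarter c' m)"
      using Suc.prems assms by (intro integral_mono_subset quarter_continuous_sub quarter_nonneg) auto
    finally show ?thesis using False by simp
  qed
qed simp

text \<open>At a fixed argument orders 0 and 1 do not depend on \<open>c\<close>. From order 2 on,
  backward integration gains the positive mass over \<open>[c, c']\<close>, and forward integration
  passes the gain on.\<close>

lemma quarter_strict_mono_param:
  assumes "0 < c" "c < c'"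
  shows "\<lbrakk>even m; m \<ge> 2; 0 \<le> t; t \<le> c\<rbrakk> \<Longrightarrow> quarter c m t < quarter c' m t"
    and "\<lbrakk>odd m; m \<ge> 3\<rbrakk> \<Longrightarrow> quarter c m c < quarter c' m c"
proof -
  show even: "quarter c m t < quarter c' m t" if m: "even m" "m \<ge> 2" and t: "0 \<le> t" "t \<le> c" for m t
  proof -
    obtain n where n: "m = Suc n" "odd n" using m by (cases m) auto
    have "integral {t..c} (quarter c n) \<le> integral {t..c} (quarter c' n)"
      using t assms by (intro integral_le quarter_integrable quarter_mono_param) auto
    moreover have "0 < integral {c..c'} (quarter c' n)"
      using assms quarter_pos[of c' n] n(2)
      by (intro integral_pos[where z = c] quarter_continuous_sub quarter_nonneg) auto
    moreover have "integral {t..c} (quarter c' n) + integral {c..c'} (quarter c' n) = integral {t..c'} (quarter c' n)"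
      using t assms by (intro Henstock_Kurzweil_Integration.integral_combine quarter_integrable) auto
    ultimately show ?thesis using n by simp
  qed
  show "quarter c m c < quarter c' m c" if m: "odd m" "m \<ge> 3"
  proof -
    obtain n where n: "m = Suc n" "even n" "n \<ge> 2" using m by (cases m) auto
    have "0 < integral {0..c} (\<lambda>t. quarter c' n t - quarter c n t)"
      using even[of n] n assms
      by (intro integral_pos[where z = 0] continuous_on_diff quarter_continuous_sub) (auto intro: less_imp_le)
    then have "integral {0..c} (quarter c n) < integral {0..c} (quarter c' n)"
      using assms by (subst (asm) integral_diff) (auto intro: quarter_integrable)
    then show ?thesis using n by simp
  qed
qed

text \<open>The initial profile lies below its own stretching by \<open>c' / c\<close>, and each
  integration contributes one more such factor. This upper bound on the growth complements
  monotonicity in the proof of continuity.\<close>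

lemma quarter_scale_le:
  assumes "0 < c" "c \<le> c'"
  shows "\<lbrakk>0 \<le> t; t \<le> c'\<rbrakk> \<Longrightarrow> quarter c' m t \<le> (c' / c) ^ m * quarter c m (t / (c' / c))"
proof (induction m arbitrary: t)
  case 0
  have "t * (c / c') \<le> t * 1" using 0(1) assms by (intro mult_left_mono) auto
  then have "t / (c' / c) \<le> t" by simp
  then show ?case by (simp del: divide_divide_eq_right)
next
  case (Suc m)
  define \<theta> where "\<theta> = c' / c"
  have \<theta>: "\<theta> > 0" "\<theta> \<ge> 1" "c' / \<theta> = c" "c * \<theta> = c'" using assms by (auto simp: \<theta>_def)
  have le: "integral {s..t} (quarter c' m) \<le> \<theta> ^ Suc m * integral {s / \<theta>..t / \<theta>} (quarter c m)"
    if st: "0 \<le> s" "s \<le> t" "t \<le> c'" for s t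
  proof -
    have dc: "t / \<theta> \<le> c" using st(3) \<theta>(1,4) by (simp only: pos_divide_le_eq)
    have "(quarter c m has_integral integral {s / \<theta>..t / \<theta>} (quarter c m)) (cbox (s / \<theta>) (t / \<theta>))"
      unfolding cbox_interval
      by (intro integrable_integral quarter_integrable divide_nonneg_pos st(1) \<theta>(1) dc)
    moreover have im: "(\<lambda>x. \<theta> * x) ` {s / \<theta>..t / \<theta>} = {s..t}" "(\<lambda>x. x * \<theta>) ` {s / \<theta>..t / \<theta>} = {s..t}"
      using \<theta>(1) image_mult_atLeastAtMost[of \<theta> "s / \<theta>" "t / \<theta>"] by (simp_all add: mult.commute)
    ultimately have "((\<lambda>x. quarter c m (x / \<theta>)) has_integral \<theta> * integral {s / \<theta>..t / \<theta>} (quarter c m)) {s..t}"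
      using has_integral_affinity[of "quarter c m" "integral {s / \<theta>..t / \<theta>} (quarter c m)" "s / \<theta>" "t / \<theta>" "1 / \<theta>" 0] \<theta>(1) st
      by (simp add: divide_right_mono mult.commute)
    then have I: "((\<lambda>x. \<theta> ^ m * quarter c m (x / \<theta>)) has_integral \<theta> ^ m * (\<theta> * integral {s / \<theta>..t / \<theta>} (quarter c m))) {s..t}"
      by (rule has_integral_mult_right)
    have "integral {s..t} (quarter c' m) \<le> \<theta> ^ m * (\<theta> * integral {s / \<theta>..t / \<theta>} (quarter c m))"
      using st Suc.IH[folded \<theta>_def]
      by (intro has_integral_le[OF integrable_integral[OF quarter_integrable] I]) auto
    then show ?thesis by (simp add: mult.assoc mult.left_commute)
  qed
  show ?case
    using le[of 0 t] le[of t c'] Suc.prems \<theta>(3) by (auto simp: \<theta>_def[symmetric] simp del: divide_divide_eq_right)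
qed

lemma psi_norm_strict_mono:
  assumes "0 \<le> a" "a < a'" "s \<ge> 3"
  shows "psi_norm s a < psi_norm s a'"
proof -
  obtain m where m: "s = Suc m" "m \<ge> 2" using \<open>s \<ge> 3\<close> by (cases s) auto
  let ?c = "1 + a / 2" and ?c' = "1 + a' / 2"
  have c: "0 < ?c" "?c < ?c'" using assms by auto
  show ?thesis
  proof (cases "even m")
    case True
    then show ?thesis
      using quarter_strict_mono_param(1)[OF c True m(2), of 0] c assms by (simp add: m psi_norm_quarter)
  next
    case False
    then have "m \<ge> 3" using m(2) by (metis Suc_leI eval_nat_numeral(3) even_numeral le_neq_implies_less)
    then show ?thesis
      using quarter_strict_mono_param(2)[OF c False] quarter_mono(2)[of ?c ?c' ?c' m] c assms False
      by (simp add: m psi_norm_quarter)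
  qed
qed

lemma psi_norm_scale_le:
  assumes "0 \<le> a" "a \<le> a'" "s \<ge> 1"
  shows "psi_norm s a' \<le> ((1 + a' / 2) / (1 + a / 2)) ^ (s - 1) * psi_norm s a"
proof -
  obtain m where m: "s = Suc m" using \<open>s \<ge> 1\<close> by (cases s) auto
  let ?c = "1 + a / 2" and ?c' = "1 + a' / 2"
  have c: "0 < ?c" "?c \<le> ?c'" using assms by auto
  have "?c' / (?c' / ?c) = ?c" using c by simp
  then show ?thesis
    using quarter_scale_le[OF c, of "if even m then 0 else ?c'" m] c assms
    by (auto simp: m psi_norm_quarter simp del: divide_divide_eq_right)
qed

lemma psi_norm_mono: "\<lbrakk>0 \<le> a; a \<le> a'; s \<ge> 3\<rbrakk> \<Longrightarrow> psi_norm s a \<le> psi_norm s a'"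
  using psi_norm_strict_mono[of a a' s] by (cases "a = a'") auto

lemma psi_norm_nonneg: "psi_norm s a \<ge> 0"
  by (simp add: psi_norm_def)

lemma psi_norm_pos:
  assumes "0 \<le> a" "s \<ge> 1" shows "psi_norm s a > 0"
proof -
  obtain m where m: "s = Suc m" using \<open>s \<ge> 1\<close> by (cases s) auto
  show ?thesis using quarter_pos[of "1 + a / 2" m] assms by (auto simp: m psi_norm_quarter split: if_splits)
qed

text \<open>Monotonicity and the growth bound enclose the norm between two expressions that both
  tend to its value at \<open>a0\<close>.\<close>

lemma psi_norm_continuous:
  assumes "s \<ge> 3"
  shows "continuous_on {0..} (psi_norm s)"
proof -
  let ?N = "psi_norm s" and ?c = "\<lambda>a. 1 + a / 2 :: real"
  have main: "((\<lambda>a. ?N a) \<longlongrightarrow> ?N a0) (at a0 within {0..})" if a0: "a0 \<ge> 0" for a0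
  proof (rule tendsto_sandwich)
    let ?lo = "\<lambda>a. min 1 ((?c a / ?c a0) ^ (s - 1)) * ?N a0"
    let ?hi = "\<lambda>a. max 1 ((?c a / ?c a0) ^ (s - 1)) * ?N a0"
    have "?lo a \<le> ?N a \<and> ?N a \<le> ?hi a" if "a \<ge> 0" for a
    proof (cases "a0 \<le> a")
      case True
      have "?N a0 \<le> ?N a" using True a0 assms by (intro psi_norm_mono) auto
      moreover have "?lo a \<le> 1 * ?N a0" by (intro mult_right_mono psi_norm_nonneg) auto
      moreover have "(?c a / ?c a0) ^ (s - 1) * ?N a0 \<le> ?hi a" by (intro mult_right_mono psi_norm_nonneg) auto
      ultimately show ?thesis using psi_norm_scale_le[OF a0 True, of s] assms by linarith
    next
      case False
      have "?N a \<le> ?N a0" using False that assms by (intro psi_norm_mono) auto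
      moreover have "1 * ?N a0 \<le> ?hi a" by (intro mult_right_mono psi_norm_nonneg) auto
      moreover have "(?c a / ?c a0) ^ (s - 1) * ?N a0 \<le> ?N a"
      proof -
        have "?N a0 \<le> (?c a0 / ?c a) ^ (s - 1) * ?N a" using False that assms by (intro psi_norm_scale_le) auto
        then have "(?c a / ?c a0) ^ (s - 1) * ?N a0 \<le> (?c a / ?c a0) ^ (s - 1) * ((?c a0 / ?c a) ^ (s - 1) * ?N a)"
          using that a0 by (intro mult_left_mono) auto
        also have "\<dots> = ?N a"
          using that a0 by (simp add: power_divide)
        finally show ?thesis .
      qed
      moreover have "?lo a \<le> (?c a / ?c a0) ^ (s - 1) * ?N a0" by (intro mult_right_mono psi_norm_nonneg) auto
      ultimately show ?thesis by linarith
    qed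
    then show "\<forall>\<^sub>F a in at a0 within {0..}. ?lo a \<le> ?N a" "\<forall>\<^sub>F a in at a0 within {0..}. ?N a \<le> ?hi a"
      by (auto simp: eventually_at_filter)
    have ne: "?c a0 \<noteq> 0" using a0 by simp
    have "((\<lambda>a. (?c a / ?c a0) ^ (s - 1)) \<longlongrightarrow> (?c a0 / ?c a0) ^ (s - 1)) (at a0 within {0..})"
      by (intro tendsto_intros ne) simp
    then have one: "((\<lambda>a. (?c a / ?c a0) ^ (s - 1)) \<longlongrightarrow> 1) (at a0 within {0..})" using ne by simp
    show "(?lo \<longlongrightarrow> ?N a0) (at a0 within {0..})"
      using tendsto_mult_right[OF tendsto_min[OF tendsto_const one, of 1], of "?N a0"] by simp
    show "(?hi \<longlongrightarrow> ?N a0) (at a0 within {0..})"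
      using tendsto_mult_right[OF tendsto_max[OF tendsto_const one, of 1], of "?N a0"] by simp
  qed
  then show ?thesis by (auto simp: continuous_on_def)
qed

text \<open>On \<open>[1, c]\<close> an odd-order profile stays above its end value for
  \<open>c = 1\<close>; integrating this backwards contributes a multiple of the length
  \<open>c - 1\<close>.\<close>

lemma psi_norm_unbounded:
  assumes "s \<ge> 3"
  shows "\<exists>\<kappa>>0. \<forall>a\<ge>0. \<kappa> * a \<le> psi_norm s a"
proof -
  obtain m where m: "s = Suc m" "m \<ge> 2" using \<open>s \<ge> 3\<close> by (cases s) auto
  \<comment> \<open>Uniformity in \<open>t\<close> over \<open>[0, 1]\<close> is required because
    the odd case integrates this bound once more over that interval.\<close>
  have even: "\<exists>\<kappa>>0. \<forall>c\<ge>1. \<forall>t\<in>{0..1}. \<kappa> * (c - 1) \<le> quarter c m t" if m: "even m" "m \<ge> 2" for m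
  proof -
    obtain n where n: "m = Suc n" "odd n" using m by (cases m) auto
    let ?\<kappa> = "quarter 1 n 1"
    have "?\<kappa> > 0" using quarter_pos[of 1 n] n by simp
    moreover have "?\<kappa> * (c - 1) \<le> quarter c m t" if c: "c \<ge> 1" and t: "t \<in> {0..1}" for c t
    proof -
      have "?\<kappa> * (c - 1) = integral {1..c} (\<lambda>_. ?\<kappa>)" using c by simp
      also have "\<dots> \<le> integral {1..c} (quarter c n)"
      proof (intro integral_le quarter_integrable)
        fix x assume x: "x \<in> {1..c}"
        have "?\<kappa> \<le> quarter c n 1" using c by (intro quarter_mono_param) auto
        also have "\<dots> \<le> quarter c n x" using x n by (intro quarter_mono) auto
        finally show "?\<kappa> \<le> quarter c n x" .
      qed auto
      also have "\<dots> \<le> integral {t..c} (quarter c n)"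
        using t by (intro integral_mono_subset quarter_continuous_sub quarter_nonneg) auto
      finally show ?thesis using n by simp
    qed
    ultimately show ?thesis by blast
  qed
  show ?thesis
  proof (cases "even m")
    case True
    obtain \<kappa> where \<kappa>: "\<kappa> > 0" "\<And>c t. \<lbrakk>c \<ge> 1; t \<in> {0..1}\<rbrakk> \<Longrightarrow> \<kappa> * (c - 1) \<le> quarter c m t"
      using even[OF True m(2)] by blast
    have "\<kappa> / 2 * a \<le> psi_norm s a" if "a \<ge> 0" for a
      using \<kappa>(2)[of "1 + a / 2" 0] that True by (simp add: m psi_norm_quarter)
    then show ?thesis using \<kappa>(1) half_gt_zero by blast
  next
    case False
    then obtain n where n: "m = Suc n" "even n" "n \<ge> 2" using m(2) by (cases m) auto
    obtain \<kappa> where \<kappa>: "\<kappa> > 0" "\<And>c t. \<lbrakk>c \<ge> 1; t \<in> {0..1}\<rbrakk> \<Longrightarrow> \<kappa> * (c - 1) \<le> quarter c n t"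
      using even[OF n(2,3)] by blast
    have "\<kappa> / 2 * a \<le> psi_norm s a" if a: "a \<ge> 0" for a
    proof -
      let ?c = "1 + a / 2"
      have "\<kappa> / 2 * a = integral {0..1::real} (\<lambda>_. \<kappa> / 2 * a)" by simp
      also have "\<dots> \<le> integral {0..1} (quarter ?c n)"
        using a \<kappa>(2)[of ?c] by (intro integral_le quarter_integrable) auto
      also have "\<dots> \<le> integral {0..?c} (quarter ?c n)"
        using a by (intro integral_mono_subset quarter_continuous_sub quarter_nonneg) auto
      finally show ?thesis using n a by (simp add: m psi_norm_quarter)
    qed
    then show ?thesis using \<kappa>(1) half_gt_zero by blast
  qed
qed

lemma psi_norm_surj:
  assumes "s \<ge> 3" "psi_norm s 0 \<le> y"
  obtains a where "a \<ge> 0" "psi_norm s a = y"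
proof -
  obtain \<kappa> where \<kappa>: "\<kappa> > 0" "\<And>a. a \<ge> 0 \<Longrightarrow> \<kappa> * a \<le> psi_norm s a"
    using psi_norm_unbounded[OF assms(1)] by blast
  have "y \<ge> 0" using assms(2) psi_norm_nonneg[of s 0] by simp
  have "y \<le> psi_norm s (y / \<kappa>)" using \<kappa>(2)[of "y / \<kappa>"] \<kappa>(1) \<open>y \<ge> 0\<close> by simp
  then have "\<exists>a. 0 \<le> a \<and> a \<le> y / \<kappa> \<and> psi_norm s a = y"
    using assms \<kappa>(1) \<open>y \<ge> 0\<close>
    by (intro IVT' continuous_on_subset[OF psi_norm_continuous[OF assms(1)]]) auto
  then show ?thesis using that by blast
qed

section \<open>The slope of the initial spline off its corners\<close>

lemma psi1_has_real_derivative: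
  assumes a: "a \<ge> 0" and s: "0 < s" "s < a + 2" "s \<noteq> 1" "s \<noteq> a + 1"
  shows "(psi1 a has_real_derivative (- 1) powi j * (if 1 < s \<and> s < a + 1 then 0 else 1)) (at (s + of_int j * (a + 2)))"
proof -
  let ?H = "a + 2" and ?e = "(- 1) powi j :: real"
  define S where "S = (if s < 1 then {0<..<1} else if s < a + 1 then {1<..<a + 1} else {a + 1<..<a + 2})"
  have S: "open S" "s \<in> S" using s by (auto simp: S_def)
  have base: "(psi1_base a has_real_derivative (if 1 < s \<and> s < a + 1 then 0 else 1)) (at s)"
  proof -
    define g where "g = (\<lambda>t. if s < 1 then t - 1 else if s < a + 1 then 0 else t - a - 1)"
    have "(g has_real_derivative (if 1 < s \<and> s < a + 1 then 0 else 1)) (at s)"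
      using s a unfolding g_def by (cases "s < 1"; cases "s < a + 1") (auto intro!: derivative_eq_intros)
    then show ?thesis
      by (rule has_field_derivative_transform_within_open[OF _ S])
        (use s a in \<open>auto simp: S_def g_def psi1_base_def split: if_splits\<close>)
  qed
  have "((\<lambda>t. psi1_base a (t - of_int j * ?H)) has_real_derivative (if 1 < s \<and> s < a + 1 then 0 else 1)) (at (s + of_int j * ?H))"
    using base DERIV_shift[of "\<lambda>t. psi1_base a (t - of_int j * ?H)" _ s "of_int j * ?H"] by simp
  from DERIV_cmult[OF this, of ?e]
  have "((\<lambda>t. ?e * psi1_base a (t - of_int j * ?H)) has_real_derivative ?e * (if 1 < s \<and> s < a + 1 then 0 else 1)) (at (s + of_int j * ?H))" .
  then show ?thesis
  proof (rule has_field_derivative_transform_within_open)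
    show "open {of_int j * ?H<..<?H + of_int j * ?H}" by simp
    show "s + of_int j * ?H \<in> {of_int j * ?H<..<?H + of_int j * ?H}" using s by simp
    fix t assume t: "t \<in> {of_int j * ?H<..<?H + of_int j * ?H}"
    have "psi1 a (t - of_int j * ?H + of_int j * ?H) = ?e * psi1 a (t - of_int j * ?H)"
      by (rule antiperiodic_shift_int) (rule psi1_antiperiodic[OF a])
    then show "?e * psi1_base a (t - of_int j * ?H) = psi1 a t"
      using t a by (simp add: psi1_eq)
  qed
qed

definition psi1_corners :: "real \<Rightarrow> real set" where
  "psi1_corners a = (\<lambda>(s, j). s + of_int j * (a + 2)) ` ({0, 1, a + 1} \<times> (UNIV :: int set))"

lemma countable_psi1_corners: "countable (psi1_corners a)"
  unfolding psi1_corners_def by (intro countable_image countable_SIGMA) auto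

lemma floor_decomposition:
  fixes t H :: real
  assumes "H > 0"
  obtains s j where "t = s + of_int j * H" "0 \<le> s" "s < H"
proof -
  have "t / H - of_int \<lfloor>t / H\<rfloor> \<ge> 0" "t / H - of_int \<lfloor>t / H\<rfloor> < 1" by linarith+
  then have "0 \<le> (t / H - of_int \<lfloor>t / H\<rfloor>) * H" "(t / H - of_int \<lfloor>t / H\<rfloor>) * H < 1 * H"
    using assms by (auto intro!: mult_strict_right_mono)
  moreover have "(t / H - of_int \<lfloor>t / H\<rfloor>) * H = t - of_int \<lfloor>t / H\<rfloor> * H" using assms by (simp add: left_diff_distrib)
  ultimately show ?thesis using that[of "t - of_int \<lfloor>t / H\<rfloor> * H" "\<lfloor>t / H\<rfloor>"] by simp
qed

lemma psi1_deriv_off_corners: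
  assumes a: "a \<ge> 0" and t: "t \<notin> psi1_corners a"
  shows "\<exists>D. (psi1 a has_real_derivative D) (at t) \<and> \<bar>D\<bar> \<le> 1"
proof -
  obtain s j where sj: "t = s + of_int j * (a + 2)" "0 \<le> s" "s < a + 2"
    using floor_decomposition[of "a + 2" t] a by auto
  have "s \<notin> {0, 1, a + 1}" using t sj(1) by (force simp: psi1_corners_def)
  then have "(psi1 a has_real_derivative (- 1) powi j * (if 1 < s \<and> s < a + 1 then 0 else 1)) (at t)"
    using psi1_has_real_derivative[OF a, of s j] sj by auto
  moreover have "\<bar>(- 1) powi j * (if 1 < s \<and> s < a + 1 then 0 else 1)\<bar> \<le> (1::real)"
    by (simp add: abs_mult power_int_abs)
  ultimately show ?thesis by blast
qed

section \<open>Euler splines as comparison splines without plateaus\<close>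

lemma sgn_sin_shift: "sgn (sin (t + pi)) = - sgn (sin t)"
  by (simp add: sgn_minus)

text \<open>For \<open>a = 0\<close> the initial spline is a triangle wave, the antiperiodic
  primitive of a square wave. As the square wave jumps, the fundamental theorem is applied with an
  exceptional set that is finite on bounded intervals.\<close>

lemma euler_spline_1: "euler_spline (Suc 0) t = pi / 2 * psi 1 0 (2 * t / pi)"
proof -
  define q where "q t = pi / 2 * psi1 0 (2 * t / pi)" for t
  \<comment> \<open>The odd multiples of \<open>pi / 2\<close> belong to the joint
    \<open>s = 1\<close> of two pieces, about which \<open>psi1_has_real_derivative\<close> says
    nothing.\<close>
  define X where "X = range (\<lambda>k::int. of_int k * pi / 2)"
  have X: "finite ({u..v} \<inter> X)" for u v
  proof (rule finite_subset)
    show "{u..v} \<inter> X \<subseteq> (\<lambda>k::int. of_int k * pi / 2) ` {\<lfloor>2 * u / pi\<rfloor>..\<lceil>2 * v / pi\<rceil>}"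
    proof
      fix t assume "t \<in> {u..v} \<inter> X"
      then obtain k :: int where k: "t = of_int k * pi / 2" "u \<le> t" "t \<le> v" by (auto simp: X_def)
      then have "2 * u / pi \<le> of_int k" "of_int k \<le> 2 * v / pi" by (simp_all add: field_simps)
      then have "k \<in> {\<lfloor>2 * u / pi\<rfloor>..\<lceil>2 * v / pi\<rceil>}" by (simp, linarith)
      then show "t \<in> (\<lambda>k::int. of_int k * pi / 2) ` {\<lfloor>2 * u / pi\<rfloor>..\<lceil>2 * v / pi\<rceil>}" using k(1) by blast
    qed
  qed simp
  have cont: "continuous_on A q" for A
    unfolding q_def
    by (intro continuous_intros continuous_on_compose2[OF lipschitz_continuous_on[of "psi1 0" 1 UNIV]])
      (auto simp: psi1_lipschitz)
  have D: "(q has_real_derivative sgn (sin t)) (at t)" if "t \<notin> X" for t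
  proof -
    obtain s j where sj: "2 * t / pi = s + of_int j * (0 + 2)" "0 \<le> s" "s < 0 + 2"
      using floor_decomposition[of "0 + 2" "2 * t / pi"] by auto
    have X_int: "of_int k * pi / 2 \<in> X" for k unfolding X_def by blast
    have "t = of_int (2 * j) * pi / 2" if "s = 0" using sj(1) that by (simp add: field_simps)
    then have "s \<noteq> 0" using \<open>t \<notin> X\<close> X_int by metis
    moreover have "t = of_int (2 * j + 1) * pi / 2" if "s = 1" using sj(1) that by (simp add: field_simps)
    then have "s \<noteq> 1" using \<open>t \<notin> X\<close> X_int by metis
    ultimately have s: "0 < s" "s < 2" "s \<noteq> 1" using sj by auto
    have "(psi1 0 has_real_derivative (- 1) powi j) (at (2 * t / pi))"
      using psi1_has_real_derivative[of 0 s j] s unfolding sj(1) by (auto split: if_splits)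
    then have "((\<lambda>t. psi1 0 (2 * t / pi)) has_real_derivative (- 1) powi j * (2 / pi)) (at t)"
      by (rule DERIV_chain2[where f = "psi1 0" and g = "\<lambda>t. 2 * t / pi"]) (auto intro!: derivative_eq_intros)
    from DERIV_cmult[OF this, of "pi / 2"]
    have "(q has_real_derivative (- 1) powi j) (at t)" unfolding q_def[abs_def] by simp
    moreover have "sgn (sin t) = (- 1) powi j"
    proof -
      have t: "t = s * pi / 2 + of_int j * pi" using sj(1) by (simp add: field_simps)
      have "sgn (sin (s * pi / 2 + of_int j * pi)) = (- 1) powi j * sgn (sin (s * pi / 2))"
        by (rule antiperiodic_shift_int[of "\<lambda>t. sgn (sin t)"]) (rule sgn_sin_shift)
      moreover have "sin (s * pi / 2) > 0" using s by (intro sin_gt_zero) auto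
      ultimately show ?thesis using t by simp
    qed
    ultimately show ?thesis by simp
  qed
  have I: "(LBINT s=0..t. sgn (sin s)) = q t - q 0" for t :: real
  proof -
    have si: "set_integrable lborel {u..v} (\<lambda>s. sgn (sin s))" for u v :: real
    proof -
      have "set_integrable lborel {u..v} (\<lambda>s. 1 :: real)" by (rule borel_integrable_atLeastAtMost') simp
      then show ?thesis
        unfolding set_integrable_def
        by (rule Bochner_Integration.integrable_bound) (auto simp: indicator_def abs_sgn_eq)
    qed
    have *: "(LBINT s=u..v. sgn (sin s)) = q v - q u" if "u \<le> v" for u v :: real
    proof -
      have "((\<lambda>s. sgn (sin s)) has_integral (q v - q u)) {u..v}"
        using X[of u v] that cont D
        by (intro fundamental_theorem_of_calculus_strong[of "{u..v} \<inter> X"])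
          (auto simp: has_real_derivative_iff_has_vector_derivative[symmetric] intro: has_field_derivative_at_within)
      then show ?thesis using interval_integral_eq_integral[OF that si] integral_unique by metis
    qed
    show ?thesis
    proof (cases "0 \<le> t")
      case True
      then show ?thesis using *[of 0 t] by (simp add: zero_ereal_def)
    next
      case False
      then show ?thesis using *[of t 0] interval_integral_endpoints_reverse[of 0 t "\<lambda>s. sgn (sin s)"]
        by (simp add: zero_ereal_def)
    qed
  qed
  have qpi: "q (t + pi) = - q t" for t
  proof -
    have "2 * (t + pi) / pi = 2 * t / pi + (0 + 2)" by (simp add: field_simps)
    then show ?thesis using psi1_antiperiodic[of 0 "2 * t / pi"] by (simp add: q_def)
  qed
  have "(LBINT u=0..2 * pi. (q u - q 0)) = (- 2 * q 0) * pi"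
    by (rule integral_of_shift_sum_const) (auto intro!: continuous_intros cont simp: qpi)
  then have "periodic_primitive (2 * pi) (\<lambda>t. sgn (sin t)) t = q t"
    by (simp add: periodic_primitive_def I)
  then show ?thesis by (simp add: euler_spline_def q_def)
qed

text \<open>Integration commutes with the substitution \<open>2 * t / pi\<close> up to a factor
  \<open>pi / 2\<close>, and antiperiodicity fixes the constants.\<close>

lemma euler_spline_psi: "euler_spline (Suc m) t = (pi / 2) ^ Suc m * psi (Suc m) 0 (2 * t / pi)"
proof (induction m arbitrary: t)
  case 0
  then show ?case using euler_spline_1 by simp
next
  case (Suc m)
  have scale: "2 * (t + pi) / pi = 2 * t / pi + (0 + 2)" for t by (simp add: field_simps)
  have E: "euler_spline (Suc m) = (\<lambda>t. (pi / 2) ^ Suc m * psi (Suc m) 0 (2 * t / pi))" using Suc by blast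
  have anti: "euler_spline (Suc m) (t + pi) = - euler_spline (Suc m) t" for t
    using psi_antiperiodic[of 0 "Suc m" "2 * t / pi"] unfolding E scale by simp
  have cont: "continuous_on UNIV (euler_spline (Suc m))"
    unfolding E by (intro continuous_intros continuous_on_compose2[OF psi_continuous[of 0 "Suc m" UNIV]]) auto
  have P: "euler_spline (Suc (Suc m)) = periodic_primitive (2 * pi) (euler_spline (Suc m))"
    by (simp add: euler_spline_def)
  have "euler_spline (Suc (Suc m)) = (\<lambda>t. (pi / 2) ^ Suc (Suc m) * psi (Suc (Suc m)) 0 (2 * t / pi))"
  proof (rule antiperiodic_eqI)
    fix t
    show "(euler_spline (Suc (Suc m)) has_real_derivative euler_spline (Suc m) t) (at t)"
      "euler_spline (Suc (Suc m)) (t + pi) = - euler_spline (Suc (Suc m)) t"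
      unfolding P using periodic_primitive_antiperiodic[OF cont anti, of t] by simp_all
    have "((\<lambda>t. psi (Suc (Suc m)) 0 (2 * t / pi)) has_real_derivative psi (Suc m) 0 (2 * t / pi) * (2 / pi)) (at t)"
      by (rule DERIV_chain2[OF psi_deriv]) (auto intro!: derivative_eq_intros)
    from DERIV_cmult[OF this, of "(pi / 2) ^ Suc (Suc m)"]
    show "((\<lambda>t. (pi / 2) ^ Suc (Suc m) * psi (Suc (Suc m)) 0 (2 * t / pi)) has_real_derivative euler_spline (Suc m) t) (at t)"
      by (simp add: E field_simps)
    show "(pi / 2) ^ Suc (Suc m) * psi (Suc (Suc m)) 0 (2 * (t + pi) / pi) = - ((pi / 2) ^ Suc (Suc m) * psi (Suc (Suc m)) 0 (2 * t / pi))"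
      unfolding scale using psi_antiperiodic[of 0 "Suc (Suc m)" "2 * t / pi"] by simp
  qed
  then show ?case by simp
qed

section \<open>Cyclic sign alternations and comparison\<close>

text \<open>A function with its derivatives up to order \<open>n\<close>, the last one Lipschitz:
  the smoothness class of order \<open>n + 1\<close> without its almost everywhere defined top
  derivative. Carrying the derivatives as data makes passing to a derivative a mere
  reindexing.\<close>

definition jet :: "nat \<Rightarrow> real \<Rightarrow> (nat \<Rightarrow> real \<Rightarrow> real) \<Rightarrow> bool" where
  "jet n M X \<longleftrightarrow> (\<forall>j<n. \<forall>t. (X j has_real_derivative X (Suc j) t) (at t)) \<and>
     (\<forall>s t. \<bar>X n s - X n t\<bar> \<le> M * \<bar>s - t\<bar>)"

lemma jet_deriv: "\<lbrakk>jet n M X; j < n\<rbrakk> \<Longrightarrow> (X j has_real_derivative X (Suc j) t) (at t)"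
  by (simp add: jet_def)

lemma jet_lipschitz: "jet n M X \<Longrightarrow> \<bar>X n s - X n t\<bar> \<le> M * \<bar>s - t\<bar>"
  by (simp add: jet_def)

lemma jet_continuous:
  assumes "jet n M X" "j \<le> n"
  shows "continuous_on A (X j)"
proof (cases "j = n")
  case True
  then show ?thesis using lipschitz_continuous_on[of "X n" M A] jet_lipschitz[OF assms(1)] by blast
next
  case False
  then show ?thesis
    using jet_deriv[OF assms(1), of j] assms(2)
    by (intro continuous_at_imp_continuous_on ballI DERIV_isCont) auto
qed

text \<open>The last point is the first one a period later; this closed cycle is what keeps the
  number of sign changes from dropping under differentiation. Only the sign of \<open>e\<close>
  matters: it lets the pattern start with either sign.\<close>

definition alternating :: "(real \<Rightarrow> real) \<Rightarrow> real \<Rightarrow> nat \<Rightarrow> bool" where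
  "alternating z T n \<longleftrightarrow> (\<exists>(t :: nat \<Rightarrow> real) e. (\<forall>i<n. t i < t (Suc i)) \<and> t n = t 0 + T \<and>
     (\<forall>i\<le>n. 0 < e * (- 1) ^ i * z (t i)))"

text \<open>The mean value theorem gives a slope of definite sign in each of the \<open>n\<close>
  intervals. Moving the first of these points by a period closes the cycle, with the correct sign
  because \<open>n\<close> is even.\<close>

lemma alternating_deriv:
  assumes alt: "alternating z T n" and n: "even n" "n > 0"
    and d: "\<And>t. (z has_real_derivative z' t) (at t)" and per: "\<And>t. z' (t + T) = z' t"
  shows "alternating z' T n"
proof -
  obtain t e where t: "\<And>i. i < n \<Longrightarrow> t i < t (Suc i)" "t n = t 0 + T"
    and sg: "\<And>i. i \<le> n \<Longrightarrow> 0 < e * (- 1) ^ i * z (t i)"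
    using alt unfolding alternating_def by blast
  have "\<exists>s. t i < s \<and> s < t (Suc i) \<and> 0 < - e * (- 1) ^ i * z' s" if i: "i < n" for i
  proof -
    obtain s where s: "t i < s" "s < t (Suc i)" "z (t (Suc i)) - z (t i) = (t (Suc i) - t i) * z' s"
      using MVT2[OF t(1)[OF i], of z z'] d by blast
    have "- e * (- 1) ^ i * ((t (Suc i) - t i) * z' s) = e * (- 1) ^ i * z (t i) + e * (- 1) ^ Suc i * z (t (Suc i))"
      unfolding s(3)[symmetric] by (simp add: algebra_simps)
    also have "\<dots> > 0" using sg[of i] sg[of "Suc i"] i by simp
    finally have "0 < (t (Suc i) - t i) * (- e * (- 1) ^ i * z' s)" by (simp add: algebra_simps)
    then have "0 < - e * (- 1) ^ i * z' s" by (rule zero_less_mult_pos) (use t(1)[OF i] in simp)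
    then show ?thesis using s by blast
  qed
  then obtain s where s: "\<And>i. i < n \<Longrightarrow> t i < s i \<and> s i < t (Suc i) \<and> 0 < - e * (- 1) ^ i * z' (s i)"
    by metis
  define u where "u i = (if i < n then s i else s 0 + T)" for i
  show ?thesis
    unfolding alternating_def
  proof (intro exI[of _ u] exI[of _ "- e"] conjI allI impI)
    fix i assume i: "i < n"
    show "u i < u (Suc i)"
    proof (cases "Suc i < n")
      case True
      then show ?thesis using s[of i] s[of "Suc i"] by (simp add: u_def)
    next
      case False
      then have "Suc i = n" using i by simp
      then show ?thesis using s[of i] s[of 0] t(2) i by (simp add: u_def)
    qed
  next
    show "u n = u 0 + T" using n by (simp add: u_def)
  next
    fix i assume "i \<le> n"
    then show "0 < - e * (- 1) ^ i * z' (u i)"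
      using s[of i] s[of 0] n per by (cases "i < n") (auto simp: u_def)
  qed
qed

lemma alternating_iterate:
  assumes d: "\<And>j t. j < m \<Longrightarrow> (z j has_real_derivative z (Suc j) t) (at t)"
    and per: "\<And>j t. j \<le> m \<Longrightarrow> z j (t + T) = z j t"
    and "alternating (z 0) T n" "even n" "n > 0"
  shows "j \<le> m \<Longrightarrow> alternating (z j) T n"
proof (induction j)
  case (Suc j)
  then have "alternating (z j) T n" by simp
  then show ?case
    by (rule alternating_deriv[OF _ assms(4,5)]) (use Suc.prems d per in auto)
qed (simp only: assms(3))

text \<open>On the \<open>j\<close>-th piece \<open>z\<close> changes sign at most once, and in a direction alternating with
  \<open>j\<close>. So an alternation point in piece \<open>j\<close> may be assigned the number \<open>j\<close> before the change and
  \<open>j + 1\<close> after it; the parity of that number is then determined by the sign, whence it increases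
  strictly along the alternation.\<close>

lemma alternating_count:
  assumes alt: "alternating z (real M * H) n" and "H > 0" "even M" "even n" and \<sigma>: "\<sigma> = 1 \<or> \<sigma> = (-1::real)"
    and piece: "\<And>j s t. \<lbrakk>c + of_int j * H \<le> s; s < t; t < c + of_int j * H + H; 0 < \<sigma> * (- 1) powi j * z s\<rbrakk>
       \<Longrightarrow> 0 \<le> \<sigma> * (- 1) powi j * z t"
  shows "n \<le> M"
proof -
  obtain t e where t: "\<And>i. i < n \<Longrightarrow> t i < t (Suc i)" "t n = t 0 + real M * H"
    and sg: "\<And>i. i \<le> n \<Longrightarrow> 0 < e * (- 1) ^ i * z (t i)"
    using alt unfolding alternating_def by blast
  define jj where "jj i = \<lfloor>(t i - c) / H\<rfloor>" for i
  define s where "s i = \<sigma> * (- 1) powi jj i * z (t i)" for i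
  define q where "q i = (if 0 < s i then jj i + 1 else jj i)" for i
  have znz: "z (t i) \<noteq> 0" if "i \<le> n" for i using sg[OF that] by auto
  have pm: "(- 1 :: real) powi j = (if even j then 1 else - 1)" for j by (simp add: power_int_minus_left)
  have in_piece: "c + of_int (jj i) * H \<le> t i" "t i < c + of_int (jj i) * H + H" for i
  proof -
    have "of_int (jj i) \<le> (t i - c) / H" "(t i - c) / H < of_int (jj i) + 1" unfolding jj_def by linarith+
    then show "c + of_int (jj i) * H \<le> t i" "t i < c + of_int (jj i) * H + H"
      using \<open>H > 0\<close> by (simp_all add: field_simps)
  qed
  have step: "q i < q (Suc i)" if i: "i < n" for i
  proof -
    have mono: "jj i \<le> jj (Suc i)"
      unfolding jj_def using t(1)[OF i] \<open>H > 0\<close> by (intro floor_mono divide_right_mono) auto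
    have opp: "z (t i) * z (t (Suc i)) < 0"
    proof -
      define E where "E = e * (- 1) ^ i"
      have "0 < E * z (t i)" "E * z (t (Suc i)) < 0"
        using sg[of i] sg[of "Suc i"] i by (simp_all add: E_def)
      then show ?thesis by (auto simp: zero_less_mult_iff mult_less_0_iff)
    qed
    show ?thesis
    proof (cases "jj (Suc i) = jj i")
      case True
      have "\<not> 0 < s i"
      proof
        assume "0 < s i"
        then have "0 \<le> s (Suc i)"
          using in_piece[of i] in_piece[of "Suc i"] t(1)[OF i] True
            piece[of "jj i" "t i" "t (Suc i)"] unfolding s_def True by simp
        then show False using \<open>0 < s i\<close> opp \<sigma> unfolding s_def True pm
          by (auto split: if_splits simp: mult_less_0_iff zero_le_mult_iff zero_less_mult_iff)
      qed
      then have "0 < s (Suc i)" using opp \<sigma> znz[of i] i unfolding s_def True pm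
        by (auto split: if_splits simp: mult_less_0_iff zero_less_mult_iff not_less)
      then show ?thesis using \<open>\<not> 0 < s i\<close> True by (simp add: q_def)
    next
      case False
      then have lt: "jj i < jj (Suc i)" using mono by simp
      show ?thesis
      proof (rule ccontr)
        assume "\<not> q i < q (Suc i)"
        then have *: "jj (Suc i) = jj i + 1" "0 < s i" "\<not> 0 < s (Suc i)"
          using lt by (auto simp: q_def split: if_splits)
        then show False using opp \<sigma> znz[of i] znz[of "Suc i"] i unfolding s_def *(1) pm
          by (auto split: if_splits simp: mult_less_0_iff zero_less_mult_iff not_less)
      qed
    qed
  qed
  have "q 0 + int i \<le> q i" if "i \<le> n" for i
    using that
  proof (induction i)
    case (Suc i)
    then show ?case using step[of i] by simp
  qed simp
  then have "q 0 + int n \<le> q n" by simp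
  \<comment> \<open>A period raises the piece number by \<open>M\<close>. As \<open>M\<close> and
    \<open>n\<close> are even, the relative sign is the same at both ends, so the assigned number
    rises by exactly \<open>M\<close> too.\<close>
  moreover have "q n = q 0 + int M"
  proof -
    have "(t n - c) / H = (t 0 - c) / H + of_int (int M)" using t(2) \<open>H > 0\<close> by (simp add: field_simps)
    then have jn: "jj n = jj 0 + int M" by (simp only: jj_def floor_add_int)
    have "0 < e * z (t n)" "0 < e * z (t 0)" using sg[of n] sg[of 0] \<open>even n\<close> by auto
    then have "(0 < z (t n)) = (0 < z (t 0))" "(z (t n) < 0) = (z (t 0) < 0)"
      by (auto simp: zero_less_mult_iff)
    then have "(0 < s n) = (0 < s 0)"
      using \<open>even M\<close> \<sigma> unfolding s_def jn pm by (auto simp: zero_less_mult_iff)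
    then show ?thesis by (simp add: q_def jn)
  qed
  ultimately show ?thesis by simp
qed

lemma antiperiodic_fold:
  fixes f :: "real \<Rightarrow> real"
  assumes "\<And>t. f (t + H) = - f t"
  shows "f t = (- 1) powi j * f (t - of_int j * H)"
  using antiperiodic_shift_int[of f H "t - of_int j * H" j] assms by simp

text \<open>Around a zero of \<open>psi 2 a\<close> the difference is first convex, then concave, and on the plateaus
  its sign is known.\<close>

lemma piece_constrained:
  assumes a: "a \<ge> 0"
    and y: "\<And>t. (y has_real_derivative y' t) (at t)" "\<And>s t. \<bar>y' s - y' t\<bar> \<le> \<bar>s - t\<bar>" "\<And>t. \<bar>y t\<bar> \<le> 1 / 2"
    and st: "- (1 + a / 2) \<le> s" "s < t" "t \<le> 1 + a / 2" "0 < y s - psi 2 a s"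
  shows "0 \<le> y t - psi 2 a t"
proof -
  define z where "z t = y t - psi 2 a t" for t
  have psi2: "(psi 2 a has_real_derivative psi1 a t) (at t)" for t
    using psi_deriv[OF a, of "Suc 0" t] by (simp add: numeral_2_eq_2)
  have z': "(z has_real_derivative y' t - psi1 a t) (at t)" for t
    unfolding z_def[abs_def] by (intro DERIV_diff y(1) psi2)
  have psi1_inner: "psi1 a t = \<bar>t\<bar> - 1" if "\<bar>t\<bar> \<le> 1" for t
    using that a by (simp add: psi1_eq psi1_base_def)
  have odd: "psi 2 a (- t) = - psi 2 a t" for t
    using psi_parity[OF a, of 1 t] by (simp add: numeral_2_eq_2)
  have plateau: "psi 2 a t = - 1 / 2" if "1 \<le> t" "t \<le> 1 + a / 2" for t
    using psi_2_eq(2)[OF a, of t] that a by simp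
  have zl: "z u \<le> 0" if "- (1 + a / 2) \<le> u" "u \<le> - 1" for u
    using plateau[of "- u"] odd[of u] y(3)[of u] that by (simp add: z_def abs_le_iff)
  have zr: "0 \<le> z u" if "1 \<le> u" "u \<le> 1 + a / 2" for u
    using plateau[of u] y(3)[of u] that by (simp add: z_def abs_le_iff)
  have mvt: "\<exists>w. u < w \<and> w < v \<and> z v - z u = (v - u) * (y' w - psi1 a w)" if "u < v" for u v
    using MVT2[OF that, of z "\<lambda>t. y' t - psi1 a t"] z' by blast
  have s1: "- 1 < s" using st zl[of s] by (force simp: z_def)
  show ?thesis
  proof (cases "1 \<le> t")
    case True
    then show ?thesis using zr[of t] st by (simp add: z_def)
  next
    case False
    \<comment> \<open>Convex part: rising from \<open>z (- 1) \<le> 0\<close> to a positive value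
      takes a positive slope, which cannot decrease afterwards.\<close>
    have left: "0 < z v" if "u < v" "- 1 < u" "v \<le> 0" "0 < z u" for u v
    proof -
      have "z (- 1) \<le> 0" using zl[of "- 1"] a by simp
      obtain w1 where w1: "- 1 < w1" "w1 < u" "z u - z (- 1) = (u + 1) * (y' w1 - psi1 a w1)"
        using mvt[of "- 1" u] \<open>- 1 < u\<close> by auto
      obtain w2 where w2: "u < w2" "w2 < v" "z v - z u = (v - u) * (y' w2 - psi1 a w2)"
        using mvt[OF \<open>u < v\<close>] by blast
      have "0 < (u + 1) * (y' w1 - psi1 a w1)" using w1(3) \<open>z (- 1) \<le> 0\<close> \<open>0 < z u\<close> by linarith
      then have "0 < y' w1 - psi1 a w1" using \<open>- 1 < u\<close> by (simp add: zero_less_mult_iff)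
      moreover have "y' w1 - psi1 a w1 \<le> y' w2 - psi1 a w2"
        using y(2)[of w1 w2] psi1_inner[of w1] psi1_inner[of w2] w1 w2 that by (simp add: abs_le_iff)
      ultimately have "0 \<le> (v - u) * (y' w2 - psi1 a w2)" using \<open>u < v\<close> by simp
      then show ?thesis using w2(3) \<open>0 < z u\<close> by linarith
    qed
    \<comment> \<open>Concave part: returning from below 0 to \<open>z 1 \<ge> 0\<close> takes a
      positive slope, so the slope cannot have been negative earlier.\<close>
    have right: "0 \<le> z v" if "u < v" "0 \<le> u" "v < 1" "0 < z u" for u v
    proof (rule ccontr)
      assume "\<not> 0 \<le> z v"
      have "0 \<le> z 1" using zr[of 1] a by simp
      obtain w1 where w1: "v < w1" "w1 < 1" "z 1 - z v = (1 - v) * (y' w1 - psi1 a w1)"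
        using mvt[of v 1] \<open>v < 1\<close> by auto
      obtain w2 where w2: "u < w2" "w2 < v" "z v - z u = (v - u) * (y' w2 - psi1 a w2)"
        using mvt[OF \<open>u < v\<close>] by blast
      have "0 < (1 - v) * (y' w1 - psi1 a w1)" using w1(3) \<open>\<not> 0 \<le> z v\<close> \<open>0 \<le> z 1\<close> by linarith
      then have "0 < y' w1 - psi1 a w1" using \<open>v < 1\<close> by (simp add: zero_less_mult_iff)
      moreover have "y' w1 - psi1 a w1 \<le> y' w2 - psi1 a w2"
        using y(2)[of w1 w2] psi1_inner[of w1] psi1_inner[of w2] w1 w2 that by (simp add: abs_le_iff)
      ultimately have "0 \<le> (v - u) * (y' w2 - psi1 a w2)" using \<open>u < v\<close> by simp
      then show False using w2(3) \<open>0 < z u\<close> \<open>\<not> 0 \<le> z v\<close> by linarith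
    qed
    have zs: "0 < z s" using st(4) by (simp add: z_def)
    have "0 \<le> z t"
    proof (cases "s < 0")
      case True
      then have "0 < z (min t 0)" using left[of s "min t 0"] s1 zs st by auto
      then show ?thesis using right[of 0 t] False by (cases "t \<le> 0") (auto simp: min_def split: if_splits)
    next
      case False
      then show ?thesis using right[of s t] zs st \<open>\<not> 1 \<le> t\<close> by auto
    qed
    then show ?thesis by (simp add: z_def)
  qed
qed

text \<open>Cavaretta's argument: the spline oscillates as fast as the constraints permit, and a point where
  \<open>h 0\<close> meets \<open>psi (Suc n) a\<close> with a larger slope yields two additional sign changes of the difference.\<close>

lemma periodic_comparison:
  assumes a: "a \<ge> 0" and n: "n \<ge> 1" and h: "jet n 1 h" and N: "N \<ge> 1"
    and per: "\<And>j t. j \<le> n \<Longrightarrow> h j (t + real (2 * N) * (a + 2)) = h j t"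
    and small: "\<And>t. \<bar>h 0 t\<bar> < psi_norm (Suc n) a"
    and constr: "a = 0 \<or> (\<forall>t. \<bar>h (n - 1) t\<bar> \<le> 1 / 2)"
  shows "h 1 t \<le> psi_norm n a"
proof (rule ccontr)
  assume "\<not> h 1 t \<le> psi_norm n a"
  then have big: "psi_norm n a < h 1 t" by simp
  let ?H = "a + 2" and ?A = "psi_norm (Suc n) a"
  define T where "T = real (2 * N) * ?H"
  have H: "?H > 0" using a by simp
  obtain p0 where p0: "psi (Suc n) a p0 = ?A" "psi (Suc n) a (p0 + ?H) = - ?A"
    using psi_norm_attained[OF a, of "Suc n"] by auto
  define p where "p = p0 + ?H"
  have psip: "psi (Suc n) a (p + of_int j * ?H) = (- 1) powi j * (- ?A)" for j
    using antiperiodic_shift_int[of "psi (Suc n) a" ?H p j] psi_antiperiodic[OF a, of "Suc n"] p0(2) by (simp add: p_def)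
  \<comment> \<open>From \<open>p\<close> to \<open>p + ?H\<close> the spline passes from its
    minimum to its maximum and takes the value \<open>h 0 t\<close> on the way. Choosing this half
    period matters: there a downward crossing of the difference comes on top of the expected upward
    change.\<close>
  have "\<exists>\<eta>\<ge>p. \<eta> \<le> p + ?H \<and> psi (Suc n) a \<eta> = h 0 t"
    using psip[of 0] psip[of 1] small[of t] H psi_continuous[OF a, of "Suc n"] by (intro IVT') auto
  then obtain \<eta> where \<eta>: "p \<le> \<eta>" "\<eta> \<le> p + ?H" "psi (Suc n) a \<eta> = h 0 t" by blast
  define d where "d = t - \<eta>"
  define g where "g j s = psi (Suc n - j) a s - h j (s + d)" for j s
  have hd: "((\<lambda>s. h j (s + d)) has_real_derivative h (Suc j) (s + d)) (at s)" if "j < n" for j s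
    using jet_deriv[OF h that, of "s + d"] by (simp add: DERIV_shift)
  have g: "(g j has_real_derivative g (Suc j) s) (at s)" if "j < n" for j s
  proof -
    have *: "Suc n - j = Suc (n - j)" "Suc n - Suc j = n - j" "n - j \<ge> 1" using that by auto
    show ?thesis
      unfolding g_def[abs_def] *(1,2) by (rule DERIV_diff[OF psi_deriv[OF a *(3)] hd[OF that]])
  qed
  have gper: "g j (s + T) = g j s" if "j \<le> n" for j s
  proof -
    have "psi (Suc n - j) a (s + of_int (int (2 * N)) * ?H) = (- 1) powi int (2 * N) * psi (Suc n - j) a s"
      by (rule antiperiodic_shift_int[where f = "psi (Suc n - j) a"]) (use that in \<open>simp add: psi_antiperiodic[OF a]\<close>)
    then have "psi (Suc n - j) a (s + T) = psi (Suc n - j) a s" by (simp add: T_def)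
    moreover have e: "s + T + d = (s + d) + real (2 * N) * ?H" by (simp add: T_def)
    have "h j (s + T + d) = h j (s + d)" unfolding e by (rule per[OF that])
    ultimately show ?thesis by (simp only: g_def)
  qed
  have gp: "0 < - 1 * (- 1) powi j * g 0 (p + of_int j * ?H)" for j
  proof -
    have "\<bar>h 0 (p + of_int j * ?H + d)\<bar> < ?A" by (rule small)
    then have "\<bar>h 0 (p + of_int j * ?H + d)\<bar> < ?A" .
    moreover have "g 0 (p + of_int j * ?H) = (- 1) powi j * (- ?A) - h 0 (p + of_int j * ?H + d)"
      unfolding g_def diff_zero psip ..
    ultimately show ?thesis
      by (cases "even j") (simp_all add: power_int_minus_left abs_less_iff)
  qed
  have g\<eta>: "g 0 \<eta> = 0" "g 1 \<eta> < 0"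
  proof -
    show "g 0 \<eta> = 0" by (simp add: g_def d_def \<eta>)
    have "psi n a \<eta> \<le> psi_norm n a" using psi_abs_le[OF a n, of \<eta>] by simp
    then show "g 1 \<eta> < 0" using big by (simp add: g_def d_def)
  qed
  have gl: "g 0 p < 0" "0 < g 0 (p + ?H)" using gp[of 0] gp[of 1] by auto
  then have \<eta>': "p < \<eta>" "\<eta> < p + ?H" using \<eta> g\<eta>(1) by (auto simp: less_le)
  have "(g 0 has_real_derivative g 1 \<eta>) (at \<eta>)" using g[of 0 \<eta>] n by simp
  from DERIV_neg_dec_left[OF this g\<eta>(2)] obtain e1 where e1: "e1 > 0" "\<And>h. \<lbrakk>0 < h; h < e1\<rbrakk> \<Longrightarrow> 0 < g 0 (\<eta> - h)"
    using g\<eta>(1) by auto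
  from \<open>(g 0 has_real_derivative g 1 \<eta>) (at \<eta>)\<close> DERIV_neg_dec_right[of "g 0" "g 1 \<eta>" \<eta>] g\<eta>
  obtain e2 where e2: "e2 > 0" "\<And>h. \<lbrakk>0 < h; h < e2\<rbrakk> \<Longrightarrow> g 0 (\<eta> + h) < 0" by auto
  define e where "e = min (min e1 e2) (min (\<eta> - p) (p + ?H - \<eta>)) / 2"
  have e: "0 < e" "e < e1" "e < e2" "e < \<eta> - p" "e < p + ?H - \<eta>"
    using e1(1) e2(1) \<eta>' by (auto simp: e_def min_def)
  \<comment> \<open>Between the negative value at \<open>p\<close> and the positive one at
    \<open>p + ?H\<close> the downward crossing at \<open>\<eta>\<close> inserts two points. From
    index 3 on the extrema of the spline follow, shifted by these two places.\<close>
  define u where "u i = (if i = 0 then p else if i = 1 then \<eta> - e else if i = 2 then \<eta> + e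
      else p + real (i - 2) * ?H)" for i :: nat
  have "alternating (g 0) T (2 * N + 2)"
    unfolding alternating_def
  proof (intro exI[of _ u] exI[of _ "- 1"] conjI allI impI)
    fix i assume "i < 2 * N + 2"
    consider "i = 0" | "i = 1" | "i = 2" | "i \<ge> 3" by linarith
    then show "u i < u (Suc i)"
    proof cases
      case 4
      then have "real (Suc i - 2) = real (i - 2) + 1" by linarith
      then have "real (i - 2) * ?H < real (Suc i - 2) * ?H" using H by simp
      then show ?thesis using 4 by (simp add: u_def)
    qed (use e in \<open>auto simp: u_def\<close>)
  next
    show "u (2 * N + 2) = u 0 + T" using N by (simp add: u_def T_def)
  next
    fix i assume "i \<le> 2 * N + 2"
    consider "i = 0" | "i = 1" | "i = 2" | "i \<ge> 3" by linarith
    then show "0 < - 1 * (- 1) ^ i * g 0 (u i)"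
    proof cases
      case 4
      then obtain k where k: "i = k + 2" "k > 0" using that[of "i - 2"] by simp
      have "0 < - 1 * (- 1) ^ k * g 0 (p + real k * ?H)" using gp[of "int k"] by simp
      then show ?thesis using k by (simp add: u_def)
    qed (use e gl e1(2)[of e] e2(2)[of e] in \<open>auto simp: u_def\<close>)
  qed
  note alt0 = this
  have alt: "alternating (g j) T (2 * N + 2)" if "j \<le> n" for j
    by (rule alternating_iterate[where m = n, OF g gper alt0 _ _ that]) simp_all
  have T: "T = real (2 * N) * ?H" by (simp add: T_def)
  \<comment> \<open>For \<open>a = 0\<close> the count is made at order \<open>n\<close>: on each
    half period the spline has slope of modulus 1 and \<open>h n\<close> is 1-Lipschitz, so their
    difference is monotone. Otherwise it is made at order \<open>n - 1\<close>, where the bound 1/2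
    settles the sign on the plateaus.\<close>
  show False
  proof (cases "a = 0")
    case True
    have "2 * N + 2 \<le> 2 * N"
    proof (rule alternating_count[where z = "g n" and H = ?H and c = 0 and \<sigma> = 1])
      show "alternating (g n) (real (2 * N) * ?H) (2 * N + 2)" using alt[of n] T by simp
      fix j :: int and s t :: real
      assume st: "0 + of_int j * ?H \<le> s" "s < t" "t < 0 + of_int j * ?H + ?H" "0 < 1 * (- 1) powi j * g n s"
      have psi: "psi1 a x = (- 1) powi j * (x - of_int j * ?H - 1)"
        if "of_int j * ?H \<le> x" "x \<le> of_int j * ?H + ?H" for x
        using antiperiodic_fold[of "psi1 a" ?H x j, OF psi1_antiperiodic[OF a]] that True by (simp add: psi1_eq psi1_base_def)
      have gn: "(- 1) powi j * g n x = (x - of_int j * ?H - 1) - (- 1) powi j * h n (x + d)"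
        if "of_int j * ?H \<le> x" "x \<le> of_int j * ?H + ?H" for x
        unfolding g_def using psi[OF that] by (cases "even j") (auto simp: power_int_minus_left)
      have "\<bar>(- 1) powi j * h n (t + d) - (- 1) powi j * h n (s + d)\<bar> = \<bar>h n (t + d) - h n (s + d)\<bar>"
        by (cases "even j") (auto simp: power_int_minus_left abs_minus_commute)
      also have "\<dots> \<le> t - s" using jet_lipschitz[OF h, of "t + d" "s + d"] st(2) by simp
      finally show "0 \<le> 1 * (- 1) powi j * g n t"
        using gn[of s] gn[of t] st by (simp add: abs_le_iff)
    qed (use H in auto)
    then show False by simp
  next
    case False
    define y where "y s = h (n - 1) s" for s
    have y2: "\<bar>h (n - 1) s\<bar> \<le> 1 / 2" for s using constr False by blast
    have n1: "Suc (n - 1) = n" "Suc n - (n - 1) = 2" using n by auto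
    have h': "(h (n - 1) has_real_derivative h n x) (at x)" for x
      using jet_deriv[OF h, of "n - 1" x] n unfolding n1(1) by simp
    \<comment> \<open>These pieces are centred at the zeros of \<open>psi 2 a\<close>. The factor
      \<open>- 1\<close> appears because \<open>g\<close> is spline minus function, whereas
      \<open>piece_constrained\<close> treats function minus spline.\<close>
    have piece: "0 \<le> - 1 * (- 1) powi j * g (n - 1) t"
      if st: "- (1 + a / 2) + of_int j * ?H \<le> s" "s < t" "t < - (1 + a / 2) + of_int j * ?H + ?H"
        "0 < - 1 * (- 1) powi j * g (n - 1) s" for j s t
    proof -
      let ?e = "(- 1) powi j :: real" and ?m = "of_int j * ?H"
      have ee: "?e * ?e = 1" "\<bar>?e\<bar> = 1" by (auto simp: power_int_minus_left)
      let ?y = "\<lambda>x. ?e * h (n - 1) (x + ?m + d)" and ?y' = "\<lambda>x. ?e * h n (x + ?m + d)"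
      have G: "- 1 * ?e * g (n - 1) x = ?y (x - ?m) - psi 2 a (x - ?m)" for x
      proof -
        have "psi 2 a x = ?e * psi 2 a (x - ?m)"
          by (rule antiperiodic_fold[where f = "psi 2 a"]) (simp add: psi_antiperiodic[OF a])
        then have "?e * psi 2 a x = psi 2 a (x - ?m)" using ee by (simp flip: mult.assoc)
        moreover have "g (n - 1) x = psi 2 a x - h (n - 1) (x + d)" unfolding g_def n1 ..
        then have "- 1 * ?e * g (n - 1) x = ?e * h (n - 1) (x + d) - ?e * psi 2 a x"
          by (simp add: right_diff_distrib)
        moreover have "x - ?m + ?m + d = x + d" by simp
        ultimately show ?thesis by (simp only:)
      qed
      have "0 \<le> ?y (t - ?m) - psi 2 a (t - ?m)"
      proof (rule piece_constrained[OF a, where y = ?y and y' = ?y' and s = "s - ?m" and t = "t - ?m"])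
        have "((\<lambda>x. h (n - 1) (x + (?m + d))) has_real_derivative h n (x + (?m + d))) (at x)" for x
          by (subst DERIV_shift[symmetric]) (rule h')
        from DERIV_cmult[OF this, of ?e] show "(?y has_real_derivative ?y' x) (at x)" for x
          by (simp add: add.assoc)
        show "\<bar>?y' x - ?y' x'\<bar> \<le> \<bar>x - x'\<bar>" for x x'
          using jet_lipschitz[OF h, of "x + ?m + d" "x' + ?m + d"] ee(2)
          by (simp add: abs_mult flip: right_diff_distrib)
        show "\<bar>?y x\<bar> \<le> 1 / 2" for x using y2[of "x + ?m + d"] ee(2) by (simp add: abs_mult)
      next
        show "- (1 + a / 2) \<le> s - ?m" "s - ?m < t - ?m" "t - ?m \<le> 1 + a / 2" using st(1-3) by linarith+
        show "0 < ?y (s - ?m) - psi 2 a (s - ?m)" using st(4) unfolding G .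
      qed
      then show ?thesis unfolding G .
    qed
    have altn: "alternating (g (n - 1)) (real (2 * N) * ?H) (2 * N + 2)"
      by (rule alt[of "n - 1", unfolded T_def]) simp
    have ev: "even (2 * N)" "even (2 * N + 2)" "- 1 = (1::real) \<or> - 1 = (- 1::real)" by simp_all
    have "2 * N + 2 \<le> 2 * N"
      by (rule alternating_count[OF altn H ev]) (rule piece)
    then show False by linarith
  qed
qed

section \<open>Reduction to the periodic case\<close>

lemma deriv_bounded_imp_lipschitz:
  fixes f :: "real \<Rightarrow> real"
  assumes "\<And>t. (f has_real_derivative f' t) (at t)" "\<And>t. \<bar>f' t\<bar> \<le> B"
  shows "\<bar>f s - f t\<bar> \<le> B * \<bar>s - t\<bar>"
  using field_differentiable_bound[of UNIV f f' B s t] assms by simp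

text \<open>Pass to unit differences, bounded by \<open>2 * A\<close>: their derivative of order
  \<open>m\<close> is, by the mean value theorem, a derivative of order \<open>m + 1\<close> of the
  original at a nearby point.\<close>

lemma small_derivative_point:
  fixes X :: "nat \<Rightarrow> real \<Rightarrow> real"
  assumes "\<And>j t. j < m \<Longrightarrow> (X j has_real_derivative X (Suc j) t) (at t)" "\<And>t. \<bar>X 0 t\<bar> \<le> A"
  shows "\<exists>c\<ge>t. c \<le> t + real m \<and> \<bar>X m c\<bar> \<le> 2 ^ m * A"
  using assms
proof (induction m arbitrary: X A)
  case 0
  then show ?case by auto
next
  case (Suc m)
  define Y where "Y j t = X j (t + 1) - X j t" for j t
  have "\<exists>c\<ge>t. c \<le> t + real m \<and> \<bar>Y m c\<bar> \<le> 2 ^ m * (2 * A)"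
  proof (rule Suc.IH)
    fix j t assume "j < m"
    then have "(X j has_real_derivative X (Suc j) s) (at s)" for s using Suc.prems(1) by simp
    then show "(Y j has_real_derivative Y (Suc j) t) (at t)"
      unfolding Y_def[abs_def] by (intro DERIV_diff) (simp_all add: DERIV_shift[symmetric])
  next
    fix t show "\<bar>Y 0 t\<bar> \<le> 2 * A"
      using Suc.prems(2)[of t] Suc.prems(2)[of "t + 1"] by (simp add: Y_def)
  qed
  then obtain c where c: "c \<ge> t" "c \<le> t + real m" "\<bar>Y m c\<bar> \<le> 2 ^ Suc m * A" by (auto simp: mult_ac)
  obtain d where d: "c < d" "d < c + 1" "X m (c + 1) - X m c = (c + 1 - c) * X (Suc m) d"
    using MVT2[of c "c + 1" "X m" "X (Suc m)"] Suc.prems(1) by auto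
  then have "X (Suc m) d = Y m c" by (simp add: Y_def)
  then show ?case using c d by (intro exI[of _ d]) auto
qed

text \<open>A qualitative Landau inequality. The top derivative is small somewhere within bounded
  distance and Lipschitz, hence bounded; its bound is then the Lipschitz constant one order
  below.\<close>

lemma jet_bounded:
  assumes "jet n M X" "\<And>t. \<bar>X 0 t\<bar> \<le> A"
  shows "\<exists>B. \<forall>j\<le>n. \<forall>t. \<bar>X j t\<bar> \<le> B"
  using assms
proof (induction n arbitrary: M)
  case 0
  then show ?case by auto
next
  case (Suc n)
  have M: "0 \<le> M" using jet_lipschitz[OF Suc.prems(1), of 0 1] abs_ge_zero[of "X (Suc n) 0 - X (Suc n) 1"] by simp
  have top: "\<bar>X (Suc n) t\<bar> \<le> 2 ^ Suc n * A + M * real (Suc n)" for t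
  proof -
    obtain c where c: "c \<ge> t" "c \<le> t + real (Suc n)" "\<bar>X (Suc n) c\<bar> \<le> 2 ^ Suc n * A"
      using small_derivative_point[of "Suc n" X A t] Suc.prems jet_deriv[OF Suc.prems(1)] by auto
    have "\<bar>X (Suc n) t - X (Suc n) c\<bar> \<le> M * \<bar>t - c\<bar>" by (rule jet_lipschitz[OF Suc.prems(1)])
    also have "\<dots> \<le> M * real (Suc n)" using c M by (intro mult_left_mono) auto
    finally show ?thesis using c(3) by linarith
  qed
  have "jet n (2 ^ Suc n * A + M * real (Suc n)) X"
    unfolding jet_def
    using jet_deriv[OF Suc.prems(1)] deriv_bounded_imp_lipschitz[of "X n" "X (Suc n)", OF _ top] by simp
  then obtain B where B: "\<And>j t. j \<le> n \<Longrightarrow> \<bar>X j t\<bar> \<le> B" using Suc.IH Suc.prems(2) by blast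
  have "\<bar>X j t\<bar> \<le> max B (2 ^ Suc n * A + M * real (Suc n))" if "j \<le> Suc n" for j t
    using B[of j t] top[of t] that by (cases "j = Suc n") auto
  then show ?case by blast
qed

section \<open>Rescaling, and periodization by a slow sine\<close>

lemma jet_mono: "\<lbrakk>jet n M X; M \<le> M'\<rbrakk> \<Longrightarrow> jet n M' X"
  unfolding jet_def by (meson abs_ge_zero mult_right_mono order_trans)

lemma jet_rescale:
  assumes "jet n M X" "l > 0"
  shows "jet n (\<bar>c\<bar> * l ^ Suc n * M) (\<lambda>j t. c * l ^ j * X j (l * t + d))"
  unfolding jet_def
proof (intro conjI allI impI)
  fix j t assume "j < n"
  have "((\<lambda>t. X j (l * t + d)) has_real_derivative X (Suc j) (l * t + d) * l) (at t)"
    by (rule DERIV_chain2[OF jet_deriv[OF assms(1) \<open>j < n\<close>]]) (auto intro!: derivative_eq_intros)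
  from DERIV_cmult[OF this, of "c * l ^ j"]
  show "((\<lambda>t. c * l ^ j * X j (l * t + d)) has_real_derivative c * l ^ Suc j * X (Suc j) (l * t + d)) (at t)"
    by (simp add: mult_ac)
next
  fix s t
  have "\<bar>X n (l * s + d) - X n (l * t + d)\<bar> \<le> M * \<bar>(l * s + d) - (l * t + d)\<bar>"
    by (rule jet_lipschitz[OF assms(1)])
  also have "\<bar>(l * s + d) - (l * t + d)\<bar> = l * \<bar>s - t\<bar>"
    using assms(2) by (simp add: abs_mult flip: right_diff_distrib)
  finally have "\<bar>c\<bar> * l ^ n * \<bar>X n (l * s + d) - X n (l * t + d)\<bar> \<le> \<bar>c\<bar> * l ^ n * (M * (l * \<bar>s - t\<bar>))"
    using assms(2) by (intro mult_left_mono) auto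
  moreover have "\<bar>c * l ^ n * X n (l * s + d) - c * l ^ n * X n (l * t + d)\<bar>
      = \<bar>c\<bar> * l ^ n * \<bar>X n (l * s + d) - X n (l * t + d)\<bar>"
    using assms(2) by (simp add: abs_mult flip: right_diff_distrib)
  ultimately show "\<bar>c * l ^ n * X n (l * s + d) - c * l ^ n * X n (l * t + d)\<bar> \<le> \<bar>c\<bar> * l ^ Suc n * M * \<bar>s - t\<bar>"
    by (simp add: mult_ac)
qed

text \<open>The coefficients of the periodization need only be bounded,
  \<open>2 * pi\<close>-periodic and closed under differentiation; membership in this algebra gives
  all three without explicit formulas.\<close>

inductive_set trig_polys :: "(real \<Rightarrow> real) set" where
  const: "(\<lambda>_. c) \<in> trig_polys"
| sin: "sin \<in> trig_polys"
| cos: "cos \<in> trig_polys"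
| add: "f \<in> trig_polys \<Longrightarrow> g \<in> trig_polys \<Longrightarrow> (\<lambda>t. f t + g t) \<in> trig_polys"
| mult: "f \<in> trig_polys \<Longrightarrow> g \<in> trig_polys \<Longrightarrow> (\<lambda>t. f t * g t) \<in> trig_polys"

lemma trig_polys_deriv_ex:
  "f \<in> trig_polys \<Longrightarrow> \<exists>f'\<in>trig_polys. \<forall>t. (f has_real_derivative f' t) (at t)"
proof (induction rule: trig_polys.induct)
  case (const c)
  show ?case by (rule bexI[of _ "\<lambda>_. 0"]) (auto intro: trig_polys.const)
next
  case sin
  show ?case by (rule bexI[of _ cos]) (auto intro: trig_polys.cos DERIV_sin)
next
  case cos
  have "(\<lambda>t. (- 1) * sin t) \<in> trig_polys" by (intro trig_polys.mult trig_polys.const trig_polys.sin)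
  then show ?case by (rule bexI[rotated]) (auto intro!: derivative_eq_intros)
next
  case (add f g)
  then obtain f' g' where d: "f' \<in> trig_polys" "g' \<in> trig_polys"
    "\<And>t. (f has_real_derivative f' t) (at t)" "\<And>t. (g has_real_derivative g' t) (at t)" by blast
  show ?case
    by (rule bexI[OF _ trig_polys.add[OF d(1,2)]]) (intro allI DERIV_add d(3,4))
next
  case (mult f g)
  then obtain f' g' where d: "f' \<in> trig_polys" "g' \<in> trig_polys"
    "\<And>t. (f has_real_derivative f' t) (at t)" "\<And>t. (g has_real_derivative g' t) (at t)" by blast
  have "(\<lambda>t. f' t * g t + g' t * f t) \<in> trig_polys"
    using d(1,2) mult.hyps by (intro trig_polys.add trig_polys.mult)
  moreover have "((\<lambda>t. f t * g t) has_real_derivative f' t * g t + g' t * f t) (at t)" for t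
    by (rule DERIV_mult[OF d(3,4)])
  ultimately show ?case by (intro bexI[of _ "\<lambda>t. f' t * g t + g' t * f t"] allI)
qed

lemma trig_polys_deriv:
  assumes "f \<in> trig_polys"
  shows "deriv f \<in> trig_polys" "(f has_real_derivative deriv f t) (at t)"
proof -
  obtain f' where f': "f' \<in> trig_polys" "\<And>t. (f has_real_derivative f' t) (at t)"
    using trig_polys_deriv_ex[OF assms] by blast
  then have "deriv f = f'" using DERIV_imp_deriv by blast
  then show "deriv f \<in> trig_polys" "(f has_real_derivative deriv f t) (at t)" using f' by auto
qed

lemma trig_polys_bounded: "f \<in> trig_polys \<Longrightarrow> \<exists>K. \<forall>t. \<bar>f t\<bar> \<le> K"
proof (induction rule: trig_polys.induct)
  case (add f g)
  then obtain K L where "\<And>t. \<bar>f t\<bar> \<le> K" "\<And>t. \<bar>g t\<bar> \<le> L" by blast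
  then have "\<bar>f t + g t\<bar> \<le> K + L" for t by (meson abs_triangle_ineq add_mono order_trans)
  then show ?case by blast
next
  case (mult f g)
  then obtain K L where *: "\<And>t. \<bar>f t\<bar> \<le> K" "\<And>t. \<bar>g t\<bar> \<le> L" by blast
  have "\<bar>f t * g t\<bar> \<le> K * L" for t
    unfolding abs_mult by (rule mult_mono'[OF *]) simp_all
  then show ?case by blast
qed (auto intro: abs_sin_le_one abs_cos_le_one exI[of _ 1])

lemma trig_polys_periodic: "f \<in> trig_polys \<Longrightarrow> f (t + 2 * pi) = f t"
  by (induction rule: trig_polys.induct) auto

text \<open>The coefficients in the derivatives of \<open>\<lambda>t. X (l * sin (t / l))\<close> (Faa di Bruno).\<close>

primrec sin_coeff_fun :: "nat \<Rightarrow> nat \<Rightarrow> real \<Rightarrow> real" where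
  "sin_coeff_fun 0 = (\<lambda>i u. if i = 0 then 1 else 0)"
| "sin_coeff_fun (Suc j) = (\<lambda>i u. (if i = 0 then 0 else sin_coeff_fun j (i - 1) u * cos u) + deriv (sin_coeff_fun j i) u)"

lemma sin_coeff_fun_trig: "sin_coeff_fun j i \<in> trig_polys"
proof (induction j arbitrary: i)
  case 0
  then show ?case by (cases "i = 0") (auto intro: trig_polys.const)
next
  case (Suc j)
  have "(\<lambda>u. if i = 0 then 0 else sin_coeff_fun j (i - 1) u * cos u) \<in> trig_polys"
    using Suc by (cases "i = 0") (auto intro: trig_polys.const trig_polys.mult trig_polys.cos)
  then show ?case using trig_polys_deriv(1)[OF Suc[of i]] by (simp add: trig_polys.add)
qed

lemma sin_coeff_fun_above: "i > j \<Longrightarrow> sin_coeff_fun j i = (\<lambda>_. 0)"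
proof (induction j arbitrary: i)
  case (Suc j)
  have "sin_coeff_fun j i = (\<lambda>_. 0)" "sin_coeff_fun j (i - 1) = (\<lambda>_. 0)"
    using Suc.IH Suc.prems by auto
  then show ?case using Suc.prems by simp
qed auto

lemma sin_coeff_fun_top: "sin_coeff_fun j j = (\<lambda>u. cos u ^ j)"
  by (induction j) (auto simp: sin_coeff_fun_above fun_eq_iff mult_ac)

text \<open>The \<open>j\<close>-th derivative of \<open>X 0 (l * sin (t / l))\<close>. A
  differentiation hits either \<open>X i\<close>, raising \<open>i\<close>, or a coefficient, at the
  cost of a factor \<open>1 / l\<close>; hence the exponent \<open>j - i\<close>, and only the term
  with \<open>i = j\<close> persists for large \<open>l\<close>.\<close>

definition sin_wrap :: "real \<Rightarrow> (nat \<Rightarrow> real \<Rightarrow> real) \<Rightarrow> nat \<Rightarrow> real \<Rightarrow> real" where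
  "sin_wrap l X j t = (\<Sum>i\<le>j. X i (l * sin (t / l)) * (sin_coeff_fun j i (t / l) * (1 / l) ^ (j - i)))"

lemma l_sin_deriv: "l \<noteq> 0 \<Longrightarrow> ((\<lambda>t. l * sin (t / l)) has_real_derivative cos (t / l)) (at t)"
  by (auto intro!: derivative_eq_intros)

lemma sin_wrap_deriv:
  assumes l: "l > 0" and X: "\<And>i t. i \<le> j \<Longrightarrow> (X i has_real_derivative X (Suc i) t) (at t)"
  shows "(sin_wrap l X j has_real_derivative sin_wrap l X (Suc j) t) (at t)"
proof -
  let ?v = "l * sin (t / l)" and ?u = "t / l"
  let ?Q = sin_coeff_fun
  let ?D = "\<lambda>i. X (Suc i) ?v * cos ?u * (?Q j i ?u * (1 / l) ^ (j - i)) + deriv (?Q j i) ?u * (1 / l) ^ Suc (j - i) * X i ?v"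
  have tm: "((\<lambda>t. X i (l * sin (t / l)) * (?Q j i (t / l) * (1 / l) ^ (j - i))) has_real_derivative ?D i) (at t)"
    if "i \<le> j" for i
  proof (rule DERIV_mult)
    show "((\<lambda>t. X i (l * sin (t / l))) has_real_derivative X (Suc i) ?v * cos ?u) (at t)"
      by (rule DERIV_chain2[OF X[OF that]]) (use l_sin_deriv l in simp)
    have "((\<lambda>t. ?Q j i (t / l)) has_real_derivative deriv (?Q j i) ?u * (1 / l)) (at t)"
      by (rule DERIV_chain2[OF trig_polys_deriv(2)[OF sin_coeff_fun_trig]]) (use l in \<open>auto intro!: derivative_eq_intros\<close>)
    from DERIV_cmult[OF this, of "(1 / l) ^ (j - i)"]
    show "((\<lambda>t. ?Q j i (t / l) * (1 / l) ^ (j - i)) has_real_derivative deriv (?Q j i) ?u * (1 / l) ^ Suc (j - i)) (at t)"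
      by (simp add: mult_ac)
  qed
  have "(sin_wrap l X j has_real_derivative (\<Sum>i\<le>j. ?D i)) (at t)"
    unfolding sin_wrap_def[abs_def] by (rule DERIV_sum) (use tm in simp)
  also have "(\<Sum>i\<le>j. ?D i) = sin_wrap l X (Suc j) t"
  proof -
    have "sin_wrap l X (Suc j) t
       = (\<Sum>i\<le>Suc j. (if i = 0 then 0 else X i ?v * (?Q j (i - 1) ?u * cos ?u * (1 / l) ^ (Suc j - i))))
       + (\<Sum>i\<le>Suc j. X i ?v * (deriv (?Q j i) ?u * (1 / l) ^ (Suc j - i)))"
      unfolding sin_wrap_def sum.distrib[symmetric]
      by (intro sum.cong refl) (simp add: algebra_simps)
    also have "(\<Sum>i\<le>Suc j. (if i = 0 then 0 else X i ?v * (?Q j (i - 1) ?u * cos ?u * (1 / l) ^ (Suc j - i))))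
       = (\<Sum>i\<le>j. X (Suc i) ?v * (?Q j i ?u * cos ?u * (1 / l) ^ (j - i)))"
      by (subst sum.atMost_Suc_shift) simp
    also have "(\<Sum>i\<le>Suc j. X i ?v * (deriv (?Q j i) ?u * (1 / l) ^ (Suc j - i)))
       = (\<Sum>i\<le>j. X i ?v * (deriv (?Q j i) ?u * (1 / l) ^ Suc (j - i)))"
      by (simp add: sin_coeff_fun_above Suc_diff_le cong: sum.cong_simp)
    finally show ?thesis by (simp add: sum.distrib mult_ac)
  qed
  finally show ?thesis .
qed

lemma sin_wrap_periodic: "l > 0 \<Longrightarrow> sin_wrap l X j (t + 2 * pi * l) = sin_wrap l X j t"
proof -
  assume "l > 0"
  then have "(t + 2 * pi * l) / l = t / l + 2 * pi" by (simp add: field_simps)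
  then show ?thesis by (simp add: sin_wrap_def trig_polys_periodic[OF sin_coeff_fun_trig])
qed

text \<open>Agreement to first order at 0: an excessive slope translated to 0 survives the
  periodization.\<close>

lemma sin_wrap_at_0: "sin_wrap l X 0 0 = X 0 0" "sin_wrap l X 1 0 = X 1 0"
  by (simp_all add: sin_wrap_def)

lemma finite_family_bounded:
  fixes P :: "'a \<Rightarrow> 'b \<Rightarrow> real"
  assumes "finite A" "\<And>x. x \<in> A \<Longrightarrow> \<exists>K. \<forall>t. P x t \<le> K"
  shows "\<exists>K\<ge>1. \<forall>x\<in>A. \<forall>t. P x t \<le> K"
  using assms
proof (induction A rule: finite_induct)
  case empty
  then show ?case by (intro exI[of _ 1]) simp
next
  case (insert x A)
  have "\<exists>K\<ge>1. \<forall>y\<in>A. \<forall>t. P y t \<le> K" using insert.prems by (intro insert.IH) simp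
  then obtain K where K: "K \<ge> 1" "\<forall>y\<in>A. \<forall>t. P y t \<le> K" by blast
  obtain L where L: "\<forall>t. P x t \<le> L" using insert.prems[of x] by blast
  show ?case
  proof (intro exI[of _ "max K L"] conjI ballI allI)
    fix y t assume "y \<in> insert x A"
    then show "P y t \<le> max K L" using K(2) L by (auto simp: le_max_iff_disj)
  qed (use K(1) in simp)
qed

lemma sin_coeff_fun_bounded:
  "\<exists>K\<ge>1. \<forall>j\<le>n. \<forall>i\<le>n. \<forall>u. \<bar>sin_coeff_fun j i u\<bar> \<le> K \<and> \<bar>deriv (sin_coeff_fun j i) u\<bar> \<le> K"
proof -
  have "\<exists>K\<ge>1. \<forall>x\<in>{..n} \<times> {..n}. \<forall>u. (case x of (j, i) \<Rightarrow> \<lambda>u. \<bar>sin_coeff_fun j i u\<bar>) u \<le> K"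
    by (rule finite_family_bounded) (auto intro: trig_polys_bounded sin_coeff_fun_trig)
  then obtain K where K: "K \<ge> 1" "\<And>j i u. \<lbrakk>j \<le> n; i \<le> n\<rbrakk> \<Longrightarrow> \<bar>sin_coeff_fun j i u\<bar> \<le> K" by fastforce
  have "\<exists>K\<ge>1. \<forall>x\<in>{..n} \<times> {..n}. \<forall>u. (case x of (j, i) \<Rightarrow> \<lambda>u. \<bar>deriv (sin_coeff_fun j i) u\<bar>) u \<le> K"
    by (rule finite_family_bounded) (auto intro: trig_polys_bounded trig_polys_deriv(1) sin_coeff_fun_trig)
  then obtain L where L: "L \<ge> 1" "\<And>j i u. \<lbrakk>j \<le> n; i \<le> n\<rbrakk> \<Longrightarrow> \<bar>deriv (sin_coeff_fun j i) u\<bar> \<le> L" by fastforce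
  show ?thesis using K L by (intro exI[of _ "max K L"]) (auto simp: le_max_iff_disj)
qed

lemma lipschitz_mult:
  fixes f g :: "real \<Rightarrow> real"
  assumes "\<bar>f s - f t\<bar> \<le> a * d" "\<bar>g s - g t\<bar> \<le> b * d" "\<bar>f s\<bar> \<le> A" "\<bar>g t\<bar> \<le> G"
  shows "\<bar>f s * g s - f t * g t\<bar> \<le> (A * b + G * a) * d"
proof -
  have "f s * g s - f t * g t = f s * (g s - g t) + g t * (f s - f t)" by (simp add: algebra_simps)
  also have "\<bar>\<dots>\<bar> \<le> \<bar>f s\<bar> * \<bar>g s - g t\<bar> + \<bar>g t\<bar> * \<bar>f s - f t\<bar>"
    by (metis abs_mult abs_triangle_ineq)
  also have "\<dots> \<le> A * (b * d) + G * (a * d)"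
    using assms by (intro add_mono mult_mono) auto
  finally show ?thesis by (simp add: algebra_simps)
qed

text \<open>The terms with \<open>i < j\<close> are at most \<open>B * K / l\<close>, and the cosine
  power in the leading term does not exceed 1 in modulus. So every bound, including the top
  Lipschitz constant, worsens by at most \<open>\<epsilon>\<close>.\<close>

lemma sin_wrap_jet:
  assumes X: "jet n M X" and B: "\<And>j t. j \<le> n \<Longrightarrow> \<bar>X j t\<bar> \<le> B" and "\<epsilon> > 0"
  shows "\<exists>l0\<ge>1. \<forall>l\<ge>l0. jet n (M + \<epsilon>) (sin_wrap l X) \<and>
     (\<forall>j\<le>n. \<forall>t. \<exists>s. \<bar>sin_wrap l X j t\<bar> \<le> \<bar>X j s\<bar> + \<epsilon>)"
proof -
  let ?Q = sin_coeff_fun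
  obtain K where K: "K \<ge> 1" "\<And>j i u. \<lbrakk>j \<le> n; i \<le> n\<rbrakk> \<Longrightarrow> \<bar>?Q j i u\<bar> \<le> K"
     "\<And>j i u. \<lbrakk>j \<le> n; i \<le> n\<rbrakk> \<Longrightarrow> \<bar>deriv (?Q j i) u\<bar> \<le> K"
    using sin_coeff_fun_bounded by metis
  have B0: "B \<ge> 0" using B[of 0 0] abs_ge_zero[of "X 0 0"] by linarith
  \<comment> \<open>Each of the \<open>n\<close> lower terms adds \<open>2 * B * K / l\<close> to
    the Lipschitz constant, and the varying cosine power of the leading term adds
    \<open>B * K / l\<close>.\<close>
  define C where "C = real (2 * n + 1) * (B * K)"
  have C0: "C \<ge> 0" using B0 K(1) by (simp add: C_def)
  have M0: "M \<ge> 0" using jet_lipschitz[OF X, of 0 1] abs_ge_zero[of "X n 0 - X n 1"] by simp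
  have main: "jet n (M + \<epsilon>) (sin_wrap l X) \<and> (\<forall>j\<le>n. \<forall>t. \<exists>s. \<bar>sin_wrap l X j t\<bar> \<le> \<bar>X j s\<bar> + \<epsilon>)"
    if l: "l \<ge> max 1 (C / \<epsilon>)" for l
  proof -
    have l1: "l \<ge> 1" "l > 0" using l by auto
    have Cl: "C * (1 / l) \<le> \<epsilon>" using l l1 \<open>\<epsilon> > 0\<close> by (simp add: field_simps)
    have BK: "0 \<le> B * K" using B0 K(1) by simp
    have pw: "(1 / l) ^ m \<le> 1 / l" if "m \<ge> 1" for m
      using power_decreasing[of 1 m "1 / l"] that l1 by simp
    have pw0: "0 \<le> (1 / l) ^ m" "(1 / l) ^ m \<le> 1" for m using l1 by (simp_all add: power_le_one)
    let ?F = "\<lambda>j i t. X i (l * sin (t / l)) * (?Q j i (t / l) * (1 / l) ^ (j - i))"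
    have split: "sin_wrap l X j t = (\<Sum>i<j. ?F j i t) + X j (l * sin (t / l)) * cos (t / l) ^ j" for j t
      by (simp add: sin_wrap_def lessThan_Suc_atMost[symmetric] sin_coeff_fun_top)
    have cosp: "\<bar>cos u ^ j\<bar> \<le> 1" for u :: real and j
      by (simp add: power_abs power_le_one)
    have G: "\<bar>?Q j i u * (1 / l) ^ (j - i)\<bar> \<le> K * (1 / l)" if "i < j" "j \<le> n" for i j u
      unfolding abs_mult using that K(1) K(2)[of j i u] pw[of "j - i"] pw0[of "j - i"]
      by (intro mult_mono) auto
    have bound: "\<bar>sin_wrap l X j t\<bar> \<le> \<bar>X j (l * sin (t / l))\<bar> + \<epsilon>" if "j \<le> n" for j t
    proof -
      have "\<bar>?F j i t\<bar> \<le> B * (K * (1 / l))" if "i < j" for i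
        unfolding abs_mult[of "X i (l * sin (t / l))"] using that \<open>j \<le> n\<close> B0
        by (intro mult_mono B G) auto
      then have "\<bar>\<Sum>i<j. ?F j i t\<bar> \<le> (\<Sum>i<j. B * (K * (1 / l)))"
        by (intro order_trans[OF sum_abs] sum_mono) simp
      also have "\<dots> = real j * (B * K) * (1 / l)"
        unfolding sum_constant card_lessThan by (simp only: mult.assoc)
      also have "\<dots> \<le> C * (1 / l)"
        unfolding C_def using that l1 BK by (intro mult_right_mono) auto
      finally have "\<bar>\<Sum>i<j. ?F j i t\<bar> \<le> \<epsilon>" using Cl by linarith
      moreover have "\<bar>X j (l * sin (t / l)) * cos (t / l) ^ j\<bar> \<le> \<bar>X j (l * sin (t / l))\<bar>"
        unfolding abs_mult using cosp[of "t / l" j] by (intro mult_right_le_one_le) auto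
      ultimately show ?thesis unfolding split by linarith
    qed
    have vlip: "\<bar>l * sin (s / l) - l * sin (t / l)\<bar> \<le> 1 * \<bar>s - t\<bar>" for s t
      using l1 by (intro deriv_bounded_imp_lipschitz[OF l_sin_deriv]) auto
    have Xlip: "\<bar>X i (l * sin (s / l)) - X i (l * sin (t / l))\<bar> \<le> (if i < n then B else M) * \<bar>s - t\<bar>" if "i \<le> n" for i s t
    proof -
      have "\<bar>X i u - X i w\<bar> \<le> (if i < n then B else M) * \<bar>u - w\<bar>" for u w
      proof (cases "i < n")
        case True
        then show ?thesis using deriv_bounded_imp_lipschitz[OF jet_deriv[OF X True] B, of u w] by simp
      next
        case False
        then show ?thesis using that jet_lipschitz[OF X, of u w] by simp
      qed
      then have "\<bar>X i (l * sin (s / l)) - X i (l * sin (t / l))\<bar> \<le> (if i < n then B else M) * \<bar>l * sin (s / l) - l * sin (t / l)\<bar>" .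
      also have "\<dots> \<le> (if i < n then B else M) * \<bar>s - t\<bar>"
        using vlip[of s t] B0 M0 by (intro mult_left_mono) auto
      finally show ?thesis .
    qed
    have Qlip: "\<bar>?Q n i (s / l) * (1 / l) ^ (n - i) - ?Q n i (t / l) * (1 / l) ^ (n - i)\<bar> \<le> (K * (1 / l)) * \<bar>s - t\<bar>" if "i \<le> n" for i s t
    proof -
      have "((\<lambda>t. ?Q n i (t / l)) has_real_derivative deriv (?Q n i) (t / l) * (1 / l)) (at t)" for t
        by (rule DERIV_chain2[OF trig_polys_deriv(2)[OF sin_coeff_fun_trig]]) (use l1 in \<open>auto intro!: derivative_eq_intros\<close>)
      moreover have "\<bar>deriv (?Q n i) (t / l) * (1 / l)\<bar> \<le> K * (1 / l)" for t
        unfolding abs_mult using K(3)[of n i "t / l"] that l1 by (intro mult_mono) auto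
      ultimately have "\<bar>?Q n i (s / l) - ?Q n i (t / l)\<bar> \<le> K * (1 / l) * \<bar>s - t\<bar>"
        by (rule deriv_bounded_imp_lipschitz)
      moreover have "\<bar>?Q n i (s / l) * (1 / l) ^ (n - i) - ?Q n i (t / l) * (1 / l) ^ (n - i)\<bar>
          \<le> \<bar>?Q n i (s / l) - ?Q n i (t / l)\<bar> * 1"
        unfolding left_diff_distrib[symmetric] abs_mult using pw0[of "n - i"] by (intro mult_left_mono) auto
      ultimately show ?thesis by linarith
    qed
    have lip: "\<bar>sin_wrap l X n s - sin_wrap l X n t\<bar> \<le> (M + \<epsilon>) * \<bar>s - t\<bar>" for s t
    proof -
      have low: "\<bar>?F n i s - ?F n i t\<bar> \<le> (B * (K * (1 / l)) + K * (1 / l) * B) * \<bar>s - t\<bar>" if "i < n" for i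
        using Xlip[of i s t] Qlip[of i s t] B[of i "l * sin (s / l)"] G[OF that, of "t / l"] that
        by (intro lipschitz_mult[where f = "\<lambda>t. X i (l * sin (t / l))" and g = "\<lambda>t. ?Q n i (t / l) * (1 / l) ^ (n - i)"]) auto
      have top: "\<bar>X n (l * sin (s / l)) * cos (s / l) ^ n - X n (l * sin (t / l)) * cos (t / l) ^ n\<bar>
          \<le> (B * (K * (1 / l)) + 1 * M) * \<bar>s - t\<bar>"
        using Xlip[of n s t] Qlip[of n s t] B[of n "l * sin (s / l)"] cosp[of "t / l" n]
        by (intro lipschitz_mult[where f = "\<lambda>t. X n (l * sin (t / l))" and g = "\<lambda>t. cos (t / l) ^ n"]) (auto simp: sin_coeff_fun_top)
      have "\<bar>sin_wrap l X n s - sin_wrap l X n t\<bar>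
        \<le> \<bar>\<Sum>i<n. ?F n i s - ?F n i t\<bar> + \<bar>X n (l * sin (s / l)) * cos (s / l) ^ n - X n (l * sin (t / l)) * cos (t / l) ^ n\<bar>"
        unfolding split sum_subtractf by linarith
      also have "\<dots> \<le> (\<Sum>i<n. (B * (K * (1 / l)) + K * (1 / l) * B) * \<bar>s - t\<bar>) + (B * (K * (1 / l)) + 1 * M) * \<bar>s - t\<bar>"
        using low by (intro add_mono top order_trans[OF sum_abs] sum_mono) auto
      also have "\<dots> = (M + C * (1 / l)) * \<bar>s - t\<bar>"
        by (simp add: C_def algebra_simps)
      also have "\<dots> \<le> (M + \<epsilon>) * \<bar>s - t\<bar>"
        using Cl by (intro mult_right_mono) auto
      finally show ?thesis .
    qed
    have "(sin_wrap l X j has_real_derivative sin_wrap l X (Suc j) t) (at t)" if "j < n" for j t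
      using that by (intro sin_wrap_deriv[OF l1(2)] jet_deriv[OF X]) auto
    then show ?thesis using lip bound unfolding jet_def by blast
  qed
  then show ?thesis by (intro exI[of _ "max 1 (C / \<epsilon>)"]) auto
qed

section \<open>The comparison theorem on the line\<close>

lemma comparison_step_upper:
  assumes a: "a \<ge> 0" and n: "n \<ge> 1" and X: "jet n 1 X"
    and le: "\<And>t. \<bar>X 0 t\<bar> \<le> psi_norm (Suc n) a"
    and constr: "a = 0 \<or> (\<forall>t. \<bar>X (n - 1) t\<bar> \<le> 1 / 2)"
  shows "X 1 t \<le> psi_norm n a"
proof (rule ccontr)
  assume "\<not> X 1 t \<le> psi_norm n a"
  then have big: "psi_norm n a < X 1 t" by simp
  let ?N = "psi_norm (Suc n) a" and ?H = "a + 2"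
  have N: "?N > 0" by (rule psi_norm_pos[OF a]) simp
  have pn: "0 \<le> psi_norm n a" by (rule psi_norm_nonneg)
  \<comment> \<open>Halfway between 1 and the factor at which the excess of slope at
    \<open>t\<close> would disappear.\<close>
  define \<rho> where "\<rho> = (psi_norm n a / X 1 t + 1) / 2"
  have \<rho>: "0 < \<rho>" "\<rho> < 1" "psi_norm n a < \<rho> * X 1 t"
    using big pn by (auto simp: \<rho>_def field_simps add_nonneg_pos)
  \<comment> \<open>Fits into all three margins that \<open>\<rho>\<close> opens: below the
    Lipschitz constant 1, below the bound 1/2, and strictly below the norm of the spline.\<close>
  define \<epsilon> where "\<epsilon> = (1 - \<rho>) * min (1 / 2) (?N / 2)"
  have \<epsilon>0: "\<epsilon> > 0" using \<rho> N by (simp add: \<epsilon>_def)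
  have "\<epsilon> \<le> (1 - \<rho>) * (1 / 2)" "\<epsilon> \<le> (1 - \<rho>) * (?N / 2)"
    unfolding \<epsilon>_def using \<rho> by (auto intro!: mult_left_mono)
  moreover have "0 < (1 - \<rho>) * ?N" using \<rho> N by simp
  ultimately have \<epsilon>: "\<rho> + \<epsilon> \<le> 1" "\<rho> / 2 + \<epsilon> \<le> 1 / 2" "\<rho> * ?N + \<epsilon> < ?N"
    using \<rho> by (simp_all add: algebra_simps)
  define Y where "Y = (\<lambda>j s. \<rho> * X j (s + t))"
  have Y: "jet n \<rho> Y" using jet_rescale[OF X, of 1 \<rho> t] \<rho> by (simp add: Y_def)
  have Y0: "\<bar>Y 0 s\<bar> \<le> \<rho> * ?N" for s
    using le[of "s + t"] \<rho> by (simp add: Y_def abs_mult)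
  obtain B where B: "\<And>j t. j \<le> n \<Longrightarrow> \<bar>Y j t\<bar> \<le> B" using jet_bounded[OF Y Y0] by blast
  obtain l0 where l0: "l0 \<ge> 1" "\<And>l. l \<ge> l0 \<Longrightarrow> jet n (\<rho> + \<epsilon>) (sin_wrap l Y) \<and>
     (\<forall>j\<le>n. \<forall>t. \<exists>s. \<bar>sin_wrap l Y j t\<bar> \<le> \<bar>Y j s\<bar> + \<epsilon>)"
    using sin_wrap_jet[OF Y B \<epsilon>0] by blast
  obtain m :: nat where m: "l0 * pi / ?H < real m" using reals_Archimedean2 by blast
  \<comment> \<open>Makes the period \<open>2 * pi * l\<close> of the wrapped function an even
    multiple of the half period \<open>?H\<close> of the spline.\<close>
  define l where "l = real m * ?H / pi"
  have H: "?H > 0" using a by simp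
  have "l0 < l" using m H by (simp add: l_def field_simps)
  then have l: "l \<ge> l0" "l > 0" using l0(1) by auto
  have m1: "m \<ge> 1" using l(2) by (cases m) (auto simp: l_def)
  note h = l0(2)[OF l(1)]
  have "sin_wrap l Y 1 0 \<le> psi_norm n a"
  proof (rule periodic_comparison[where h = "sin_wrap l Y" and t = 0, OF a n _ m1])
    show "jet n 1 (sin_wrap l Y)" using h \<epsilon>(1) jet_mono by blast
    have period: "real (2 * m) * (a + 2) = 2 * pi * l" by (simp add: l_def)
    show "sin_wrap l Y j (s + real (2 * m) * (a + 2)) = sin_wrap l Y j s" for j s
      unfolding period by (rule sin_wrap_periodic[OF l(2)])
    show "\<bar>sin_wrap l Y 0 s\<bar> < ?N" for s
    proof -
      obtain s' where "\<bar>sin_wrap l Y 0 s\<bar> \<le> \<bar>Y 0 s'\<bar> + \<epsilon>" using h by blast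
      then show ?thesis using Y0[of s'] \<epsilon>(3) by linarith
    qed
    show "a = 0 \<or> (\<forall>s. \<bar>sin_wrap l Y (n - 1) s\<bar> \<le> 1 / 2)"
    proof (cases "a = 0")
      case False
      have "\<bar>sin_wrap l Y (n - 1) s\<bar> \<le> 1 / 2" for s
      proof -
        have "n - 1 \<le> n" by simp
        then obtain s' where s': "\<bar>sin_wrap l Y (n - 1) s\<bar> \<le> \<bar>Y (n - 1) s'\<bar> + \<epsilon>" using h by blast
        have "\<bar>X (n - 1) (s' + t)\<bar> \<le> 1 / 2" using constr False by blast
        then have "\<bar>Y (n - 1) s'\<bar> \<le> \<rho> * (1 / 2)"
          using \<rho> unfolding Y_def abs_mult by (intro mult_mono) auto
        then show ?thesis using s' \<epsilon>(2) by linarith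
      qed
      then show ?thesis by blast
    qed simp
  qed
  then show False using \<rho>(3) by (simp add: sin_wrap_at_0[simplified] Y_def)
qed

lemma comparison_step:
  assumes a: "a \<ge> 0" and n: "n \<ge> 1" and X: "jet n 1 X"
    and le: "\<And>t. \<bar>X 0 t\<bar> \<le> psi_norm (Suc n) a"
    and constr: "a = 0 \<or> (\<forall>t. \<bar>X (n - 1) t\<bar> \<le> 1 / 2)"
  shows "\<bar>X 1 t\<bar> \<le> psi_norm n a"
proof -
  have "jet n 1 (\<lambda>j t. - X j t)" using jet_rescale[OF X, of 1 "- 1" 0] by simp
  then have "- X 1 t \<le> psi_norm n a"
    using le constr by (intro comparison_step_upper[OF a n, of "\<lambda>j t. - X j t"]) auto
  then show ?thesis using comparison_step_upper[OF assms, of t] by simp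
qed

text \<open>Induction on the order: the bound just obtained is the hypothesis for the jet that
  starts there, and the constrained order \<open>n - 1\<close> is the same for all these
  jets.\<close>

lemma comparison:
  assumes a: "a \<ge> 0" and X: "jet n 1 X"
    and le: "\<And>t. \<bar>X 0 t\<bar> \<le> psi_norm (Suc n) a"
    and constr: "a = 0 \<or> (\<forall>t. \<bar>X (n - 1) t\<bar> \<le> 1 / 2)"
  shows "k \<le> n \<Longrightarrow> \<bar>X k t\<bar> \<le> psi_norm (Suc n - k) a"
proof (induction k arbitrary: t)
  case 0
  then show ?case using le by simp
next
  case (Suc k)
  have "jet (n - k) 1 (\<lambda>j. X (k + j))"
    using X Suc.prems unfolding jet_def by auto
  then have "\<bar>X (k + 1) t\<bar> \<le> psi_norm (n - k) a"
    using Suc constr by (intro comparison_step[OF a, where X = "\<lambda>j. X (k + j)"]) (auto simp: Suc_diff_le)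
  then show ?case using Suc.prems by simp
qed

text \<open>Replacing the argument by \<open>\<mu> * t\<close> and dividing by
  \<open>\<mu> ^ Suc n\<close> keeps the top Lipschitz constant at 1 and turns the bound into the
  norm of the spline. For \<open>\<mu> < 1\<close> a deficit in the function thus spreads to its
  derivatives.\<close>

lemma comparison_unconstrained:
  assumes X: "jet n 1 X" and \<mu>: "\<mu> > 0"
    and le: "\<And>t. \<bar>X 0 t\<bar> \<le> \<mu> ^ Suc n * psi_norm (Suc n) 0" and k: "k \<le> n"
  shows "\<bar>X k t\<bar> \<le> \<mu> ^ (Suc n - k) * psi_norm (Suc n - k) 0"
proof -
  define c where "c = (1 / \<mu>) ^ Suc n"
  have c: "c > 0" "c * \<mu> ^ Suc n = 1" using \<mu> by (simp_all add: c_def power_divide)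
  let ?Z = "\<lambda>j t. c * \<mu> ^ j * X j (\<mu> * t + 0)"
  have "jet n 1 ?Z" using jet_rescale[OF X \<mu>, of c 0] c by simp
  moreover have "\<bar>?Z 0 t\<bar> \<le> psi_norm (Suc n) 0" for t
  proof -
    have "c * \<bar>X 0 (\<mu> * t + 0)\<bar> \<le> c * (\<mu> ^ Suc n * psi_norm (Suc n) 0)" using le c by (intro mult_left_mono) auto
    also have "\<dots> = psi_norm (Suc n) 0" using c(2) by (metis mult.assoc mult_1)
    finally show ?thesis using c(1) by (simp add: abs_mult)
  qed
  ultimately have "\<bar>?Z k (t / \<mu>)\<bar> \<le> psi_norm (Suc n - k) 0"
    using comparison[of 0 n ?Z k] k by blast
  then have "c * \<mu> ^ k * \<bar>X k t\<bar> \<le> psi_norm (Suc n - k) 0" using c \<mu> by (simp add: abs_mult)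
  then have "\<mu> ^ (Suc n - k) * (c * \<mu> ^ k * \<bar>X k t\<bar>) \<le> \<mu> ^ (Suc n - k) * psi_norm (Suc n - k) 0"
    using \<mu> by (intro mult_left_mono) auto
  moreover have "\<mu> ^ (Suc n - k) * (c * \<mu> ^ k * \<bar>X k t\<bar>) = c * (\<mu> ^ (Suc n - k) * \<mu> ^ k) * \<bar>X k t\<bar>" by (simp add: mult_ac)
  moreover have "\<mu> ^ (Suc n - k) * \<mu> ^ k = \<mu> ^ Suc n" using k by (subst power_add[symmetric]) simp
  ultimately show ?thesis using c(2) by simp
qed

section \<open>The essential supremum norm and Sobolev functions\<close>

lemma continuous_measurable_lebesgue:
  "continuous_on UNIV (f :: real \<Rightarrow> real) \<Longrightarrow> f \<in> borel_measurable lebesgue"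
  by (simp add: borel_measurable_continuous_onI measurable_completion)

lemma Linf_norm_AE: "Linf_norm f = ereal M \<Longrightarrow> AE t in lebesgue. \<bar>f t\<bar> \<le> M"
  using esssup_AE[where M = lebesgue and f = "\<lambda>t. ereal \<bar>f t\<bar>"] by (simp add: Linf_norm_def)

lemma Linf_norm_le:
  "\<lbrakk>f \<in> borel_measurable lebesgue; AE t in lebesgue. \<bar>f t\<bar> \<le> M\<rbrakk> \<Longrightarrow> Linf_norm f \<le> ereal M"
  unfolding Linf_norm_def by (rule esssup_I) auto

text \<open>A nonempty open set is never null, so the essential supremum sees a lower bound on it
  even when a null set is excepted.\<close>

lemma Linf_norm_ge_open:
  assumes S: "open S" "S \<noteq> {}" and N: "negligible N" and ge: "\<And>t. t \<in> S - N \<Longrightarrow> M \<le> \<bar>f t\<bar>"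
  shows "ereal M \<le> Linf_norm f"
proof (rule ccontr)
  assume "\<not> ereal M \<le> Linf_norm f"
  then have lt: "Linf_norm f < ereal M" by simp
  have "AE t in lebesgue. ereal \<bar>f t\<bar> \<le> Linf_norm f"
    unfolding Linf_norm_def by (rule esssup_AE)
  then obtain Z where Z: "Z \<in> null_sets lebesgue" "{t. \<not> ereal \<bar>f t\<bar> \<le> Linf_norm f} \<subseteq> Z"
    by (auto simp: eventually_ae_filter)
  have "S \<subseteq> Z \<union> N"
  proof
    fix t assume "t \<in> S"
    show "t \<in> Z \<union> N"
    proof (rule ccontr)
      assume "t \<notin> Z \<union> N"
      then have "ereal \<bar>f t\<bar> \<le> Linf_norm f" "ereal M \<le> ereal \<bar>f t\<bar>"
        using Z(2) ge[of t] \<open>t \<in> S\<close> by auto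
      then show False using lt by (metis leD order_trans)
    qed
  qed
  then have "negligible S"
    using Z(1) N by (meson negligible_Un negligible_iff_null_sets negligible_subset)
  then show False using open_not_negligible S by blast
qed

lemma Linf_norm_continuous_iff:
  assumes "continuous_on UNIV f"
  shows "Linf_norm f \<le> ereal M \<longleftrightarrow> (\<forall>t. \<bar>f t\<bar> \<le> M)"
proof
  assume le: "Linf_norm f \<le> ereal M"
  show "\<forall>t. \<bar>f t\<bar> \<le> M"
  proof (rule ccontr)
    assume "\<not> (\<forall>t. \<bar>f t\<bar> \<le> M)"
    then obtain t where t: "M < \<bar>f t\<bar>" by (auto simp: not_le)
    define y where "y = (M + \<bar>f t\<bar>) / 2"
    have "open {t. y < \<bar>f t\<bar>}"
      using assms by (intro open_Collect_less continuous_intros) auto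
    moreover have "t \<in> {t. y < \<bar>f t\<bar>}" using t by (simp add: y_def)
    ultimately have "ereal y \<le> Linf_norm f"
      by (intro Linf_norm_ge_open[where N = "{}"]) auto
    then have "ereal y \<le> ereal M" using le by (rule order_trans)
    then show False using t by (simp add: y_def)
  qed
next
  assume "\<forall>t. \<bar>f t\<bar> \<le> M"
  then show "Linf_norm f \<le> ereal M"
    using continuous_measurable_lebesgue[OF assms] by (intro Linf_norm_le) auto
qed

lemma Linf_norm_continuous_eq:
  assumes "continuous_on UNIV f" "\<And>t. \<bar>f t\<bar> \<le> M" "\<bar>f t0\<bar> = M"
  shows "Linf_norm f = ereal M"
proof (rule antisym)
  show "Linf_norm f \<le> ereal M" using assms Linf_norm_continuous_iff by blast
  show "ereal M \<le> Linf_norm f"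
  proof (rule ccontr)
    assume "\<not> ereal M \<le> Linf_norm f"
    then obtain y where "Linf_norm f < ereal y" "ereal y < ereal M" using ereal_dense2[of "Linf_norm f" "ereal M"] by (auto simp: not_le)
    then show False using Linf_norm_continuous_iff[OF assms(1), of y] assms(3) by (auto simp: less_imp_le leD)
  qed
qed

text \<open>Off the null set \<open>deriv f\<close> is a limit of continuous difference quotients;
  on it arbitrary values do no harm because Lebesgue measure is complete.\<close>

lemma borel_measurable_deriv:
  fixes f :: "real \<Rightarrow> real"
  assumes f: "continuous_on UNIV f" and N: "negligible N"
    and d: "\<And>t. t \<notin> N \<Longrightarrow> f field_differentiable (at t)"
  shows "deriv f \<in> borel_measurable lebesgue"
proof -
  define q where "q n t = (f (t + 1 / real (Suc n)) - f t) / (1 / real (Suc n))" for n t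
  define g where "g t = lim (\<lambda>n. q n t)" for t
  have "q n \<in> borel_measurable lebesgue" for n
    unfolding q_def
    by (intro continuous_measurable_lebesgue continuous_intros continuous_on_compose2[OF f]) auto
  then have g: "g \<in> borel_measurable lebesgue"
    unfolding g_def by (rule borel_measurable_lim_metric)
  have eq: "deriv f t = g t" if "t \<notin> N" for t
  proof -
    have "(f has_real_derivative deriv f t) (at t)" using d[OF that] by (simp add: DERIV_deriv_iff_field_differentiable)
    then have "((\<lambda>h. (f (t + h) - f t) / h) \<longlongrightarrow> deriv f t) (at 0)" by (simp add: DERIV_def)
    moreover have "filterlim (\<lambda>n. 1 / real (Suc n)) (at 0) sequentially"
      by (intro filterlim_atI LIMSEQ_Suc lim_1_over_n) auto
    ultimately have "(\<lambda>n. q n t) \<longlonglongrightarrow> deriv f t"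
      unfolding q_def by (rule filterlim_compose)
    then show ?thesis by (simp add: g_def limI)
  qed
  show ?thesis
  proof (rule measurableI)
    fix S :: "real set" assume S: "S \<in> sets borel"
    have "negligible (deriv f -` S \<inter> N)" using N by (rule negligible_subset) auto
    then have 1: "deriv f -` S \<inter> N \<in> sets lebesgue" by (rule negligible_imp_sets)
    have "g -` S \<inter> space lebesgue \<in> sets lebesgue" using g S by (rule measurable_sets)
    then have 2: "g -` S - N \<in> sets lebesgue" using negligible_imp_sets[OF N] by auto
    have e: "deriv f -` S \<inter> space lebesgue = (deriv f -` S \<inter> N) \<union> (g -` S - N)"
      using eq by auto
    show "deriv f -` S \<inter> space lebesgue \<in> sets lebesgue" unfolding e by (rule sets.Un[OF 1 2])
  qed simp
qed

lemma lipschitz_imp_locally_abs_continuous: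
  fixes f :: "real \<Rightarrow> real"
  assumes "\<And>s t. \<bar>f s - f t\<bar> \<le> M * \<bar>s - t\<bar>"
  shows "locally_abs_continuous f"
  unfolding locally_abs_continuous_def abs_continuous_on_interval_def
proof (intro allI impI)
  fix a b \<epsilon> :: real assume "\<epsilon> > 0"
  have M: "0 \<le> M" using assms[of 0 1] abs_ge_zero[of "f 0 - f 1"] by simp
  show "\<exists>\<delta>>0. \<forall>(n::nat) u v. (\<forall>i<n. a \<le> u i \<and> u i \<le> v i \<and> v i \<le> b) \<longrightarrow>
        disjoint_family_on (\<lambda>i. {u i<..<v i}) {..<n} \<longrightarrow> (\<Sum>i<n. v i - u i) < \<delta> \<longrightarrow>
        (\<Sum>i<n. \<bar>f (v i) - f (u i)\<bar>) < \<epsilon>"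
  proof (intro exI[of _ "\<epsilon> / (M + 1)"] conjI allI impI)
    show "\<epsilon> / (M + 1) > 0" using \<open>\<epsilon> > 0\<close> M by simp
    fix n :: nat and u v :: "nat \<Rightarrow> real"
    assume *: "\<forall>i<n. a \<le> u i \<and> u i \<le> v i \<and> v i \<le> b" "(\<Sum>i<n. v i - u i) < \<epsilon> / (M + 1)"
    have "(\<Sum>i<n. \<bar>f (v i) - f (u i)\<bar>) \<le> (\<Sum>i<n. M * (v i - u i))"
    proof (rule sum_mono)
      fix i assume "i \<in> {..<n}"
      then have "u i \<le> v i" using *(1) by simp
      then show "\<bar>f (v i) - f (u i)\<bar> \<le> M * (v i - u i)" using assms[of "v i" "u i"] by simp
    qed
    also have "\<dots> = M * (\<Sum>i<n. v i - u i)" by (simp add: sum_distrib_left)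
    also have "\<dots> \<le> M * (\<epsilon> / (M + 1))" using *(2) M by (intro mult_left_mono) auto
    also have "\<dots> < \<epsilon>" using \<open>\<epsilon> > 0\<close> M by (simp add: field_simps)
    finally show "(\<Sum>i<n. \<bar>f (v i) - f (u i)\<bar>) < \<epsilon>" .
  qed
qed

lemma Sobolev_inf_jet:
  assumes x: "x \<in> Sobolev_inf r" and "r \<ge> 1" and M: "Linf_norm ((deriv ^^ r) x) = ereal M"
  shows "jet (r - 1) M (\<lambda>j. (deriv ^^ j) x)"
  unfolding jet_def
proof (intro conjI allI impI)
  fix j t assume "j < r - 1"
  then have "(deriv ^^ j) x field_differentiable (at t)" using x by (simp add: Sobolev_inf_def)
  then show "((deriv ^^ j) x has_real_derivative (deriv ^^ Suc j) x t) (at t)"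
    by (simp add: DERIV_deriv_iff_field_differentiable)
next
  fix s t
  have "(deriv ^^ r) x = deriv ((deriv ^^ (r - 1)) x)"
    using \<open>r \<ge> 1\<close> by (metis Suc_diff_1 funpow.simps(2) o_apply less_eq_Suc_le One_nat_def)
  then have "AE t in lebesgue. \<bar>deriv ((deriv ^^ (r - 1)) x) t\<bar> \<le> M" using Linf_norm_AE[OF M] by simp
  then show "\<bar>(deriv ^^ (r - 1)) x s - (deriv ^^ (r - 1)) x t\<bar> \<le> M * \<bar>s - t\<bar>"
    using x by (intro locally_abs_continuous_lipschitz) (auto simp: Sobolev_inf_def)
qed

section \<open>Norms of the comparison spline plus a constant\<close>

context
  fixes r :: nat and a b l C :: real
  assumes r: "r \<ge> 1" and a: "a \<ge> 0" and b: "b > 0" and l: "l > 0" and C: "C \<ge> 0"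
begin

definition shifted_Psi :: "real \<Rightarrow> real" where "shifted_Psi = (\<lambda>t. Psi r a b l t + C)"

lemma shifted_Psi_deriv:
  "j < r \<Longrightarrow> (deriv ^^ j) shifted_Psi = (\<lambda>t. b * l ^ j * psi (r - j) a (l * t) + (if j = 0 then C else 0))"
proof (induction j)
  case 0
  then show ?case by (simp add: shifted_Psi_def Psi_def)
next
  case (Suc j)
  have s: "r - j = Suc (r - Suc j)" "r - Suc j \<ge> 1" using Suc.prems by auto
  have "((\<lambda>t. psi (r - j) a (l * t)) has_real_derivative psi (r - Suc j) a (l * t) * l) (at t)" for t
    unfolding s(1) by (rule DERIV_chain2[OF psi_deriv[OF a s(2)]]) (auto intro!: derivative_eq_intros)
  note d = DERIV_add[OF DERIV_cmult[OF this, of "b * l ^ j"] DERIV_const[of "if j = 0 then C else 0"]]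
  have "(deriv ^^ j) shifted_Psi = (\<lambda>t. b * l ^ j * psi (r - j) a (l * t) + (if j = 0 then C else 0))"
    using Suc by simp
  then have "((deriv ^^ j) shifted_Psi has_real_derivative b * l ^ j * (psi (r - Suc j) a (l * t) * l) + 0) (at t)" for t
    using d[of t] by (simp only:)
  moreover have "b * l ^ j * (p * l) + 0 = b * l ^ Suc j * p" for p by simp
  ultimately have "((deriv ^^ j) shifted_Psi has_real_derivative b * l ^ Suc j * psi (r - Suc j) a (l * t)) (at t)" for t
    by (simp only:)
  then show ?case by (auto simp: fun_eq_iff DERIV_imp_deriv)
qed

lemma shifted_Psi_continuous: "j < r \<Longrightarrow> continuous_on UNIV ((deriv ^^ j) shifted_Psi)"
  unfolding shifted_Psi_deriv
  by (intro continuous_intros continuous_on_compose2[OF psi_continuous[OF a, of "r - j" UNIV]]) auto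

text \<open>The spline attains its norm with positive sign, so a nonnegative constant adds to the
  norm in full, while derivatives do not see it.\<close>

lemma shifted_Psi_norm:
  assumes "j < r"
  shows "Linf_norm ((deriv ^^ j) shifted_Psi) = ereal (b * l ^ j * psi_norm (r - j) a + (if j = 0 then C else 0))"
proof -
  have s: "r - j \<ge> 1" using assms by simp
  have p: "0 < b * l ^ j" using b l by simp
  obtain t0 where t0: "psi (r - j) a t0 = psi_norm (r - j) a" using psi_norm_attained[OF a s] by metis
  show ?thesis
  proof (rule Linf_norm_continuous_eq[OF shifted_Psi_continuous[OF assms]])
    fix t
    have "\<bar>b * l ^ j * psi (r - j) a (l * t)\<bar> \<le> b * l ^ j * psi_norm (r - j) a"
      unfolding abs_mult[of "b * l ^ j"] abs_of_pos[OF p] 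
      by (rule mult_left_mono[OF psi_abs_le[OF a s] less_imp_le[OF p]])
    then show "\<bar>(deriv ^^ j) shifted_Psi t\<bar> \<le> b * l ^ j * psi_norm (r - j) a + (if j = 0 then C else 0)"
      unfolding shifted_Psi_deriv[OF assms] using C by (auto simp: abs_le_iff)
    show "\<bar>(deriv ^^ j) shifted_Psi (t0 / l)\<bar> = b * l ^ j * psi_norm (r - j) a + (if j = 0 then C else 0)"
      unfolding shifted_Psi_deriv[OF assms] using C l t0 p psi_norm_nonneg[of "r - j" a] by simp
  qed
qed

lemma shifted_Psi_top:
  "(deriv ^^ r) shifted_Psi = deriv ((deriv ^^ (r - 1)) shifted_Psi)"
  using r by (metis Suc_diff_1 funpow.simps(2) o_apply less_eq_Suc_le One_nat_def)

lemma shifted_Psi_pre_top: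
  "(deriv ^^ (r - 1)) shifted_Psi = (\<lambda>t. b * l ^ (r - 1) * psi1 a (l * t) + (if r - 1 = 0 then C else 0))"
proof -
  have "r - (r - 1) = Suc 0" "r - 1 < r" using r by auto
  then show ?thesis using shifted_Psi_deriv[of "r - 1"] by simp
qed

lemma shifted_Psi_top_deriv:
  assumes "(psi1 a has_real_derivative D) (at (l * t))"
  shows "((deriv ^^ (r - 1)) shifted_Psi has_real_derivative b * l ^ r * D) (at t)"
proof -
  have "((\<lambda>t. psi1 a (l * t)) has_real_derivative D * l) (at t)"
    by (rule DERIV_chain2[where f = "psi1 a" and g = "\<lambda>t. l * t", OF assms]) (auto intro!: derivative_eq_intros)
  from DERIV_add[OF DERIV_cmult[OF this, of "b * l ^ (r - 1)"] DERIV_const]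
  have "((deriv ^^ (r - 1)) shifted_Psi has_real_derivative b * l ^ (r - 1) * (D * l)) (at t)"
    unfolding shifted_Psi_pre_top by simp
  moreover have "l ^ r = l ^ (r - 1) * l" using r by (metis power_minus_mult less_eq_Suc_le One_nat_def)
  ultimately show ?thesis by (simp add: mult_ac)
qed

lemma shifted_Psi_corners: "negligible ((*) l -` psi1_corners a)"
proof -
  have "(*) l -` psi1_corners a \<subseteq> (\<lambda>x. x / l) ` psi1_corners a" using l by (force simp: image_iff)
  then have "countable ((*) l -` psi1_corners a)"
    by (rule countable_subset) (intro countable_image countable_psi1_corners)
  then show ?thesis
    unfolding negligible_iff_null_sets by (intro null_sets_completionI countable_imp_null_set_lborel)
qed

text \<open>Off the null set of corners the slopes of \<open>psi1\<close> are at most 1 in modulus,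
  and on the open interval \<open>(0, 1)\<close> they equal 1.\<close>

lemma shifted_Psi_norm_top:
  "(deriv ^^ r) shifted_Psi \<in> borel_measurable lebesgue" "Linf_norm ((deriv ^^ r) shifted_Psi) = ereal (b * l ^ r)"
proof -
  let ?N = "(*) l -` psi1_corners a" and ?f = "(deriv ^^ (r - 1)) shifted_Psi"
  have p: "0 < b * l ^ r" using b l by simp
  have d: "\<exists>D. (?f has_real_derivative b * l ^ r * D) (at t) \<and> \<bar>D\<bar> \<le> 1" if "t \<notin> ?N" for t
    using psi1_deriv_off_corners[OF a, of "l * t"] that shifted_Psi_top_deriv by auto
  show meas: "(deriv ^^ r) shifted_Psi \<in> borel_measurable lebesgue"
    unfolding shifted_Psi_top
  proof (rule borel_measurable_deriv[OF _ shifted_Psi_corners])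
    show "continuous_on UNIV ?f" using r by (intro shifted_Psi_continuous) simp
    show "?f field_differentiable (at t)" if "t \<notin> ?N" for t
      using d[OF that] by (auto simp: field_differentiable_def)
  qed
  show "Linf_norm ((deriv ^^ r) shifted_Psi) = ereal (b * l ^ r)"
  proof (rule antisym)
    have "\<bar>(deriv ^^ r) shifted_Psi t\<bar> \<le> b * l ^ r" if t: "t \<notin> ?N" for t
    proof -
      obtain D where D: "deriv ?f t = b * l ^ r * D" "\<bar>D\<bar> \<le> 1" using d[OF t] DERIV_imp_deriv by blast
      show ?thesis
        unfolding shifted_Psi_top D(1) abs_mult[of "b * l ^ r"] abs_of_pos[OF p] 
        using mult_left_mono[OF D(2) less_imp_le[OF p]] by (simp only: mult_1_right)
    qed
    then have "AE t in lebesgue. \<bar>(deriv ^^ r) shifted_Psi t\<bar> \<le> b * l ^ r"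
      using shifted_Psi_corners by (intro AE_I'[of ?N]) (auto simp: negligible_iff_null_sets)
    then show "Linf_norm ((deriv ^^ r) shifted_Psi) \<le> ereal (b * l ^ r)" by (rule Linf_norm_le[OF meas])
    show "ereal (b * l ^ r) \<le> Linf_norm ((deriv ^^ r) shifted_Psi)"
    proof (rule Linf_norm_ge_open[where S = "{0<..<1 / l}" and N = "{}"])
      fix t assume "t \<in> {0<..<1 / l} - {}"
      then have "0 < l * t" "l * t < 1" using l by (auto simp: field_simps)
      then have "(psi1 a has_real_derivative 1) (at (l * t))"
        using psi1_has_real_derivative[OF a, of "l * t" 0] a by simp
      then have "deriv ?f t = b * l ^ r" using shifted_Psi_top_deriv[of 1 t] DERIV_imp_deriv by fastforce
      then show "b * l ^ r \<le> \<bar>(deriv ^^ r) shifted_Psi t\<bar>" unfolding shifted_Psi_top using p by simp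
    qed (use l in auto)
  qed
qed

lemma shifted_Psi_Sobolev: "shifted_Psi \<in> Sobolev_inf_inf r"
proof -
  let ?M = "b * l ^ (r - 1) * l"
  have lip: "\<bar>(deriv ^^ (r - 1)) shifted_Psi s - (deriv ^^ (r - 1)) shifted_Psi t\<bar> \<le> ?M * \<bar>s - t\<bar>" for s t
  proof -
    have "\<bar>psi1 a (l * s) - psi1 a (l * t)\<bar> \<le> l * \<bar>s - t\<bar>"
      using psi1_lipschitz[OF a, of "l * s" "l * t"] l by (simp add: abs_mult flip: right_diff_distrib)
    then have "b * l ^ (r - 1) * \<bar>psi1 a (l * s) - psi1 a (l * t)\<bar> \<le> b * l ^ (r - 1) * (l * \<bar>s - t\<bar>)"
      using b l by (intro mult_left_mono) auto
    moreover have "\<bar>(deriv ^^ (r - 1)) shifted_Psi s - (deriv ^^ (r - 1)) shifted_Psi t\<bar>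
        = \<bar>b * l ^ (r - 1) * (psi1 a (l * s) - psi1 a (l * t))\<bar>"
      unfolding shifted_Psi_pre_top by (simp add: right_diff_distrib)
    moreover have "\<dots> = b * l ^ (r - 1) * \<bar>psi1 a (l * s) - psi1 a (l * t)\<bar>"
      using b l abs_mult[of "b * l ^ (r - 1)"] by (simp only: abs_of_pos mult_pos_pos zero_less_power)
    ultimately show ?thesis by (simp only: mult.assoc)
  qed
  have diff: "(deriv ^^ j) shifted_Psi field_differentiable (at t)" if "j < r - 1" for j t
  proof -
    have j: "j < r" "r - j = Suc (r - Suc j)" "r - Suc j \<ge> 1" using that by auto
    have "((\<lambda>t. psi (r - j) a (l * t)) has_real_derivative psi (r - Suc j) a (l * t) * l) (at t)"
      unfolding j(2) by (rule DERIV_chain2[OF psi_deriv[OF a j(3)]]) (auto intro!: derivative_eq_intros)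
    from DERIV_add[OF DERIV_cmult[OF this] DERIV_const] show ?thesis
      unfolding shifted_Psi_deriv[OF j(1)] field_differentiable_def by blast
  qed
  have "shifted_Psi \<in> Linf"
    using shifted_Psi_norm[of 0] shifted_Psi_continuous[of 0] r continuous_measurable_lebesgue by (simp add: Linf_def)
  moreover have "(deriv ^^ r) shifted_Psi \<in> Linf" using shifted_Psi_norm_top by (simp add: Linf_def)
  ultimately show ?thesis
    using diff lipschitz_imp_locally_abs_continuous[OF lip] by (simp add: Sobolev_inf_inf_def Sobolev_inf_def)
qed

end

section \<open>The Kolmogorov problem\<close>

lemma euler_spline_norm:
  assumes "s \<ge> 1"
  shows "Linf_norm (euler_spline s) = ereal ((pi / 2) ^ s * psi_norm s 0)"
proof -
  obtain m where m: "s = Suc m" using assms by (cases s) auto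
  have E: "euler_spline s = (\<lambda>t. (pi / 2) ^ s * psi s 0 (2 * t / pi))"
    unfolding m using euler_spline_psi by blast
  obtain t0 where t0: "psi s 0 t0 = psi_norm s 0" using psi_norm_attained[of 0 s] assms by auto
  have p: "0 < (pi / 2) ^ s" by simp
  show ?thesis
  proof (rule Linf_norm_continuous_eq)
    show "continuous_on UNIV (euler_spline s)"
      unfolding E using assms
      by (intro continuous_intros continuous_on_compose2[OF psi_continuous[of 0 s UNIV]]) auto
    show "\<bar>euler_spline s t\<bar> \<le> (pi / 2) ^ s * psi_norm s 0" for t
      unfolding E abs_mult[of "(pi / 2) ^ s"] abs_of_pos[OF p]
      using assms by (intro mult_left_mono psi_abs_le) auto
    show "\<bar>euler_spline s (t0 * pi / 2)\<bar> = (pi / 2) ^ s * psi_norm s 0"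
      unfolding E abs_mult[of "(pi / 2) ^ s"] abs_of_pos[OF p] using t0 psi_norm_nonneg[of s 0] by simp
  qed
qed

text \<open>The powers of \<open>pi / 2\<close> cancel, since raising \<open>(pi / 2) ^ q\<close> to
  the power \<open>2 / q\<close> gives its square. With \<open>m\<close> expressed through
  \<open>l\<close>, raising both sides to the power \<open>q / 2\<close> leaves a comparison of
  \<open>K\<close> with the spline for \<open>a = 0\<close>, scaled to the other two norms.\<close>

lemma kolmogorov_condition_iff:
  fixes q :: nat
  assumes q: "q \<ge> 3" and pos: "N > 0" "K > 0" "M > 0" "m > 0" "l > 0" and l: "l\<^sup>2 = M / (2 * m)"
  shows "m \<le> (pi / 2) ^ 2 * (1 / 2) / ((pi / 2) ^ q * N) powr (2 / real q) * K powr (2 / real q) * M powr (real (q - 2) / real q)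
     \<longleftrightarrow> M / l ^ q * N \<le> K"
proof -
  define p where "p = 2 / real q"
  have p: "p > 0" "real q * p = 2" "real (q - 2) / real q = 1 - p" using q by (auto simp: p_def field_simps)
  have root: "(c ^ q) powr p = c\<^sup>2" if "c > 0" for c :: real
  proof -
    have "(c ^ q) powr p = (c powr real q) powr p" using that by (simp add: powr_realpow)
    also have "\<dots> = c powr 2" unfolding powr_powr p(2) ..
    finally show ?thesis using that by simp
  qed
  have E: "((pi / 2) ^ q * N) powr p = (pi / 2)\<^sup>2 * N powr p"
    using pos root[of "pi / 2"] by (simp only: powr_mult pi_half_gt_zero)
  have mm: "m = M / l\<^sup>2 / 2" unfolding l using pos by simp
  have Msplit: "M powr p * M powr (1 - p) = M" using pos by (simp flip: powr_add)
  have cancel: "(pi / 2)\<^sup>2 * (1 / 2) / ((pi / 2)\<^sup>2 * N powr p) = 1 / 2 / N powr p" by simp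
  have alg: "M / A / 2 \<le> 1 / 2 / B * C * D \<longleftrightarrow> M * B / A \<le> C * D" if "A > 0" "B > 0" for A B C D
    using that by (simp add: field_simps)
  have "m \<le> (pi / 2) ^ 2 * (1 / 2) / ((pi / 2) ^ q * N) powr p * K powr p * M powr (1 - p)
     \<longleftrightarrow> M / l\<^sup>2 / 2 \<le> 1 / 2 / N powr p * K powr p * M powr (1 - p)"
    by (simp only: E cancel mm[symmetric])
  also have "\<dots> \<longleftrightarrow> M * N powr p / l\<^sup>2 \<le> K powr p * M powr (1 - p)"
    by (rule alg) (use pos in auto)
  also have "M * N powr p / l\<^sup>2 = (M powr p * N powr p / l\<^sup>2) * M powr (1 - p)"
  proof -
    have "(M powr p * N powr p / l\<^sup>2) * M powr (1 - p) = (M powr p * M powr (1 - p)) * N powr p / l\<^sup>2" by simp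
    then show ?thesis unfolding Msplit by (rule sym)
  qed
  also have "(M powr p * N powr p / l\<^sup>2) * M powr (1 - p) \<le> K powr p * M powr (1 - p)
     \<longleftrightarrow> M powr p * N powr p / l\<^sup>2 \<le> K powr p"
    using pos by (intro mult_le_cancel_right_pos) simp
  also have "M powr p * N powr p / l\<^sup>2 = (M / l ^ q * N) powr p"
  proof -
    have "(M / l ^ q * N) powr p = M powr p / (l ^ q) powr p * N powr p"
      using pos by (subst powr_mult, simp_all add: powr_divide)
    then show ?thesis using root[OF pos(5)] by simp
  qed
  also have "(M / l ^ q * N) powr p \<le> K powr p \<longleftrightarrow> M / l ^ q * N \<le> K"
  proof -
    have "0 \<le> M / l ^ q * N" using pos by simp
    then show ?thesis
      using powr_mono2[of p "M / l ^ q * N" K] powr_less_mono2[of p K "M / l ^ q * N"] p(1) pos(2)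
      by (cases "M / l ^ q * N \<le> K") (auto simp del: times_divide_eq_left)
  qed
  finally show ?thesis by (simp only: p_def[symmetric] p(3))
qed

context
  fixes r k :: nat and Mk Mr2 Mr l b :: real
  assumes r: "r \<ge> 4" and k: "0 < k" "k < r - 2" and pos: "Mk > 0" "Mr2 > 0" "Mr > 0"
    and l: "l > 0" "l\<^sup>2 = Mr / (2 * Mr2)" and b: "b = Mr / l ^ r"
begin

lemma b_pos: "b > 0" using pos l by (simp add: b)

text \<open>Two of the norms force amplitude and scale: \<open>b * l ^ r\<close> is
  \<open>Mr\<close>, and \<open>b * l ^ (r - 2)\<close> times 1/2, the norm of
  \<open>psi 2 a\<close>, is \<open>Mr2\<close>.\<close>

lemma b_powers: "b * l ^ r = Mr" "b * l ^ (r - 2) = 2 * Mr2" "b * l ^ k = Mr / l ^ (r - k)"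
proof -
  show "b * l ^ r = Mr" using l by (simp add: b)
  have e: "r - 2 + 2 = r" "r - k + k = r" using r k by auto
  have "l ^ r = l ^ (r - 2) * l\<^sup>2" by (metis power_add e(1))
  then show "b * l ^ (r - 2) = 2 * Mr2"
    unfolding b l(2) using l(1) pos by simp
  have "l ^ r = l ^ (r - k) * l ^ k" by (metis power_add e(2))
  then show "b * l ^ k = Mr / l ^ (r - k)"
    unfolding b using l(1) by simp
qed

text \<open>The intermediate value theorem in \<open>a\<close> shows that the choice is not void.
  Whatever is chosen, the norms of order \<open>r\<close> and \<open>r - 2\<close> determine its
  amplitude and scale, and its parameter realizes the norm of order \<open>k\<close>.\<close>

lemma comparison_spline_eq:
  assumes le: "b * l ^ k * psi_norm (r - k) 0 \<le> Mk"
  obtains a where "a \<ge> 0" "comparison_spline r k Mk Mr2 Mr = Psi r a b l" "b * l ^ k * psi_norm (r - k) a = Mk"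
proof -
  let ?P = "\<lambda>F. \<exists>a b l. a \<ge> 0 \<and> b > 0 \<and> l > 0 \<and> F = Psi r a b l \<and>
        Linf_norm ((deriv ^^ k) F) = ereal Mk \<and> Linf_norm ((deriv ^^ (r - 2)) F) = ereal Mr2 \<and>
        Linf_norm ((deriv ^^ r) F) = ereal Mr"
  have norms: "Linf_norm ((deriv ^^ k) (Psi r a b l)) = ereal (b * l ^ k * psi_norm (r - k) a)"
      "Linf_norm ((deriv ^^ (r - 2)) (Psi r a b l)) = ereal (b * l ^ (r - 2) * (1 / 2))"
      "Linf_norm ((deriv ^^ r) (Psi r a b l)) = ereal (b * l ^ r)"
    if "a \<ge> 0" "b > 0" "l > 0" for a b l
  proof -
    have s: "shifted_Psi r a b l 0 = Psi r a b l" using r that by (simp add: shifted_Psi_def fun_eq_iff)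
    have "r \<ge> 1" "r - (r - 2) = 2" using r by auto
    then show "Linf_norm ((deriv ^^ k) (Psi r a b l)) = ereal (b * l ^ k * psi_norm (r - k) a)"
      "Linf_norm ((deriv ^^ (r - 2)) (Psi r a b l)) = ereal (b * l ^ (r - 2) * (1 / 2))"
      "Linf_norm ((deriv ^^ r) (Psi r a b l)) = ereal (b * l ^ r)"
      using shifted_Psi_norm[of r a b l 0] shifted_Psi_norm_top(2)[of r a b l 0] that k r psi_norm_2[of a]
      by (simp_all add: s)
  qed
  have blk: "b * l ^ k > 0" using b_pos l by simp
  have "r - k \<ge> 3" using k by simp
  moreover have "psi_norm (r - k) 0 \<le> Mk / (b * l ^ k)" using le blk by (simp add: pos_le_divide_eq mult.commute)
  ultimately obtain a1 where a1: "a1 \<ge> 0" "psi_norm (r - k) a1 = Mk / (b * l ^ k)" by (rule psi_norm_surj)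
  have "b * l ^ k * psi_norm (r - k) a1 = Mk" unfolding a1(2)
    using blk by (metis less_irrefl nonzero_mult_div_cancel_left times_divide_eq_right)
  then have "?P (Psi r a1 b l)"
    using norms[OF a1(1) b_pos l(1)] b_powers a1(1) b_pos l(1) by (intro exI[of _ a1] exI[of _ b] exI[of _ l]) simp
  then have "?P (comparison_spline r k Mk Mr2 Mr)"
    unfolding comparison_spline_def by (rule someI[of ?P])
  then obtain a b' l' where F: "a \<ge> 0" "b' > 0" "l' > 0" "comparison_spline r k Mk Mr2 Mr = Psi r a b' l'"
     "b' * l' ^ k * psi_norm (r - k) a = Mk" "b' * l' ^ (r - 2) * (1 / 2) = Mr2" "b' * l' ^ r = Mr"
    using norms by (metis ereal.inject)
  have "r - 2 + 2 = r" using r by simp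
  then have "l' ^ r = l' ^ (r - 2) * l'\<^sup>2" by (metis power_add)
  moreover have "b' * l' ^ (r - 2) = 2 * Mr2" using F(6) by simp
  ultimately have "2 * Mr2 * l'\<^sup>2 = Mr" using F(7) by (metis mult.assoc)
  then have "l'\<^sup>2 = l\<^sup>2"
    unfolding l(2) using pos(2) by (subst nonzero_eq_divide_eq) (simp_all add: mult.commute)
  then have "l' = l" using F(3) l(1) by (simp add: power2_eq_iff_nonneg)
  moreover have "b' = b" using F(7) l(1) unfolding b \<open>l' = l\<close> by (simp add: field_simps)
  ultimately show ?thesis using that[OF F(1)] F(4,5) by simp
qed

lemma necessity:
  assumes x: "x \<in> Sobolev_inf_inf r"
    and nx: "Linf_norm x = ereal M0" "Linf_norm ((deriv ^^ k) x) = ereal Mk"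
      "Linf_norm ((deriv ^^ (r - 2)) x) = ereal Mr2" "Linf_norm ((deriv ^^ r) x) = ereal Mr"
    and "M0 > 0"
  shows "b * l ^ k * psi_norm (r - k) 0 \<le> Mk"
    and "Linf_norm (comparison_spline r k Mk Mr2 Mr) \<le> ereal M0"
proof -
  define X where "X = (\<lambda>j. (deriv ^^ j) x)"
  have jX: "jet (r - 1) Mr X"
    unfolding X_def using x nx(4) r by (intro Sobolev_inf_jet) (auto simp: Sobolev_inf_inf_def)
  have bound_iff: "Linf_norm (X j) \<le> ereal y \<longleftrightarrow> (\<forall>t. \<bar>X j t\<bar> \<le> y)" if "j \<le> r - 1" for j y
    by (rule Linf_norm_continuous_iff[OF jet_continuous[OF jX that]])
  \<comment> \<open>Undoes \<open>b\<close> and \<open>l\<close>: the top Lipschitz constant becomes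
    1 and the bound of order \<open>r - 2\<close> becomes 1/2, so \<open>Z\<close> compares directly
    with \<open>psi r a\<close>.\<close>
  define Z where "Z = (\<lambda>j t. 1 / b * (1 / l) ^ j * X j (1 / l * t + 0))"
  have jZ: "jet (r - 1) 1 Z"
  proof -
    have "Suc (r - 1) = r" using r by simp
    then have "\<bar>1 / b\<bar> * (1 / l) ^ Suc (r - 1) * Mr = 1"
      using b_pos l(1) unfolding b_powers(1)[symmetric] by (simp add: power_divide)
    moreover have "jet (r - 1) (\<bar>1 / b\<bar> * (1 / l) ^ Suc (r - 1) * Mr) Z"
      unfolding Z_def by (rule jet_rescale[OF jX]) (use l(1) in simp)
    ultimately show ?thesis by (simp only:)
  qed
  have ZX: "(\<forall>t. \<bar>Z j t\<bar> \<le> y) \<longleftrightarrow> (\<forall>t. \<bar>X j t\<bar> \<le> b * l ^ j * y)" for j y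
  proof -
    have p: "b * l ^ j > 0" using b_pos l(1) by simp
    have eq: "X j t = b * l ^ j * Z j (l * t)" for t
      using b_pos l(1) by (simp add: Z_def power_divide)
    have le: "\<bar>X j t\<bar> \<le> b * l ^ j * y \<longleftrightarrow> \<bar>Z j (l * t)\<bar> \<le> y" for t
      unfolding eq abs_mult[of "b * l ^ j"] abs_of_pos[OF p] using p by (rule mult_le_cancel_left_pos)
    show ?thesis unfolding le using l(1) by (metis nonzero_mult_div_cancel_left less_irrefl times_divide_eq_right)
  qed
  have X: "\<forall>t. \<bar>X 0 t\<bar> \<le> M0" "\<forall>t. \<bar>X k t\<bar> \<le> Mk" "\<forall>t. \<bar>X (r - 2) t\<bar> \<le> Mr2"
    using bound_iff[of 0 M0] bound_iff[of k Mk] bound_iff[of "r - 2" Mr2] nx r k by (simp_all add: X_def)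
  \<comment> \<open>As \<open>Mk\<close> is the norm itself and not just a bound, any strictly
    better estimate of \<open>Z k\<close> is contradictory; the same holds for \<open>Mr2\<close> at
    order \<open>r - 2\<close>.\<close>
  have lowk: "Mk \<le> b * l ^ k * y" if "\<forall>t. \<bar>Z k t\<bar> \<le> y" for y
    using that bound_iff[of k "b * l ^ k * y"] nx(2) k unfolding ZX by (simp add: X_def)
  have low2: "Mr2 \<le> 2 * Mr2 * y" if "\<forall>t. \<bar>Z (r - 2) t\<bar> \<le> y" for y
    using that bound_iff[of "r - 2" "2 * Mr2 * y"] nx(3) r unfolding ZX b_powers(2) by (simp add: X_def)
  have Z2: "\<forall>t. \<bar>Z (r - 2) t\<bar> \<le> 1 / 2" unfolding ZX b_powers(2) using X(3) by simp
  have blk: "b * l ^ k > 0" using b_pos l(1) by simp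
  let ?q = "r - k"
  have q: "?q \<ge> 3" using k by simp
  have root: "\<exists>\<mu>. 0 < \<mu> \<and> \<mu> < 1 \<and> \<mu> ^ n = \<theta>" if "0 < \<theta>" "\<theta> < 1" "n > 0" for \<theta> :: real and n :: nat
    using that by (intro exI[of _ "root n \<theta>"]) (auto simp: real_root_gt_zero)
  show A: "b * l ^ k * psi_norm ?q 0 \<le> Mk"
  proof (rule ccontr)
    assume c: "\<not> b * l ^ k * psi_norm ?q 0 \<le> Mk"
    have N: "psi_norm ?q 0 > 0" using q by (intro psi_norm_pos) auto
    have "0 < b * l ^ k * psi_norm ?q 0" using blk N by (rule mult_pos_pos)
    then have "0 < Mk / (b * l ^ k * psi_norm ?q 0)" "Mk / (b * l ^ k * psi_norm ?q 0) < 1"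
      using c pos(1) by (simp_all only: zero_less_divide_iff pos_divide_less_eq mult_1 not_le simp_thms)
    \<comment> \<open>The deficit of \<open>Mk\<close> written as \<open>\<mu> ^ ?q\<close>
      reappears at order \<open>r - 2\<close> as \<open>\<mu>\<^sup>2\<close>, which contradicts the
      norm \<open>Mr2\<close>.\<close>
    then obtain \<mu> where \<mu>: "0 < \<mu>" "\<mu> < 1" "\<mu> ^ ?q = Mk / (b * l ^ k * psi_norm ?q 0)"
      using root[of "Mk / (b * l ^ k * psi_norm ?q 0)" ?q] q by force
    have "jet (r - 1 - k) 1 (\<lambda>j. Z (k + j))"
      using jZ k unfolding jet_def by auto
    moreover have "Suc (r - 1 - k) = ?q" using k by simp
    moreover have "\<bar>Z k t\<bar> \<le> \<mu> ^ ?q * psi_norm ?q 0" for t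
    proof -
      have "u * (Mk / (u * v) * v) = Mk" if "u > 0" "v > 0" for u v using that by simp
      from this[OF blk N] have "b * l ^ k * (\<mu> ^ ?q * psi_norm ?q 0) = Mk" unfolding \<mu>(3) .
      then show ?thesis using ZX[of k "\<mu> ^ ?q * psi_norm ?q 0"] X(2) by simp
    qed
    ultimately have "\<bar>Z (k + (?q - 2)) t\<bar> \<le> \<mu> ^ (?q - (?q - 2)) * psi_norm (?q - (?q - 2)) 0" for t
      using comparison_unconstrained[of "r - 1 - k" "\<lambda>j. Z (k + j)" \<mu> "?q - 2" t] \<mu>(1) q by simp
    moreover have "k + (?q - 2) = r - 2" "?q - (?q - 2) = 2" using k by auto
    ultimately have "\<forall>t. \<bar>Z (r - 2) t\<bar> \<le> \<mu>\<^sup>2 * (1 / 2)" by (simp add: psi_norm_2)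
    then have "Mr2 \<le> 2 * Mr2 * (\<mu>\<^sup>2 * (1 / 2))" by (rule low2)
    moreover have "\<mu>\<^sup>2 < 1" using \<mu> by (simp add: power_less_one_iff)
    ultimately show False using pos(2) by simp
  qed
  obtain a where a: "a \<ge> 0" "comparison_spline r k Mk Mr2 Mr = Psi r a b l" "b * l ^ k * psi_norm ?q a = Mk"
    using comparison_spline_eq[OF A] .
  have r1: "r \<ge> 1" "Suc (r - 1) = r" using r by auto
  have nF: "Linf_norm (Psi r a b l) = ereal (b * psi_norm r a)"
    using shifted_Psi_norm[OF r1(1) a(1) b_pos l(1) order_refl, of 0] r by (simp add: shifted_Psi_def[OF r1(1) a(1) b_pos l(1) order_refl])
  have "b * psi_norm r a \<le> M0"
  proof (rule ccontr)
    assume c: "\<not> b * psi_norm r a \<le> M0"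
    have b0: "b > 0" by (rule b_pos)
    define \<theta> where "\<theta> = M0 / b"
    have \<theta>: "0 < \<theta>" "\<theta> < psi_norm r a" using c b0 \<open>M0 > 0\<close> by (auto simp: \<theta>_def field_simps)
    have Z0: "\<bar>Z 0 t\<bar> \<le> \<theta>" for t
      using ZX[of 0 \<theta>] X(1) b0 by (simp add: \<theta>_def)
    show False
    proof (cases "a = 0")
      case True
      then obtain \<mu> where \<mu>: "0 < \<mu>" "\<mu> < 1" "\<mu> ^ r = \<theta> / psi_norm r 0"
        using root[of "\<theta> / psi_norm r 0" r] \<theta> r by auto
      have "\<mu> ^ r * psi_norm r 0 = \<theta>" using \<mu>(3) \<theta> True by simp
      then have "\<forall>t. \<bar>Z k t\<bar> \<le> \<mu> ^ ?q * psi_norm ?q 0"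
        using comparison_unconstrained[OF jZ \<mu>(1), of k] Z0 k r1 by simp
      then have "Mk \<le> b * l ^ k * (\<mu> ^ ?q * psi_norm ?q 0)" by (rule lowk)
      also have "\<dots> = \<mu> ^ ?q * Mk" using a(3) True by (simp add: mult_ac)
      finally have "1 \<le> \<mu> ^ ?q" using pos(1) by simp
      then show False using \<mu> q by (metis power_less_one_iff less_le_not_le less_imp_le not_numeral_le_zero le_zero_eq neq0_conv)
    next
      case False
      \<comment> \<open>A smaller parameter whose spline still dominates \<open>Z 0\<close>. The
        bound 1/2 suits it equally well, but its norm of order \<open>?q\<close> is strictly smaller
        than required.\<close>
      obtain a' where a': "0 \<le> a'" "a' < a" "\<theta> \<le> psi_norm r a'"
      proof (cases "\<theta> \<le> psi_norm r 0")
        case True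
        then show ?thesis using that[of 0] a(1) False by simp
      next
        case False
        have "continuous_on {0..a} (psi_norm r)"
          using r by (intro continuous_on_subset[OF psi_norm_continuous]) auto
        then obtain a' where "0 \<le> a'" "a' \<le> a" "psi_norm r a' = \<theta>"
          using IVT'[of "psi_norm r" 0 \<theta> a] False \<theta>(2) a(1) by auto
        then show ?thesis using that[of a'] \<theta>(2) by (cases "a' = a") auto
      qed
      have "\<bar>Z 0 t\<bar> \<le> psi_norm r a'" for t using Z0[of t] a'(3) by linarith
      moreover have "r - 1 - 1 = r - 2" by simp
      ultimately have "\<forall>t. \<bar>Z k t\<bar> \<le> psi_norm ?q a'"
        using comparison[OF a'(1) jZ, of k] Z2 k r1 by simp
      then have "Mk \<le> b * l ^ k * psi_norm ?q a'" by (rule lowk)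
      also have "\<dots> < b * l ^ k * psi_norm ?q a"
        by (rule mult_strict_left_mono[OF psi_norm_strict_mono[OF a'(1,2) q] blk])
      finally show False using a(3) by simp
    qed
  qed
  then show "Linf_norm (comparison_spline r k Mk Mr2 Mr) \<le> ereal M0" by (simp add: a(2) nF)
qed

lemma sufficiency:
  assumes le: "b * l ^ k * psi_norm (r - k) 0 \<le> Mk"
    and M0: "Linf_norm (comparison_spline r k Mk Mr2 Mr) \<le> ereal M0"
  shows "\<exists>x \<in> Sobolev_inf_inf r. Linf_norm x = ereal M0 \<and> Linf_norm ((deriv ^^ k) x) = ereal Mk \<and>
     Linf_norm ((deriv ^^ (r - 2)) x) = ereal Mr2 \<and> Linf_norm ((deriv ^^ r) x) = ereal Mr"
proof -
  obtain a where a: "a \<ge> 0" "comparison_spline r k Mk Mr2 Mr = Psi r a b l" "b * l ^ k * psi_norm (r - k) a = Mk"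
    using comparison_spline_eq[OF le] .
  have r1: "r \<ge> 1" "r - (r - 2) = 2" using r by auto
  note sP = r1(1) a(1) b_pos l(1)
  have "Linf_norm (Psi r a b l) = ereal (b * psi_norm r a)"
    using shifted_Psi_norm[OF sP order_refl, of 0] r by (simp add: shifted_Psi_def[OF sP order_refl])
  then have C: "M0 - b * psi_norm r a \<ge> 0" using M0 a(2) by simp
  let ?x = "shifted_Psi r a b l (M0 - b * psi_norm r a)"
  show ?thesis
  proof (intro bexI[of _ ?x] conjI)
    show "?x \<in> Sobolev_inf_inf r" by (rule shifted_Psi_Sobolev[OF sP C])
    show "Linf_norm ?x = ereal M0" using shifted_Psi_norm[OF sP C, of 0] r by simp
    show "Linf_norm ((deriv ^^ k) ?x) = ereal Mk" using shifted_Psi_norm[OF sP C, of k] k a(3) by simp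
    show "Linf_norm ((deriv ^^ (r - 2)) ?x) = ereal Mr2"
      using shifted_Psi_norm[OF sP C, of "r - 2"] k r r1(2) psi_norm_2[OF a(1)] b_powers(2) by simp
    show "Linf_norm ((deriv ^^ r) ?x) = ereal Mr" using shifted_Psi_norm_top(2)[OF sP C] b_powers(1) by simp
  qed
qed

end

theorem theorem4:
  fixes r k :: nat and M0 Mk Mr2 Mr :: real
  assumes "r \<ge> 4" and "0 < k" and "k < r - 2"
    and "M0 > 0" and "Mk > 0" and "Mr2 > 0" and "Mr > 0"
  shows "(\<exists>x \<in> Sobolev_inf_inf r.
            Linf_norm x = ereal M0 \<and>
            Linf_norm ((deriv ^^ k) x) = ereal Mk \<and>
            Linf_norm ((deriv ^^ (r - 2)) x) = ereal Mr2 \<and>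
            Linf_norm ((deriv ^^ r) x) = ereal Mr)
     \<longleftrightarrow>
         (Mr2 \<le> real_of_ereal (Linf_norm (euler_spline 2))
                  / real_of_ereal (Linf_norm (euler_spline (r - k))) powr (2 / real (r - k))
                  * Mk powr (2 / real (r - k)) * Mr powr (real (r - k - 2) / real (r - k))
          \<and> ereal M0 \<ge> Linf_norm (comparison_spline r k Mk Mr2 Mr))"
proof -
  define l where "l = sqrt (Mr / (2 * Mr2))"
  define b where "b = Mr / l ^ r"
  have l: "l > 0" "l\<^sup>2 = Mr / (2 * Mr2)" using assms by (simp_all add: l_def)
  note ctx = assms(1-3,5-7) l b_def
  have q: "r - k \<ge> 3" using assms by simp
  have A: "Mr2 \<le> real_of_ereal (Linf_norm (euler_spline 2))
                  / real_of_ereal (Linf_norm (euler_spline (r - k))) powr (2 / real (r - k))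
                  * Mk powr (2 / real (r - k)) * Mr powr (real (r - k - 2) / real (r - k))
     \<longleftrightarrow> b * l ^ k * psi_norm (r - k) 0 \<le> Mk"
    using kolmogorov_condition_iff[OF q _ _ _ _ l(1) l(2), of "psi_norm (r - k) 0" Mk] assms q b_powers(3)[OF ctx]
    by (simp add: euler_spline_norm psi_norm_2 psi_norm_pos)
  show ?thesis
    unfolding A using necessity[OF ctx] sufficiency[OF ctx] assms(4) by blast
qed

end
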